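(* Let $(N,\xi)$ be a three-dimensional contact manifold contactomorphic to the space of null geodesics of a spacetime. Let $(Q,\mathcal{D})$ be an Engel manifold with Engel flag $\mathcal{W}\subset\mathcal{D}\subset\mathcal{E}\subset TQ$ such that $N\cong Q/\mathcal{W}$ and $\xi\cong p_*\mathcal{E}$, for $p:Q\to Q/\mathcal{W}$ the projection, and such that $Q$ admits an oriented foliation by circles $\mathcal{F}$ satisfying: i) for all $S\in\mathcal{F}$ and $x\in S$, $T_xS\oplus\mathcal{W}_x=\mathcal{D}_x$; ii) the space of leaves $M:=Q/\mathcal{F}$ is a manifold and the projection $q:Q\to M$ is a submersion; iii) for every $S\in\mathcal{F}$, the image $q_*\mathcal{D}|_S$ is a cone in the vector space $T_{q(S)}M$ and the map $x\in S\mapsto q_*\mathcal{D}_x$ is injective. Then $(Q,\mathcal{D})$ comes with a canonical local diffeomorphism $\Phi:Q\to\mathbb{S}(\xi)$ to the Cartan prolongation of $(N,\xi)$ compatible with the Engel structures.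
   Context: All manifolds are smooth. A spacetime is a time-oriented connected Lorentzian manifold $(M,g)$ of dimension $\geq 3$. Let $C^+\subset TM$ be the bundle of future-pointing null vectors. The space of null geodesics is $\mathcal{N}=\{\gamma(I) \mid \gamma:I\to M \text{ a maximal geodesic with } \dot\gamma\subset C^+\}$, identified with the leaf space $C^+/\langle X_g,\Delta\rangle$, where $X_g$ is the geodesic spray and $\Delta$ the Euler vector field on $TM$; only the case in which $\mathcal{N}$ is a manifold is considered. The sky of $x\in M$ is $\mathfrak{S}_x=\{\gamma\in\mathcal{N}\mid x\in\gamma\}$. The space $\mathcal{N}$ is a contact manifold with $\mathcal{H}_\gamma=T_\gamma\mathfrak{S}_x\oplus T_\gamma\mathfrak{S}_y$, where $x,y\in\gamma$ are points that cannot be joined by a one-parameter family of geodesics (independent of the choice). For distributions, $[\cdot,\cdot]$ means the bracket of sections. An Engel structure on a four-manifold $Q$ is a rank-two distribution $\mathcal{D}\subset TQ$ such that $\mathcal{E}:=[\mathcal{D},\mathcal{D}]$ is a rank-three distribution with $[\mathcal{E},\mathcal{E}]=TQ$; $(Q,\mathcal{D})$ is then an Engel manifold. It determines a unique line field $\mathcal{W}\subset\mathcal{E}$ with $[\mathcal{W},\mathcal{E}]\subseteq\mathcal{E}$, called the kernel; moreover $\mathcal{W}\subset\mathcal{D}$, giving the Engel flag. $Q/\mathcal{W}$ denotes the leaf space of the foliation tangent to $\mathcal{W}$; in $N\cong Q/\mathcal{W}$, $\xi\cong p_*\mathcal{E}$ it is understood that $Q/\mathcal{W}$ is a manifold, $p$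 is a submersion, and one diffeomorphism identifies $N$ with $Q/\mathcal{W}$ and $\xi$ with $p_*\mathcal{E}$. Under i) and ii), $q_*\mathcal{D}_x=T_xq(\mathcal{D}_x)$ is a line in $T_{q(x)}M$, and $q_*\mathcal{D}|_S$ is the union of these lines for $x\in S$; "cone" means the null cone of a Lorentzian inner product. Cartan prolongation: for a contact three-manifold $(N,\xi)$, $\pi_C:\mathbb{S}(\xi)\to N$ is the circle bundle with $\mathbb{S}(\xi)_x=(\xi_x\setminus\{0\})/\mathbb{R}^+$; its points are pairs $(x,R)$ with $R$ an oriented line in $\xi_x$. It carries the Engel structure $\widetilde{\mathcal{D}}_{(x,R)}:=(T_{(x,R)}\pi_C)^{-1}(R)$. Compatibility of $\Phi$ with the Engel structures means $T\Phi(\mathcal{D})=\widetilde{\mathcal{D}}$ along $\Phi$. *)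

theory Defs
  imports "HOL-Analysis.Analysis"
begin

section \<open>Smooth manifolds\<close>

primrec Ck_on :: "nat \<Rightarrow> 'e::euclidean_space set \<Rightarrow> ('e \<Rightarrow> 'f::euclidean_space) \<Rightarrow> bool" where
  "Ck_on 0 S f \<longleftrightarrow> continuous_on S f"
| "Ck_on (Suc k) S f \<longleftrightarrow>
     (\<forall>x\<in>S. f differentiable (at x)) \<and>
     (\<forall>v. Ck_on k S (\<lambda>x. frechet_derivative f (at x) v))"

text \<open>Openness of the domain is part of the definition. Through this clause \<open>smooth_map_on\<close>
  below also expresses continuity, because the chart domains to which it applies
  \<open>smooth_on\<close> contain preimages under the map.\<close>

definition smooth_on :: "'e::euclidean_space set \<Rightarrow> ('e \<Rightarrow> 'f::euclidean_space) \<Rightarrow> bool" where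
  "smooth_on S f \<longleftrightarrow> open S \<and> (\<forall>k. Ck_on k S f)"

text \<open>A manifold is given by an atlas, which determines the carrier and the topology.
  A chart is a pair of a domain and a coordinate map; only the values of the coordinate map
  on the domain matter. The dimension is that of the model space.\<close>

type_synonym ('a, 'e) chart = "'a set \<times> ('a \<Rightarrow> 'e)"
type_synonym ('a, 'e) atlas = "('a, 'e) chart set"

definition mcarrier :: "('a, 'e) atlas \<Rightarrow> 'a set" where
  "mcarrier A = \<Union>(fst ` A)"

definition mtop :: "('a, 'e::euclidean_space) atlas \<Rightarrow> 'a topology" where
  "mtop A = topology_generated_by {fst c \<inter> snd c -` V | c V. c \<in> A \<and> open V}"

definition chart_inv :: "('a, 'e) chart \<Rightarrow> 'e \<Rightarrow> 'a" where
  "chart_inv c = inv_into (fst c) (snd c)"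

definition smooth_manifold :: "('a, 'e::euclidean_space) atlas \<Rightarrow> bool" where
  "smooth_manifold A \<longleftrightarrow>
     (\<forall>c\<in>A. inj_on (snd c) (fst c) \<and> open (snd c ` fst c)) \<and>
     (\<forall>c\<in>A. \<forall>d\<in>A. smooth_on (snd c ` (fst c \<inter> fst d)) (snd d \<circ> chart_inv c)) \<and>
     Hausdorff_space (mtop A) \<and> second_countable (mtop A)"

definition smooth_map_on ::
    "('a, 'e::euclidean_space) atlas \<Rightarrow> ('b, 'f::euclidean_space) atlas \<Rightarrow> 'a set \<Rightarrow> ('a \<Rightarrow> 'b) \<Rightarrow> bool" where
  "smooth_map_on A B U f \<longleftrightarrow>
     openin (mtop A) U \<and> f ` U \<subseteq> mcarrier B \<and>
     (\<forall>c\<in>A. \<forall>d\<in>B. smooth_on (snd c ` (fst c \<inter> U \<inter> f -` fst d)) (snd d \<circ> f \<circ> chart_inv c))"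

definition eucl_atlas :: "('e, 'e) atlas" where
  "eucl_atlas = {(UNIV, id)}"

definition diffeo ::
    "('a, 'e::euclidean_space) atlas \<Rightarrow> ('b, 'f::euclidean_space) atlas \<Rightarrow> ('a \<Rightarrow> 'b) \<Rightarrow> bool" where
  "diffeo A B f \<longleftrightarrow>
     smooth_map_on A B (mcarrier A) f \<and> bij_betw f (mcarrier A) (mcarrier B) \<and>
     smooth_map_on B A (mcarrier B) (inv_into (mcarrier A) f)"

definition local_diffeo ::
    "('a, 'e::euclidean_space) atlas \<Rightarrow> ('b, 'f::euclidean_space) atlas \<Rightarrow> ('a \<Rightarrow> 'b) \<Rightarrow> bool" where
  "local_diffeo A B f \<longleftrightarrow>
     (\<forall>x\<in>mcarrier A. \<exists>U V. openin (mtop A) U \<and> x \<in> U \<and> openin (mtop B) V \<and>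
        bij_betw f U V \<and> smooth_map_on A B U f \<and> smooth_map_on B A V (inv_into U f))"


section \<open>Tangent vectors\<close>

text \<open>At each point \<open>x\<close> a preferred chart \<open>chart_at A x\<close> is fixed, and the tangent space at \<open>x\<close>
  is the model space, a vector being represented by its components in the preferred chart.
  A vector field is hence a function from points to the model space, but its smoothness has to be
  tested on its components \<open>tcoord A c x\<close> in charts \<open>c\<close>, because the preferred chart varies
  with the point. The map \<open>tvec A c x\<close> goes from components in \<open>c\<close> to components
  in the preferred chart.\<close>

definition chart_at :: "('a, 'e) atlas \<Rightarrow> 'a \<Rightarrow> ('a, 'e) chart" where
  "chart_at A x = (SOME c. c \<in> A \<and> x \<in> fst c)"

definition tcoord ::
    "('a, 'e::euclidean_space) atlas \<Rightarrow> ('a, 'e) chart \<Rightarrow> 'a \<Rightarrow> 'e \<Rightarrow> 'e" where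
  "tcoord A c x =
     frechet_derivative (snd c \<circ> chart_inv (chart_at A x)) (at (snd (chart_at A x) x))"

definition tvec ::
    "('a, 'e::euclidean_space) atlas \<Rightarrow> ('a, 'e) chart \<Rightarrow> 'a \<Rightarrow> 'e \<Rightarrow> 'e" where
  "tvec A c x = frechet_derivative (snd (chart_at A x) \<circ> chart_inv c) (at (snd c x))"

definition mderiv ::
    "('a, 'e::euclidean_space) atlas \<Rightarrow> ('b, 'f::euclidean_space) atlas \<Rightarrow> ('a \<Rightarrow> 'b) \<Rightarrow> 'a \<Rightarrow> 'e \<Rightarrow> 'f" where
  "mderiv A B f x =
     frechet_derivative (snd (chart_at B (f x)) \<circ> f \<circ> chart_inv (chart_at A x))
       (at (snd (chart_at A x) x))"

definition submersion ::
    "('a, 'e::euclidean_space) atlas \<Rightarrow> ('b, 'f::euclidean_space) atlas \<Rightarrow> ('a \<Rightarrow> 'b) \<Rightarrow> bool" where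
  "submersion A B f \<longleftrightarrow>
     smooth_map_on A B (mcarrier A) f \<and> (\<forall>x\<in>mcarrier A. surj (mderiv A B f x))"

text \<open>\<open>C\<close> is the smooth structure of an embedded submanifold with carrier \<open>K\<close>.\<close>

definition embedded_submanifold ::
    "('a, 'h::euclidean_space) atlas \<Rightarrow> ('a, 'e::euclidean_space) atlas \<Rightarrow> 'a set \<Rightarrow> bool" where
  "embedded_submanifold C A K \<longleftrightarrow>
     smooth_manifold C \<and> mcarrier C = K \<and> K \<subseteq> mcarrier A \<and>
     smooth_map_on C A K id \<and> (\<forall>x\<in>K. inj (mderiv C A id x)) \<and>
     mtop C = subtopology (mtop A) K"

definition tangent_atlas :: "('a, 'e::euclidean_space) atlas \<Rightarrow> ('a \<times> 'e, 'e \<times> 'e) atlas" where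
  "tangent_atlas A = (\<lambda>c. (fst c \<times> UNIV, \<lambda>(x, v). (snd c x, tcoord A c x v))) ` A"

definition smooth_curve :: "('a, 'e::euclidean_space) atlas \<Rightarrow> real set \<Rightarrow> (real \<Rightarrow> 'a) \<Rightarrow> bool" where
  "smooth_curve A I \<gamma> \<longleftrightarrow> smooth_map_on eucl_atlas A I \<gamma>"

definition velocity :: "('a, 'e::euclidean_space) atlas \<Rightarrow> (real \<Rightarrow> 'a) \<Rightarrow> real \<Rightarrow> 'e" where
  "velocity A \<gamma> t = mderiv eucl_atlas A \<gamma> t 1"

definition smooth_vf :: "('a, 'e::euclidean_space) atlas \<Rightarrow> 'a set \<Rightarrow> ('a \<Rightarrow> 'e) \<Rightarrow> bool" where
  "smooth_vf A U X \<longleftrightarrow>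
     openin (mtop A) U \<and>
     (\<forall>c\<in>A. smooth_on (snd c ` (fst c \<inter> U))
        (\<lambda>y. tcoord A c (chart_inv c y) (X (chart_inv c y))))"

definition lie_bracket ::
    "('a, 'e::euclidean_space) atlas \<Rightarrow> ('a \<Rightarrow> 'e) \<Rightarrow> ('a \<Rightarrow> 'e) \<Rightarrow> 'a \<Rightarrow> 'e" where
  "lie_bracket A X Y x =
     (let c = chart_at A x;
          X' = (\<lambda>y. tcoord A c (chart_inv c y) (X (chart_inv c y)));
          Y' = (\<lambda>y. tcoord A c (chart_inv c y) (Y (chart_inv c y)));
          y = snd c x
      in frechet_derivative Y' (at y) (X' y) - frechet_derivative X' (at y) (Y' y))"


section \<open>Distributions, contact structures and Engel structures\<close>

definition distribution ::
    "('a, 'e::euclidean_space) atlas \<Rightarrow> nat \<Rightarrow> ('a \<Rightarrow> 'e set) \<Rightarrow> bool" where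
  "distribution A k D \<longleftrightarrow>
     (\<forall>x\<in>mcarrier A. \<exists>U X. openin (mtop A) U \<and> x \<in> U \<and> (\<forall>i<k. smooth_vf A U (X i)) \<and>
        (\<forall>y\<in>U. inj_on (\<lambda>i::nat. X i y) {..<k} \<and> independent ((\<lambda>i. X i y) ` {..<k}) \<and>
           D y = span ((\<lambda>i. X i y) ` {..<k})))"

definition section_on ::
    "('a, 'e::euclidean_space) atlas \<Rightarrow> ('a \<Rightarrow> 'e set) \<Rightarrow> 'a set \<Rightarrow> ('a \<Rightarrow> 'e) \<Rightarrow> bool" where
  "section_on A D U X \<longleftrightarrow> smooth_vf A U X \<and> (\<forall>x\<in>U. X x \<in> D x)"

definition dist_bracket ::
    "('a, 'e::euclidean_space) atlas \<Rightarrow> ('a \<Rightarrow> 'e set) \<Rightarrow> ('a \<Rightarrow> 'e set) \<Rightarrow> 'a \<Rightarrow> 'e set" where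
  "dist_bracket A D E x =
     span {lie_bracket A X Y x | X Y. \<exists>U. x \<in> U \<and> section_on A D U X \<and> section_on A E U Y}"

definition direct_sum :: "'e::real_vector set \<Rightarrow> 'e set \<Rightarrow> 'e set \<Rightarrow> bool" where
  "direct_sum U V Z \<longleftrightarrow> U \<inter> V = {0} \<and> Z = {u + v | u v. u \<in> U \<and> v \<in> V}"

text \<open>A hyperplane field such that the form sending sections \<open>X\<close>, \<open>Y\<close> of it to
  the class of their bracket modulo the field is nondegenerate at every point.\<close>

definition contact_structure :: "('a, 'e::euclidean_space) atlas \<Rightarrow> ('a \<Rightarrow> 'e set) \<Rightarrow> bool" where
  "contact_structure A \<xi> \<longleftrightarrow>
     distribution A (DIM('e) - 1) \<xi> \<and>
     (\<forall>x\<in>mcarrier A. \<forall>U X. x \<in> U \<longrightarrow> section_on A \<xi> U X \<longrightarrow> X x \<noteq> 0 \<longrightarrow>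
        (\<exists>V Y. x \<in> V \<and> section_on A \<xi> V Y \<and> lie_bracket A X Y x \<notin> \<xi> x))"

definition contactomorphic ::
    "('a, 'e::euclidean_space) atlas \<Rightarrow> ('a \<Rightarrow> 'e set) \<Rightarrow> ('b, 'f::euclidean_space) atlas \<Rightarrow> ('b \<Rightarrow> 'f set) \<Rightarrow> bool" where
  "contactomorphic A \<xi> B \<eta> \<longleftrightarrow>
     (\<exists>f. diffeo A B f \<and> (\<forall>x\<in>mcarrier A. mderiv A B f x ` \<xi> x = \<eta> (f x)))"

definition engel_structure :: "('a, 'e::euclidean_space) atlas \<Rightarrow> ('a \<Rightarrow> 'e set) \<Rightarrow> bool" where
  "engel_structure A D \<longleftrightarrow>
     DIM('e) = 4 \<and> distribution A 2 D \<and> distribution A 3 (dist_bracket A D D) \<and>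
     (\<forall>x\<in>mcarrier A. dist_bracket A (dist_bracket A D D) (dist_bracket A D D) x = UNIV)"

definition engel_kernel ::
    "('a, 'e::euclidean_space) atlas \<Rightarrow> ('a \<Rightarrow> 'e set) \<Rightarrow> ('a \<Rightarrow> 'e set) \<Rightarrow> bool" where
  "engel_kernel A D W \<longleftrightarrow>
     distribution A 1 W \<and>
     (\<forall>x\<in>mcarrier A. W x \<subseteq> dist_bracket A D D x \<and>
        dist_bracket A W (dist_bracket A D D) x \<subseteq> dist_bracket A D D x)"


section \<open>Leaf spaces and oriented foliations by circles\<close>

text \<open>The leaf through \<open>x\<close> of the foliation tangent to the line field \<open>W\<close> consists of the
  points that can be reached from \<open>x\<close> along curves tangent to \<open>W\<close>.\<close>

definition leaf :: "('a, 'e::euclidean_space) atlas \<Rightarrow> ('a \<Rightarrow> 'e set) \<Rightarrow> 'a \<Rightarrow> 'a set" where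
  "leaf A W x =
     {y. \<exists>\<gamma> J. open J \<and> is_interval J \<and> {0..1} \<subseteq> J \<and> smooth_curve A J \<gamma> \<and>
           (\<forall>t\<in>J. velocity A \<gamma> t \<in> W (\<gamma> t)) \<and> \<gamma> 0 = x \<and> \<gamma> 1 = y}"

definition leaf_space :: "('a, 'e::euclidean_space) atlas \<Rightarrow> ('a \<Rightarrow> 'e set) \<Rightarrow> 'a set set" where
  "leaf_space A W = leaf A W ` mcarrier A"

text \<open>The leaf space of \<open>W\<close> is a manifold with smooth structure \<open>L\<close>, and the projection,
  sending a point to its leaf, is a submersion.\<close>

definition leaf_manifold ::
    "('a, 'e::euclidean_space) atlas \<Rightarrow> ('a \<Rightarrow> 'e set) \<Rightarrow> ('a set, 'f::euclidean_space) atlas \<Rightarrow> bool" where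
  "leaf_manifold A W L \<longleftrightarrow>
     smooth_manifold L \<and> mcarrier L = leaf_space A W \<and> submersion A L (leaf A W)"

definition ray :: "'e::real_vector \<Rightarrow> 'e set" where
  "ray v = {t *\<^sub>R v | t. t > 0}"

text \<open>An oriented line field assigns to each point the ray of its positively oriented vectors.\<close>

definition oriented_line_field :: "('a, 'e::euclidean_space) atlas \<Rightarrow> ('a \<Rightarrow> 'e set) \<Rightarrow> bool" where
  "oriented_line_field A R \<longleftrightarrow>
     (\<forall>x\<in>mcarrier A. \<exists>U X. x \<in> U \<and> smooth_vf A U X \<and> (\<forall>y\<in>U. X y \<noteq> 0 \<and> R y = ray (X y)))"

definition unoriented :: "('a \<Rightarrow> 'e::euclidean_space set) \<Rightarrow> 'a \<Rightarrow> 'e set" where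
  "unoriented R x = span (R x)"

text \<open>An oriented foliation by circles is given by its oriented tangent line field \<open>R\<close>; its leaves
  are those of \<open>unoriented R\<close>, and \<open>unoriented R x\<close> is the tangent space at \<open>x\<close> of the leaf
  through \<open>x\<close>. Each leaf is the image of an injective immersion of the circle,
  the latter viewed as the quotient of the reals by the integers.\<close>

definition oriented_circle_foliation ::
    "('a, 'e::euclidean_space) atlas \<Rightarrow> ('a \<Rightarrow> 'e set) \<Rightarrow> bool" where
  "oriented_circle_foliation A R \<longleftrightarrow>
     oriented_line_field A R \<and>
     (\<forall>S\<in>leaf_space A (unoriented R). \<exists>\<gamma>. smooth_curve A UNIV \<gamma> \<and> range \<gamma> = S \<and>
        (\<forall>s t. \<gamma> s = \<gamma> t \<longleftrightarrow> s - t \<in> \<int>) \<and> (\<forall>t. velocity A \<gamma> t \<in> R (\<gamma> t)))"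


section \<open>Spacetimes and their null geodesics\<close>

text \<open>A bilinear form that a linear isomorphism identifies with the Minkowski form of signature
  \<open>(-, +, \<dots>, +)\<close>; \<open>t\<close> is the negative basis direction.\<close>

definition lorentz_form :: "('e::euclidean_space \<Rightarrow> 'e \<Rightarrow> real) \<Rightarrow> bool" where
  "lorentz_form b \<longleftrightarrow>
     (\<exists>(f :: 'e \<Rightarrow> 'e) t. linear f \<and> bij f \<and> t \<in> Basis \<and>
        (\<forall>u v. b (f u) (f v) = u \<bullet> v - 2 * (u \<bullet> t) * (v \<bullet> t)))"

definition is_null_cone :: "'e::euclidean_space set \<Rightarrow> bool" where
  "is_null_cone K \<longleftrightarrow> (\<exists>b. lorentz_form b \<and> K = {v. b v v = 0})"

definition metric_coord ::
    "('m, 'e::euclidean_space) atlas \<Rightarrow> ('m \<Rightarrow> 'e \<Rightarrow> 'e \<Rightarrow> real) \<Rightarrow> ('m, 'e) chart \<Rightarrow> 'e \<Rightarrow> 'e \<Rightarrow> 'e \<Rightarrow> real" where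
  "metric_coord A g c y u v =
     (let x = chart_inv c y in g x (tvec A c x u) (tvec A c x v))"

definition lorentz_metric ::
    "('m, 'e::euclidean_space) atlas \<Rightarrow> ('m \<Rightarrow> 'e \<Rightarrow> 'e \<Rightarrow> real) \<Rightarrow> bool" where
  "lorentz_metric A g \<longleftrightarrow>
     (\<forall>x\<in>mcarrier A. lorentz_form (g x)) \<and>
     (\<forall>c\<in>A. \<forall>u v. smooth_on (snd c ` fst c) (\<lambda>y. metric_coord A g c y u v))"

text \<open>A time orientation is a smooth choice \<open>fut x\<close> of one of the two timecones at each point.\<close>

definition time_orientation ::
    "('m, 'e::euclidean_space) atlas \<Rightarrow> ('m \<Rightarrow> 'e \<Rightarrow> 'e \<Rightarrow> real) \<Rightarrow> ('m \<Rightarrow> 'e set) \<Rightarrow> bool" where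
  "time_orientation A g fut \<longleftrightarrow>
     (\<forall>x\<in>mcarrier A. \<exists>U X. x \<in> U \<and> smooth_vf A U X \<and>
        (\<forall>y\<in>U. g y (X y) (X y) < 0 \<and> fut y = {v. g y v v < 0 \<and> g y v (X y) < 0}))"

definition spacetime ::
    "('m, 'e::euclidean_space) atlas \<Rightarrow> ('m \<Rightarrow> 'e \<Rightarrow> 'e \<Rightarrow> real) \<Rightarrow> ('m \<Rightarrow> 'e set) \<Rightarrow> bool" where
  "spacetime A g fut \<longleftrightarrow>
     DIM('e) \<ge> 3 \<and> smooth_manifold A \<and> connected_space (mtop A) \<and>
     lorentz_metric A g \<and> time_orientation A g fut"

definition future_null_bundle ::
    "('m, 'e::euclidean_space) atlas \<Rightarrow> ('m \<Rightarrow> 'e \<Rightarrow> 'e \<Rightarrow> real) \<Rightarrow> ('m \<Rightarrow> 'e set) \<Rightarrow> ('m \<times> 'e) set" where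
  "future_null_bundle A g fut =
     {(x, v). x \<in> mcarrier A \<and> v \<noteq> 0 \<and> g x v v = 0 \<and> v \<in> closure (fut x)}"

text \<open>The Christoffel symbols of the Levi-Civita connection in the chart \<open>c\<close>, as a bilinear map.\<close>

definition christoffel ::
    "('m, 'e::euclidean_space) atlas \<Rightarrow> ('m \<Rightarrow> 'e \<Rightarrow> 'e \<Rightarrow> real) \<Rightarrow> ('m, 'e) chart \<Rightarrow> 'e \<Rightarrow> 'e \<Rightarrow> 'e \<Rightarrow> 'e" where
  "christoffel A g c y u v =
     (THE z. \<forall>w. metric_coord A g c y z w =
        (frechet_derivative (\<lambda>y. metric_coord A g c y v w) (at y) u +
         frechet_derivative (\<lambda>y. metric_coord A g c y u w) (at y) v -
         frechet_derivative (\<lambda>y. metric_coord A g c y u v) (at y) w) / 2)"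

definition geodesic ::
    "('m, 'e::euclidean_space) atlas \<Rightarrow> ('m \<Rightarrow> 'e \<Rightarrow> 'e \<Rightarrow> real) \<Rightarrow> real set \<Rightarrow> (real \<Rightarrow> 'm) \<Rightarrow> bool" where
  "geodesic A g I \<gamma> \<longleftrightarrow>
     open I \<and> is_interval I \<and> I \<noteq> {} \<and> smooth_curve A I \<gamma> \<and>
     (\<forall>c\<in>A. \<forall>t\<in>I. \<gamma> t \<in> fst c \<longrightarrow>
        (let u = snd c \<circ> \<gamma>; u' = (\<lambda>s. vector_derivative u (at s))
         in vector_derivative u' (at t) + christoffel A g c (u t) (u' t) (u' t) = 0))"

definition maximal_null_geodesic ::
    "('m, 'e::euclidean_space) atlas \<Rightarrow> ('m \<Rightarrow> 'e \<Rightarrow> 'e \<Rightarrow> real) \<Rightarrow> ('m \<Rightarrow> 'e set) \<Rightarrow> real set \<Rightarrow> (real \<Rightarrow> 'm) \<Rightarrow> bool" where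
  "maximal_null_geodesic A g fut I \<gamma> \<longleftrightarrow>
     geodesic A g I \<gamma> \<and>
     (\<forall>J \<delta>. geodesic A g J \<delta> \<longrightarrow> I \<subseteq> J \<longrightarrow> (\<forall>t\<in>I. \<delta> t = \<gamma> t) \<longrightarrow> J = I) \<and>
     (\<forall>t\<in>I. (\<gamma> t, velocity A \<gamma> t) \<in> future_null_bundle A g fut)"

definition null_geodesics ::
    "('m, 'e::euclidean_space) atlas \<Rightarrow> ('m \<Rightarrow> 'e \<Rightarrow> 'e \<Rightarrow> real) \<Rightarrow> ('m \<Rightarrow> 'e set) \<Rightarrow> 'm set set" where
  "null_geodesics A g fut = {\<gamma> ` I | \<gamma> I. maximal_null_geodesic A g fut I \<gamma>}"

definition null_geodesic_through ::
    "('m, 'e::euclidean_space) atlas \<Rightarrow> ('m \<Rightarrow> 'e \<Rightarrow> 'e \<Rightarrow> real) \<Rightarrow> ('m \<Rightarrow> 'e set) \<Rightarrow> 'm \<times> 'e \<Rightarrow> 'm set" where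
  "null_geodesic_through A g fut w =
     (THE G. \<exists>\<gamma> I t. maximal_null_geodesic A g fut I \<gamma> \<and> t \<in> I \<and>
        (\<gamma> t, velocity A \<gamma> t) = w \<and> G = \<gamma> ` I)"

text \<open>\<open>N\<close> is the manifold structure of the space of null geodesics as a leaf space of the bundle of
  future-pointing null vectors. The latter carries its smooth structure \<open>C\<close> as a submanifold
  of the tangent bundle. The leaves of the foliation spanned by the geodesic spray and the Euler
  field are the fibres of \<open>null_geodesic_through\<close>.\<close>

definition null_geodesic_manifold ::
    "('m, 'e::euclidean_space) atlas \<Rightarrow> ('m \<Rightarrow> 'e \<Rightarrow> 'e \<Rightarrow> real) \<Rightarrow> ('m \<Rightarrow> 'e set) \<Rightarrow>
     ('m \<times> 'e, 'h::euclidean_space) atlas \<Rightarrow> ('m set, 'k::euclidean_space) atlas \<Rightarrow> bool" where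
  "null_geodesic_manifold A g fut C N \<longleftrightarrow>
     embedded_submanifold C (tangent_atlas A) (future_null_bundle A g fut) \<and>
     smooth_manifold N \<and> mcarrier N = null_geodesics A g fut \<and>
     submersion C N (null_geodesic_through A g fut)"

definition sky ::
    "('m, 'e::euclidean_space) atlas \<Rightarrow> ('m \<Rightarrow> 'e \<Rightarrow> 'e \<Rightarrow> real) \<Rightarrow> ('m \<Rightarrow> 'e set) \<Rightarrow> 'm \<Rightarrow> 'm set set" where
  "sky A g fut x = {G \<in> null_geodesics A g fut. x \<in> G}"

text \<open>The tangent space at \<open>x\<close> of a submanifold with underlying set \<open>S\<close>.\<close>

definition tangent_to_subset :: "('a, 'e::euclidean_space) atlas \<Rightarrow> 'a set \<Rightarrow> 'a \<Rightarrow> 'e set" where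
  "tangent_to_subset A S x =
     {velocity A \<delta> 0 | \<delta>. smooth_curve A {-1<..<1} \<delta> \<and> \<delta> ` {-1<..<1} \<subseteq> S \<and> \<delta> 0 = x}"

text \<open>The points \<open>\<gamma> a\<close> and \<open>\<gamma> b\<close> are joined by a nonconstant smooth one-parameter family of
  geodesics that starts at \<open>\<gamma>\<close> and has fixed endpoints.\<close>

definition joined_by_family ::
    "('m, 'e::euclidean_space) atlas \<Rightarrow> ('m \<Rightarrow> 'e \<Rightarrow> 'e \<Rightarrow> real) \<Rightarrow> (real \<Rightarrow> 'm) \<Rightarrow> real \<Rightarrow> real \<Rightarrow> bool" where
  "joined_by_family A g \<gamma> a b \<longleftrightarrow>
     (\<exists>J (\<Gamma> :: real \<times> real \<Rightarrow> 'm). {a..b} \<subseteq> J \<and> smooth_map_on eucl_atlas A ({-1<..<1} \<times> J) \<Gamma> \<and>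
        (\<forall>t\<in>J. \<Gamma> (0, t) = \<gamma> t) \<and>
        (\<forall>s\<in>{-1<..<1}. geodesic A g J (\<lambda>t. \<Gamma> (s, t)) \<and> \<Gamma> (s, a) = \<gamma> a \<and> \<Gamma> (s, b) = \<gamma> b) \<and>
        (\<exists>s\<in>{-1<..<1}. \<exists>t\<in>J. \<Gamma> (s, t) \<noteq> \<gamma> t))"

text \<open>The contact hyperplane at a null geodesic is the direct sum of the tangent spaces to the skies
  of two of its points that are not joined by a one-parameter family of geodesics; it does not
  depend on these points.\<close>

definition null_geodesic_contact ::
    "('m, 'e::euclidean_space) atlas \<Rightarrow> ('m \<Rightarrow> 'e \<Rightarrow> 'e \<Rightarrow> real) \<Rightarrow> ('m \<Rightarrow> 'e set) \<Rightarrow>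
     ('m set, 'k::euclidean_space) atlas \<Rightarrow> ('m set \<Rightarrow> 'k set) \<Rightarrow> bool" where
  "null_geodesic_contact A g fut N H \<longleftrightarrow>
     (\<forall>G\<in>null_geodesics A g fut. \<exists>\<gamma> I a b.
        maximal_null_geodesic A g fut I \<gamma> \<and> G = \<gamma> ` I \<and> a \<in> I \<and> b \<in> I \<and> a < b \<and>
        \<not> joined_by_family A g \<gamma> a b \<and>
        direct_sum (tangent_to_subset N (sky A g fut (\<gamma> a)) G)
                   (tangent_to_subset N (sky A g fut (\<gamma> b)) G) (H G))"


section \<open>The Cartan prolongation\<close>

text \<open>Oriented lines are represented by open rays.\<close>

definition cartan_prolongation ::
    "('a, 'e::euclidean_space) atlas \<Rightarrow> ('a \<Rightarrow> 'e set) \<Rightarrow> ('a \<times> 'e set) set" where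
  "cartan_prolongation A \<xi> =
     {(x, R). x \<in> mcarrier A \<and> (\<exists>v\<in>\<xi> x. v \<noteq> 0 \<and> R = ray v)}"

text \<open>A chart \<open>c\<close> and a frame \<open>X\<close>, \<open>Y\<close> of \<open>\<xi>\<close> over an open subset \<open>U\<close> of its domain induce a
  chart of the prolongation: over \<open>U\<close> it covers the rays spanned by \<open>X + s Y\<close> with \<open>s\<close> real, with
  fibre coordinate \<open>s\<close>. Each ray occurs for some frame, as \<open>X\<close> can be any local section.\<close>

definition cartan_chart ::
    "('a, 'e::euclidean_space) atlas \<Rightarrow> ('a \<Rightarrow> 'e set) \<Rightarrow> ('a, 'e) chart \<Rightarrow> 'a set \<Rightarrow>
     ('a \<Rightarrow> 'e) \<Rightarrow> ('a \<Rightarrow> 'e) \<Rightarrow> ('a \<times> 'e set, 'e \<times> real) chart" where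
  "cartan_chart A \<xi> c U X Y =
     ({(x, R) \<in> cartan_prolongation A \<xi>. x \<in> U \<and> (\<exists>s. R = ray (X x + s *\<^sub>R Y x))},
      \<lambda>(x, R). (snd c x, THE s. R = ray (X x + s *\<^sub>R Y x)))"

definition cartan_atlas ::
    "('a, 'e::euclidean_space) atlas \<Rightarrow> ('a \<Rightarrow> 'e set) \<Rightarrow> ('a \<times> 'e set, 'e \<times> real) atlas" where
  "cartan_atlas A \<xi> =
     {cartan_chart A \<xi> c U X Y | c U X Y.
        c \<in> A \<and> U \<subseteq> fst c \<and> section_on A \<xi> U X \<and> section_on A \<xi> U Y \<and>
        (\<forall>x\<in>U. \<forall>a b. a *\<^sub>R X x + b *\<^sub>R Y x = 0 \<longrightarrow> a = 0 \<and> b = 0)}"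

text \<open>The bundle projection of the prolongation is \<open>fst\<close>.\<close>

definition cartan_engel ::
    "('a, 'e::euclidean_space) atlas \<Rightarrow> ('a \<Rightarrow> 'e set) \<Rightarrow> 'a \<times> 'e set \<Rightarrow> ('e \<times> real) set" where
  "cartan_engel A \<xi> z = mderiv (cartan_atlas A \<xi>) A fst z -` span (snd z)"

text \<open>The canonical map to the Cartan prolongation sends \<open>x\<close> to its image in \<open>N\<close>, together with the
  image in \<open>\<xi>\<close> of the line that \<open>\<D>\<close> induces at \<open>x\<close>. As \<open>\<D>\<close> is the sum of the tangent line of
  the circle foliation and the kernel \<open>\<W>\<close>, this image is spanned by the tangent line of the circle,
  which also orients it. Here \<open>L\<close> is the smooth structure of the leaf space of \<open>W\<close> and \<open>\<psi>\<close> its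
  identification with \<open>N\<close>.\<close>

definition prolongation_map ::
    "('q, 'e::euclidean_space) atlas \<Rightarrow> ('q \<Rightarrow> 'e set) \<Rightarrow> ('q \<Rightarrow> 'e set) \<Rightarrow>
     ('q set, 'f::euclidean_space) atlas \<Rightarrow> ('n, 'k::euclidean_space) atlas \<Rightarrow> ('q set \<Rightarrow> 'n) \<Rightarrow>
     'q \<Rightarrow> 'n \<times> 'k set" where
  "prolongation_map Q W R L N \<psi> x =
     (let p = leaf Q W
      in (\<psi> (p x), (\<lambda>v. mderiv L N \<psi> (p x) (mderiv Q L p x v)) ` R x))"

end

(* The kernel line field W is the kernel of the differential of p, so dP (for P = psi o p) maps D at x
   onto a line of xi, and the orientation of the circle through x orients this line; this is the map
   Phi. In fibre coordinates of the prolongation, moving along W turns this line, because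
   [D, D] has rank three and hence [w, r] is not in D for sections w of W and r of the circle
   direction. So Phi is an immersion between four-manifolds. Since the bundle projection composed
   with Phi is P, the preimage of the tautological line under d(pi) is the image of D. *)

theory Submission
  imports Defs
begin

section \<open>Calculus of smooth maps between Euclidean spaces\<close>

text \<open>Leaves of \<open>W\<close> are described by curves, so no flow of \<open>W\<close> is at
  hand to show that dp vanishes on \<open>W\<close>. This is obtained by contradiction: if dp did
  not vanish on \<open>W\<close> near a point, curves tangent to \<open>W\<close> could not move
  there, leaves would be points, and p would map an open set injectively into a space of lower
  dimension. That the kernel is not larger is a dimension count. The turning of the line rests on
  dP([w, r]) = w(dP(r)) - r(dP(w)): the second derivatives of P cancel by symmetry, and the last
  term is zero because w lies in the kernel. Vectors are components in a preferred chart that varies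
  with the point. Smoothness is therefore treated in arbitrary charts, whereas injectivity of
  d\<Phi> at a point is proved in the preferred chart, where brackets are computed, and carried over
  to the others. A local diffeomorphism needs a smooth inverse in all charts. Cramer's rule makes
  the inverse of a smooth family of linear maps smooth, and this raises the regularity of a local
  inverse order by order.\<close>

lemma frechet_derivative_cong_open:
  assumes "open S" "x \<in> S" "\<And>y. y \<in> S \<Longrightarrow> f y = g y"
  shows "frechet_derivative f (at x) = frechet_derivative g (at x)"
proof -
  have "(f has_derivative f') (at x) \<longleftrightarrow> (g has_derivative f') (at x)" for f'
    using has_derivative_transform_within_open[OF _ assms(1,2)] assms(3) by metis
  then show ?thesis unfolding frechet_derivative_def by simp
qed

lemma Ck_on_cong:
  assumes "open S" "\<And>x. x \<in> S \<Longrightarrow> f x = g x" "Ck_on k S f"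
  shows "Ck_on k S g"
  using assms(2,3)
proof (induction k arbitrary: f g)
  case 0
  then show ?case by (auto cong: continuous_on_cong)
next
  case (Suc k)
  have d: "frechet_derivative f (at x) = frechet_derivative g (at x)" if "x \<in> S" for x
    using frechet_derivative_cong_open[OF assms(1) that] Suc(2) by blast
  have "g differentiable (at x)" if "x \<in> S" for x
  proof -
    from Suc(3) that obtain f' where f': "(f has_derivative f') (at x)"
      unfolding Ck_on.simps(2) differentiable_def by blast
    have "(g has_derivative f') (at x)"
      by (rule has_derivative_transform_within_open[OF f' assms(1) that]) (rule Suc(2))
    then show ?thesis by (rule differentiableI)
  qed
  moreover have "Ck_on k S (\<lambda>x. frechet_derivative g (at x) v)" for v
    by (rule Suc.IH[of "\<lambda>x. frechet_derivative f (at x) v"]) (use d Suc in auto)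
  ultimately show ?case by auto
qed

text \<open>\<open>Ck_on\<close> refers to the derivative chosen by
  \<open>frechet_derivative\<close>. This rule accepts any explicit formula for it, so that the
  inductions on \<open>k\<close> below come down to calculus rules.\<close>

lemma Ck_on_has_derivativeI:
  assumes "open S" "\<And>x. x \<in> S \<Longrightarrow> (f has_derivative f' x) (at x)"
    "\<And>v. Ck_on k S (\<lambda>x. f' x v)"
  shows "Ck_on (Suc k) S f"
proof -
  have eq: "f' x = frechet_derivative f (at x)" if "x \<in> S" for x
    by (rule frechet_derivative_at[OF assms(2)[OF that]])
  have "Ck_on k S (\<lambda>x. frechet_derivative f (at x) v)" for v
    by (rule Ck_on_cong[OF assms(1) _ assms(3)]) (simp add: eq)
  then show ?thesis using assms(2) by (auto simp: differentiable_def)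
qed

lemma Ck_on_has_derivative:
  assumes "Ck_on (Suc k) S f" "x \<in> S"
  shows "(f has_derivative frechet_derivative f (at x)) (at x)"
  using assms frechet_derivative_works by auto

lemma Ck_on_SucD: "Ck_on (Suc k) S f \<Longrightarrow> Ck_on k S f"
proof (induction k arbitrary: f)
  case 0
  then show ?case
    by (auto intro!: continuous_at_imp_continuous_on differentiable_imp_continuous_within)
qed auto

lemma Ck_on_subset: "Ck_on k S f \<Longrightarrow> T \<subseteq> S \<Longrightarrow> Ck_on k T f"
  by (induction k arbitrary: f) (auto intro: continuous_on_subset)

lemma Ck_on_locally:
  assumes "\<And>x. x \<in> S \<Longrightarrow> \<exists>T. open T \<and> x \<in> T \<and> Ck_on k T f"
  shows "Ck_on k S f"
  using assms
proof (induction k arbitrary: f)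
  case 0
  have "continuous (at x) f" if x: "x \<in> S" for x
  proof -
    obtain T where "open T" "x \<in> T" "continuous_on T f" using 0[OF x] by auto
    then show ?thesis by (simp add: continuous_on_eq_continuous_at)
  qed
  then show ?case by (simp add: continuous_at_imp_continuous_on)
next
  case (Suc k)
  show ?case
  proof (simp, intro conjI ballI allI)
    show "f differentiable at x" if "x \<in> S" for x
      using Suc(2)[OF that] by auto
    show "Ck_on k S (\<lambda>x. frechet_derivative f (at x) v)" for v
      by (rule Suc.IH) (use Suc(2) in fastforce)
  qed
qed

lemma Ck_on_const: "open S \<Longrightarrow> Ck_on k S (\<lambda>x. c)"
proof (induction k arbitrary: c)
  case (Suc k)
  show ?case
    by (rule Ck_on_has_derivativeI[where f' = "\<lambda>x v. 0"]) (use Suc in auto)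
qed simp

lemma Ck_on_linear:
  assumes "open S" "bounded_linear L" "Ck_on k S f"
  shows "Ck_on k S (\<lambda>x. L (f x))"
  using assms(3)
proof (induction k arbitrary: f)
  case 0
  then show ?case using bounded_linear.continuous_on[OF assms(2)] by auto
next
  case (Suc k)
  show ?case
    by (rule Ck_on_has_derivativeI[where f' = "\<lambda>x v. L (frechet_derivative f (at x) v)"])
      (use Suc assms Ck_on_has_derivative[OF Suc(2)] in \<open>auto intro!: bounded_linear.has_derivative[OF assms(2)]\<close>)
qed

lemma Ck_on_add:
  assumes "open S" "Ck_on k S f" "Ck_on k S g"
  shows "Ck_on k S (\<lambda>x. f x + g x)"
  using assms(2,3)
proof (induction k arbitrary: f g)
  case (Suc k)
  show ?case
    by (rule Ck_on_has_derivativeI[where f' = "\<lambda>x v. frechet_derivative f (at x) v + frechet_derivative g (at x) v"])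
      (use Suc assms Ck_on_has_derivative[OF Suc(2)] Ck_on_has_derivative[OF Suc(3)] has_derivative_add in auto)
qed (auto intro: continuous_intros)

text \<open>The product rule expresses the derivative through the same bilinear map with factors one
  order lower. One induction with \<open>f\<close> and \<open>g\<close> arbitrary thus covers scalar
  multiples, products and inner products.\<close>

lemma Ck_on_bilinear:
  assumes "open S" "bounded_bilinear b" "Ck_on k S f" "Ck_on k S g"
  shows "Ck_on k S (\<lambda>x. b (f x) (g x))"
  using assms(3,4)
proof (induction k arbitrary: f g)
  case 0
  then show ?case using bounded_bilinear.continuous_on[OF assms(2)] by auto
next
  case (Suc k)
  show ?case
  proof (rule Ck_on_has_derivativeI[OF assms(1)])
    show "((\<lambda>x. b (f x) (g x)) has_derivative
        (\<lambda>v. b (f x) (frechet_derivative g (at x) v) + b (frechet_derivative f (at x) v) (g x))) (at x)"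
      if "x \<in> S" for x
      using bounded_bilinear.FDERIV[OF assms(2)] Ck_on_has_derivative[OF Suc(2) that]
        Ck_on_has_derivative[OF Suc(3) that] by blast
    show "Ck_on k S (\<lambda>x. b (f x) (frechet_derivative g (at x) v) + b (frechet_derivative f (at x) v) (g x))" for v
      using Suc.prems Suc.prems[THEN Ck_on_SucD] by (intro Ck_on_add assms Suc.IH) simp_all
  qed
qed

lemma Ck_on_sum:
  assumes "open S" "\<And>i. i \<in> I \<Longrightarrow> Ck_on k S (f i)"
  shows "Ck_on k S (\<lambda>x. \<Sum>i\<in>I. f i x)"
  using assms(2)
  by (induction I rule: infinite_finite_induct) (auto intro: Ck_on_const Ck_on_add assms(1))

text \<open>\<open>Ck_on\<close> controls derivatives in fixed directions only. Expanding a moving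
  direction in the basis reduces to these.\<close>

lemma linear_sum_Basis:
  fixes f :: "'a::euclidean_space \<Rightarrow> 'b::real_vector"
  assumes "linear f"
  shows "f u = (\<Sum>b\<in>Basis. (u \<bullet> b) *\<^sub>R f b)"
proof -
  have "f u = f (\<Sum>b\<in>Basis. (u \<bullet> b) *\<^sub>R b)" by (simp only: euclidean_representation)
  then show ?thesis by (simp add: linear_sum[OF assms] linear_scale[OF assms])
qed

text \<open>The chain rule evaluates the derivative of \<open>g\<close> in a direction that moves
  with the point; after the basis expansion it is a sum of products of functions of class
  \<open>C^k\<close>. The induction varies \<open>g\<close> alone: \<open>f\<close> recurs unchanged
  inside the derivative of \<open>g\<close> and is controlled at the lower order by
  \<open>Ck_on_SucD\<close>.\<close>

lemma Ck_on_compose: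
  assumes "open S" "open T" "f ` S \<subseteq> T" "Ck_on k T g" "Ck_on k S f"
  shows "Ck_on k S (\<lambda>x. g (f x))"
  using assms(4,5)
proof (induction k arbitrary: g)
  case 0
  then show ?case using continuous_on_compose2[of T g S f] assms(3) by simp
next
  case (Suc k)
  let ?Df = "\<lambda>x. frechet_derivative f (at x)" and ?Dg = "\<lambda>x. frechet_derivative g (at x)"
  show ?case
  proof (rule Ck_on_has_derivativeI[OF assms(1)])
    show "((\<lambda>x. g (f x)) has_derivative (\<lambda>v. \<Sum>b\<in>Basis. (?Df x v \<bullet> b) *\<^sub>R ?Dg (f x) b)) (at x)"
      if x: "x \<in> S" for x
    proof -
      have g: "(g has_derivative ?Dg (f x)) (at (f x))"
        using Ck_on_has_derivative[OF Suc(2)] assms(3) x by blast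
      have "((\<lambda>x. g (f x)) has_derivative (\<lambda>v. ?Dg (f x) (?Df x v))) (at x)"
        using diff_chain_at[OF Ck_on_has_derivative[OF Suc(3) x] g] by (simp add: o_def)
      moreover have "(\<lambda>v. ?Dg (f x) (?Df x v)) = (\<lambda>v. \<Sum>b\<in>Basis. (?Df x v \<bullet> b) *\<^sub>R ?Dg (f x) b)"
        by (rule ext, rule linear_sum_Basis[OF has_derivative_linear[OF g]])
      ultimately show ?thesis by (rule subst[rotated])
    qed
    show "Ck_on k S (\<lambda>x. \<Sum>b\<in>Basis. (?Df x v \<bullet> b) *\<^sub>R ?Dg (f x) b)" for v
      using Suc.prems Ck_on_SucD[OF Suc.prems(2)]
      by (intro Ck_on_sum Ck_on_bilinear[OF _ bounded_bilinear_scaleR]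
          Ck_on_bilinear[OF _ bounded_bilinear_inner] Ck_on_const assms(1) Suc.IH) simp_all
  qed
qed

text \<open>The derivative of \<open>1 / f\<close> contains \<open>1 / f\<close> itself, to which
  the induction hypothesis applies.\<close>

lemma Ck_on_inverse:
  fixes f :: "'a::euclidean_space \<Rightarrow> real"
  assumes "open S" "\<And>x. x \<in> S \<Longrightarrow> f x \<noteq> 0" "Ck_on k S f"
  shows "Ck_on k S (\<lambda>x. inverse (f x))"
  using assms(3)
proof (induction k)
  case 0
  then show ?case using assms(2) by (auto intro: continuous_intros)
next
  case (Suc k)
  show ?case
  proof (rule Ck_on_has_derivativeI[OF assms(1)])
    show "((\<lambda>x. inverse (f x)) has_derivative
        (\<lambda>v. - (inverse (f x) * frechet_derivative f (at x) v * inverse (f x)))) (at x)" if "x \<in> S" for x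
      using Deriv.has_derivative_inverse[OF assms(2)[OF that] Ck_on_has_derivative[OF Suc(2) that]] .
    show "Ck_on k S (\<lambda>x. - (inverse (f x) * frechet_derivative f (at x) v * inverse (f x)))" for v
      using Suc.prems Suc.IH[OF Ck_on_SucD[OF Suc.prems]]
      by (intro Ck_on_linear[OF _ bounded_linear_minus[OF bounded_linear_ident]]
          Ck_on_bilinear[OF _ bounded_bilinear_mult] assms(1)) auto
  qed
qed

section \<open>Closure properties of smooth functions\<close>

lemma smooth_on_open: "smooth_on S f \<Longrightarrow> open S"
  by (simp add: smooth_on_def)

lemma smooth_on_continuous_on: "smooth_on S f \<Longrightarrow> continuous_on S f"
  unfolding smooth_on_def using Ck_on.simps(1) by blast

lemma smooth_on_differentiable: "smooth_on S f \<Longrightarrow> x \<in> S \<Longrightarrow> f differentiable (at x)"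
  unfolding smooth_on_def using Ck_on.simps(2) by blast

lemma smooth_on_has_derivative:
  "smooth_on S f \<Longrightarrow> x \<in> S \<Longrightarrow> (f has_derivative frechet_derivative f (at x)) (at x)"
  using smooth_on_differentiable frechet_derivative_works by blast

lemma smooth_on_linear_derivative:
  "smooth_on S f \<Longrightarrow> x \<in> S \<Longrightarrow> linear (frechet_derivative f (at x))"
  by (simp add: linear_frechet_derivative smooth_on_differentiable)

lemma smooth_on_subset: "smooth_on S f \<Longrightarrow> open T \<Longrightarrow> T \<subseteq> S \<Longrightarrow> smooth_on T f"
  unfolding smooth_on_def using Ck_on_subset by blast

lemma smooth_on_cong:
  assumes "smooth_on S f" "\<And>x. x \<in> S \<Longrightarrow> f x = g x"
  shows "smooth_on S g"
  using assms Ck_on_cong unfolding smooth_on_def by metis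

lemma smooth_on_locally:
  assumes "\<And>x. x \<in> S \<Longrightarrow> \<exists>T. x \<in> T \<and> T \<subseteq> S \<and> smooth_on T f"
  shows "smooth_on S f"
proof -
  have "open S" using assms by (metis openI open_contains_ball smooth_on_open order_trans openE)
  then show ?thesis unfolding smooth_on_def
    using Ck_on_locally[of S _ f] assms unfolding smooth_on_def by metis
qed

lemma smooth_on_const: "open S \<Longrightarrow> smooth_on S (\<lambda>x. c)"
  by (simp add: smooth_on_def Ck_on_const)

lemma smooth_on_linear:
  "bounded_linear L \<Longrightarrow> smooth_on S f \<Longrightarrow> smooth_on S (\<lambda>x. L (f x))"
  by (simp add: smooth_on_def Ck_on_linear)

lemma smooth_on_ident: "open S \<Longrightarrow> smooth_on S (\<lambda>x. x)"
proof -
  assume S: "open S"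
  have "Ck_on k S (\<lambda>x. x)" for k
  proof (cases k)
    case (Suc l)
    show ?thesis unfolding Suc
      by (rule Ck_on_has_derivativeI[where f' = "\<lambda>x v. v"]) (use S in \<open>auto intro: Ck_on_const\<close>)
  qed simp
  then show ?thesis using S by (simp add: smooth_on_def)
qed

lemma smooth_on_bounded_linear: "bounded_linear L \<Longrightarrow> open S \<Longrightarrow> smooth_on S L"
  using smooth_on_linear smooth_on_ident by blast

lemma smooth_on_bilinear:
  "bounded_bilinear b \<Longrightarrow> smooth_on S f \<Longrightarrow> smooth_on S g \<Longrightarrow> smooth_on S (\<lambda>x. b (f x) (g x))"
  by (simp add: smooth_on_def Ck_on_bilinear)

lemmas smooth_on_scaleR = smooth_on_bilinear[OF bounded_bilinear_scaleR]
lemmas smooth_on_mult = smooth_on_bilinear[OF bounded_bilinear_mult[where 'a = real]]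
lemmas smooth_on_inner = smooth_on_bilinear[OF bounded_bilinear_inner]

lemma smooth_on_add: "smooth_on S f \<Longrightarrow> smooth_on S g \<Longrightarrow> smooth_on S (\<lambda>x. f x + g x)"
  by (simp add: smooth_on_def Ck_on_add)

lemma smooth_on_minus: "smooth_on S f \<Longrightarrow> smooth_on S (\<lambda>x. - f x)"
  by (rule smooth_on_linear[OF bounded_linear_minus[OF bounded_linear_ident]])

lemma smooth_on_diff: "smooth_on S f \<Longrightarrow> smooth_on S g \<Longrightarrow> smooth_on S (\<lambda>x. f x - g x)"
  using smooth_on_add[OF _ smooth_on_minus, of S f g] by simp

lemma smooth_on_sum:
  "open S \<Longrightarrow> (\<And>i. i \<in> I \<Longrightarrow> smooth_on S (f i)) \<Longrightarrow> smooth_on S (\<lambda>x. \<Sum>i\<in>I. f i x)"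
  by (simp add: smooth_on_def Ck_on_sum)

lemma smooth_on_prod:
  fixes f :: "'i \<Rightarrow> 'a::euclidean_space \<Rightarrow> real"
  shows "open S \<Longrightarrow> (\<And>i. i \<in> I \<Longrightarrow> smooth_on S (f i)) \<Longrightarrow> smooth_on S (\<lambda>x. \<Prod>i\<in>I. f i x)"
  by (induction I rule: infinite_finite_induct) (auto intro: smooth_on_const smooth_on_mult)

lemma smooth_on_compose:
  assumes "smooth_on T g" "smooth_on S f" "f ` S \<subseteq> T"
  shows "smooth_on S (\<lambda>x. g (f x))"
  using assms by (auto simp: smooth_on_def intro: Ck_on_compose)

lemma smooth_on_inverse:
  fixes f :: "'a::euclidean_space \<Rightarrow> real"
  shows "smooth_on S f \<Longrightarrow> (\<And>x. x \<in> S \<Longrightarrow> f x \<noteq> 0) \<Longrightarrow> smooth_on S (\<lambda>x. inverse (f x))"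
  by (simp add: smooth_on_def Ck_on_inverse)

lemma smooth_on_divide:
  fixes f :: "'a::euclidean_space \<Rightarrow> real"
  shows "smooth_on S f \<Longrightarrow> smooth_on S g \<Longrightarrow> (\<And>x. x \<in> S \<Longrightarrow> g x \<noteq> 0) \<Longrightarrow> smooth_on S (\<lambda>x. f x / g x)"
  unfolding divide_inverse by (intro smooth_on_mult smooth_on_inverse)

lemma smooth_on_componentwise:
  assumes "open S" "\<And>b. b \<in> Basis \<Longrightarrow> smooth_on S (\<lambda>x. f x \<bullet> b)"
  shows "smooth_on S f"
proof -
  have "smooth_on S (\<lambda>x. \<Sum>b\<in>Basis. (f x \<bullet> b) *\<^sub>R b)"
    by (intro smooth_on_sum smooth_on_scaleR smooth_on_const assms)
  then show ?thesis by (simp add: euclidean_representation)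
qed

lemma smooth_on_Pair:
  assumes "smooth_on S f" "smooth_on S g"
  shows "smooth_on S (\<lambda>x. (f x, g x))"
proof -
  have 1: "bounded_linear (\<lambda>x. (x, 0))" and 2: "bounded_linear (\<lambda>y. (0, y))"
    by (intro bounded_linear_Pair bounded_linear_ident bounded_linear_zero)+
  show ?thesis
    using smooth_on_add[OF smooth_on_linear[OF 1 assms(1)] smooth_on_linear[OF 2 assms(2)]] by simp
qed

lemma smooth_on_derivative:
  "smooth_on S f \<Longrightarrow> smooth_on S (\<lambda>x. frechet_derivative f (at x) v)"
  unfolding smooth_on_def using Ck_on.simps(2) by blast

lemma smooth_on_derivative_field:
  assumes f: "smooth_on S f" and u: "smooth_on S u"
  shows "smooth_on S (\<lambda>x. frechet_derivative f (at x) (u x))"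
proof -
  have "smooth_on S (\<lambda>x. \<Sum>b\<in>Basis. (u x \<bullet> b) *\<^sub>R frechet_derivative f (at x) b)"
    by (intro smooth_on_sum smooth_on_scaleR smooth_on_inner smooth_on_const
        smooth_on_derivative f u smooth_on_open[OF f])
  moreover have "(\<Sum>b\<in>Basis. (u x \<bullet> b) *\<^sub>R frechet_derivative f (at x) b) = frechet_derivative f (at x) (u x)"
    if "x \<in> S" for x
    using linear_sum_Basis[OF smooth_on_linear_derivative[OF f that]] by (rule sym)
  ultimately show ?thesis by (rule smooth_on_cong)
qed

subsection \<open>Inverse functions\<close>

lemma smooth_on_det:
  assumes S: "open S" and "\<And>i j. smooth_on S (\<lambda>x. M x $ i $ j)"
  shows "smooth_on S (\<lambda>x. det (M x :: real ^ 'n ^ 'n))"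
  unfolding det_def
  by (intro smooth_on_sum smooth_on_mult smooth_on_prod smooth_on_const assms)

text \<open>Cramer's rule exhibits the solution as a rational function of the entries.\<close>

lemma smooth_on_linear_solution:
  fixes T :: "'a::euclidean_space \<Rightarrow> real ^ 'n \<Rightarrow> real ^ 'n"
  assumes S: "open S" and T: "\<And>v. smooth_on S (\<lambda>x. T x v)"
    and lin: "\<And>x. x \<in> S \<Longrightarrow> linear (T x)" and inj: "\<And>x. x \<in> S \<Longrightarrow> inj (T x)"
    and u: "\<And>x. x \<in> S \<Longrightarrow> T x (u x) = v"
  shows "smooth_on S u"
proof -
  let ?M = "\<lambda>x. matrix (T x)"
  have ent: "smooth_on S (\<lambda>x. ?M x $ i $ j)" for i j
    unfolding matrix_def by (auto intro!: smooth_on_linear[OF bounded_linear_vec_nth] T)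
  have det: "det (?M x) \<noteq> 0" if "x \<in> S" for x
    using det_nz_iff_inj lin inj that by blast
  have "smooth_on S (\<lambda>x. det (\<chi> i j. if j = k then v $ i else ?M x $ i $ j) / det (?M x))" for k
  proof (intro smooth_on_divide smooth_on_det S ent det)
    show "smooth_on S (\<lambda>x. (\<chi> i j. if j = k then v $ i else ?M x $ i $ j) $ i $ j)" for i j
      by (cases "j = k") (use S smooth_on_const ent in \<open>auto\<close>)
  qed
  moreover have "u x $ k = det (\<chi> i j. if j = k then v $ i else ?M x $ i $ j) / det (?M x)"
    if "x \<in> S" for x k
    using cramer[OF det[OF that], of "u x" v] u[OF that] fun_cong[OF matrix_vector_mul(2)[OF lin[OF that]]]
    by simp
  ultimately have comp: "smooth_on S (\<lambda>x. u x $ k)" for k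
    using smooth_on_cong[of S _ "\<lambda>x. u x $ k"] by fastforce
  show ?thesis
  proof (rule smooth_on_componentwise[OF S])
    fix b :: "real ^ 'n" assume "b \<in> Basis"
    then obtain k where "b = axis k 1" by (auto simp: Basis_vec_def)
    then show "smooth_on S (\<lambda>x. u x \<bullet> b)" using comp[of k] by (simp add: inner_axis)
  qed
qed

text \<open>The inverse function theorem yields a continuous inverse \<open>g\<close> whose
  derivative at y is the inverse of Df at g(y). This formula raises the regularity: inverting Df
  depends smoothly on the point, so if \<open>g\<close> is of class \<open>C^k\<close>, then so is
  its derivative.\<close>

lemma local_inverse_real_vec:
  fixes f :: "real ^ 'n \<Rightarrow> real ^ 'n"
  assumes f: "smooth_on S f" and x: "x \<in> S" and inj: "inj (frechet_derivative f (at x))"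
  obtains U where "open U" "x \<in> U" "U \<subseteq> S" "open (f ` U)" "inj_on f U"
    "smooth_on (f ` U) (inv_into U f)"
proof -
  let ?D = "\<lambda>y. frechet_derivative f (at y)"
  \<comment> \<open>The theorem requires the derivative to be continuous as a bounded linear map. In
    finite dimension this may be tested on single vectors, where smoothness of \<open>f\<close>
    supplies it.\<close>
  define F where "F y = Blinfun (?D y)" for y
  have F: "blinfun_apply (F y) = ?D y" if "y \<in> S" for y
    unfolding F_def
    by (rule bounded_linear_Blinfun_apply[OF iffD1[OF linear_conv_bounded_linear smooth_on_linear_derivative[OF f that]]])
  have lin: "linear (?D x)" using smooth_on_linear_derivative[OF f x] .
  obtain G where G: "linear G" "G \<circ> ?D x = id"
    using linear_injective_left_inverse[OF lin inj] by auto
  have "continuous_on S (\<lambda>y. blinfun_apply (F y) v)" for v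
    by (rule continuous_on_eq[OF smooth_on_continuous_on[OF smooth_on_derivative[OF f, of v]]]) (simp add: F)
  then have cont: "continuous_on S F"
    by (intro continuous_on_blinfun_componentwise) auto
  have "Blinfun G o\<^sub>L F x = id_blinfun"
    using G F[OF x] by (intro blinfun_eqI)
      (auto simp: bounded_linear_Blinfun_apply linear_conv_bounded_linear pointfree_idE)
  then obtain U V g g' where U: "open U" "U \<subseteq> S" "x \<in> U" and V: "open V"
    and hom: "homeomorphism U V f g"
    and g: "\<And>y. y \<in> V \<Longrightarrow> (g has_derivative g' y) (at y)"
    and g': "\<And>y. y \<in> V \<Longrightarrow> g' y = inv (blinfun_apply (F (g y)))"
    and bij: "\<And>y. y \<in> V \<Longrightarrow> bij (blinfun_apply (F (g y)))"
    using inverse_function_theorem[OF smooth_on_open[OF f] _ cont x, of f "Blinfun G"]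
      smooth_on_has_derivative[OF f] F by metis
  have fU: "f ` U = V" and gV: "g ` V = U" and gf: "\<And>y. y \<in> U \<Longrightarrow> g (f y) = y"
    using hom by (auto simp: homeomorphism_def)
  have injf: "inj_on f U" using gf by (metis inj_onI)
  have b: "bij (?D y)" if "y \<in> U" for y
    using bij[of "f y"] gf[OF that] fU F that U(2) by auto
  have sm: "smooth_on U (\<lambda>y. inv (?D y) v)" for v
  proof (rule smooth_on_linear_solution[where T = ?D])
    show "smooth_on U (\<lambda>y. ?D y w)" for w
      using smooth_on_subset[OF smooth_on_derivative[OF f] U(1,2)] .
    show "linear (?D y)" if "y \<in> U" for y using smooth_on_linear_derivative[OF f] U(2) that by auto
    show "inj (?D y)" if "y \<in> U" for y using b[OF that] bij_is_inj by blast
    show "?D y (inv (?D y) v) = v" if "y \<in> U" for y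
      using b[OF that] bij_is_surj surj_f_inv_f by metis
  qed (use U in auto)
  have "Ck_on k V g" for k
  proof (induction k)
    case 0
    then show ?case using hom by (simp add: homeomorphism_def)
  next
    case (Suc k)
    show ?case
    proof (rule Ck_on_has_derivativeI[OF V])
      show "(g has_derivative (\<lambda>v. inv (?D (g y)) v)) (at y)" if "y \<in> V" for y
        using g[OF that] g'[OF that] F[of "g y"] gV U(2) that by auto
      show "Ck_on k V (\<lambda>y. inv (?D (g y)) v)" for v
        by (rule Ck_on_compose[OF V U(1) _ _ Suc]) (use sm gV in \<open>auto simp: smooth_on_def\<close>)
    qed
  qed
  then have "smooth_on V g" using V by (simp add: smooth_on_def)
  moreover have "g y = inv_into U f y" if "y \<in> V" for y
    using that fU gf injf by (metis imageE inv_into_f_f)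
  ultimately have "smooth_on (f ` U) (inv_into U f)" using smooth_on_cong fU by blast
  then show thesis using that U V fU injf by blast
qed

text \<open>The prolongation is modelled on \<open>(real ^ 3) \<times> real\<close>, a different
  type from the model \<open>real ^ 4\<close> of the source. The linear isomorphism \<open>J\<close>
  moves the target to \<open>real ^ 'n\<close>, where determinants are available.\<close>

lemma local_inverse:
  fixes f :: "real ^ 'n \<Rightarrow> 'b::euclidean_space"
  assumes dim: "DIM('b) = CARD('n)"
    and f: "smooth_on S f" and x: "x \<in> S" and inj: "inj (frechet_derivative f (at x))"
  obtains U where "open U" "x \<in> U" "U \<subseteq> S" "open (f ` U)" "inj_on f U"
    "smooth_on (f ` U) (inv_into U f)"
proof -
  have dimeq: "DIM('b) = DIM(real ^ 'n)" using dim by simp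
  obtain J :: "'b \<Rightarrow> real ^ 'n" and K where J: "linear J"
    and K: "\<And>x. K (J x) = x" "\<And>y. J (K y) = y"
    by (rule isomorphisms_UNIV_UNIV[OF dimeq]) (rule that, assumption+)
  have "bij J" by (rule bijI') (use K in metis)+
  note J = J this
  then have Jb: "bounded_linear J" using linear_conv_bounded_linear by blast
  have d: "frechet_derivative (\<lambda>x. J (f x)) (at x) = J \<circ> frechet_derivative f (at x)"
    using frechet_derivative_at[OF bounded_linear.has_derivative[OF Jb smooth_on_has_derivative[OF f x]]]
    by (simp add: o_def)
  have "inj (frechet_derivative (\<lambda>x. J (f x)) (at x))"
    unfolding d using inj J(2) bij_is_inj inj_compose by blast
  then obtain U where U: "open U" "x \<in> U" "U \<subseteq> S" "open ((\<lambda>x. J (f x)) ` U)" "inj_on (\<lambda>x. J (f x)) U"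
    "smooth_on ((\<lambda>x. J (f x)) ` U) (inv_into U (\<lambda>x. J (f x)))"
    using local_inverse_real_vec[OF smooth_on_linear[OF Jb f] x] by blast
  have injf: "inj_on f U" using U(5) by (auto simp: inj_on_def)
  have "f ` U = J -` ((\<lambda>x. J (f x)) ` U)" using J(2) by (auto simp: bij_def inj_def)
  then have op: "open (f ` U)"
    using open_vimage[OF U(4) linear_continuous_on[OF Jb]] by simp
  have "smooth_on (f ` U) (\<lambda>y. inv_into U (\<lambda>x. J (f x)) (J y))"
    by (rule smooth_on_compose[OF U(6) smooth_on_bounded_linear[OF Jb op]]) auto
  moreover have "inv_into U (\<lambda>x. J (f x)) (J y) = inv_into U f y" if y: "y \<in> f ` U" for y
  proof -
    obtain z where "z \<in> U" "y = f z" using y by auto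
    then show ?thesis using inv_into_f_f[OF U(5)] inv_into_f_f[OF injf] by simp
  qed
  ultimately have "smooth_on (f ` U) (inv_into U f)" using smooth_on_cong by blast
  then show thesis using that U injf op by blast
qed

text \<open>Injectivity on all of \<open>S\<close> makes the local inverses restrictions of the
  global one, which therefore inherits their smoothness.\<close>

lemma smooth_inverse:
  fixes f :: "real ^ 'n \<Rightarrow> 'b::euclidean_space"
  assumes dim: "DIM('b) = CARD('n)" and f: "smooth_on S f" and injf: "inj_on f S"
    and inj: "\<And>x. x \<in> S \<Longrightarrow> inj (frechet_derivative f (at x))"
  shows "smooth_on (f ` S) (inv_into S f)"
proof (rule smooth_on_locally)
  fix y assume "y \<in> f ` S"
  then obtain x where x: "x \<in> S" "y = f x" by auto
  obtain U where U: "open U" "x \<in> U" "U \<subseteq> S" "smooth_on (f ` U) (inv_into U f)"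
    using local_inverse[OF dim f x(1) inj[OF x(1)]] by metis
  have "smooth_on (f ` U) (inv_into S f)"
  proof (rule smooth_on_cong[OF U(4)])
    fix z assume "z \<in> f ` U"
    then obtain u where "u \<in> U" "z = f u" by auto
    then show "inv_into U f z = inv_into S f z"
      using inv_into_f_f[OF injf] inv_into_f_f[OF inj_on_subset[OF injf U(3)]] U(3) by auto
  qed
  then show "\<exists>T. y \<in> T \<and> T \<subseteq> f ` S \<and> smooth_on T (inv_into S f)"
    using x U(2,3) by blast
qed

subsection \<open>Symmetry of second derivatives\<close>

text \<open>The mean value theorem is applied along \<open>u\<close> to the increment in direction
  \<open>v\<close>, and along \<open>v\<close> to the resulting derivative. The left hand side is
  symmetric in \<open>u\<close> and \<open>v\<close>; this is the source of the symmetry of second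
  derivatives.\<close>

lemma second_difference:
  fixes f :: "'a::euclidean_space \<Rightarrow> real"
  assumes f: "smooth_on S f" and S: "ball x e \<subseteq> S" and h: "0 < h" "h * (norm u + norm v) < e"
  obtains z where "z \<in> ball x e"
    "f (x + h *\<^sub>R u + h *\<^sub>R v) - f (x + h *\<^sub>R u) - f (x + h *\<^sub>R v) + f x
      = h * h * frechet_derivative (\<lambda>y. frechet_derivative f (at y) u) (at z) v"
proof -
  let ?D = "\<lambda>y. frechet_derivative f (at y)"
  let ?G = "\<lambda>y. frechet_derivative (\<lambda>y. ?D y u) (at y)"
  have inS: "x + s *\<^sub>R u + t *\<^sub>R v \<in> ball x e" if "0 \<le> s" "s \<le> h" "0 \<le> t" "t \<le> h" for s t
  proof -
    have "norm (s *\<^sub>R u + t *\<^sub>R v) \<le> s * norm u + t * norm v"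
      using that norm_triangle_ineq[of "s *\<^sub>R u" "t *\<^sub>R v"] by simp
    also have "\<dots> \<le> h * norm u + h * norm v"
      using that by (intro add_mono mult_right_mono) auto
    finally have "norm (s *\<^sub>R u + t *\<^sub>R v) < e" using h(2) by (simp add: algebra_simps)
    then show ?thesis by (simp add: dist_norm norm_minus_commute algebra_simps)
  qed
  have f': "(f has_derivative ?D y) (at y)" if "y \<in> ball x e" for y
    using smooth_on_has_derivative[OF f] S that by blast
  have G': "((\<lambda>y. ?D y u) has_derivative ?G y) (at y)" if "y \<in> ball x e" for y
    using smooth_on_has_derivative[OF smooth_on_derivative[OF f]] S that by blast
  \<comment> \<open>The vacuous \<open>0 *\<^sub>R v\<close> gives both terms the form treated by
    \<open>line\<close>, with \<open>t\<close> equal to \<open>h\<close> and to 0.\<close>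
  let ?\<phi> = "\<lambda>s. f (x + s *\<^sub>R u + h *\<^sub>R v) - f (x + s *\<^sub>R u + 0 *\<^sub>R v)"
  have line: "((\<lambda>s. f (x + s *\<^sub>R u + t *\<^sub>R v)) has_derivative (\<lambda>r. ?D (x + s *\<^sub>R u + t *\<^sub>R v) (r *\<^sub>R u))) (at s within T)"
    if "0 \<le> s" "s \<le> h" "0 \<le> t" "t \<le> h" for s t T
  proof -
    have "((\<lambda>s. x + s *\<^sub>R u + t *\<^sub>R v) has_derivative (\<lambda>r. r *\<^sub>R u)) (at s within T)"
      by (auto intro!: derivative_eq_intros)
    from has_derivative_compose[OF this f'[OF inS[OF that]]] show ?thesis .
  qed
  have "\<exists>s\<in>{0<..<h}. ?\<phi> h - ?\<phi> 0 = ?D (x + s *\<^sub>R u + h *\<^sub>R v) ((h - 0) *\<^sub>R u) - ?D (x + s *\<^sub>R u + 0 *\<^sub>R v) ((h - 0) *\<^sub>R u)"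
    using h(1) by (intro mvt_simple has_derivative_diff line) auto
  then obtain s where s: "0 < s" "s < h"
    "?\<phi> h - ?\<phi> 0 = ?D (x + s *\<^sub>R u + h *\<^sub>R v) (h *\<^sub>R u) - ?D (x + s *\<^sub>R u) (h *\<^sub>R u)"
    by auto
  have lin: "linear (?D y)" if "y \<in> ball x e" for y using f'[OF that] has_derivative_linear by blast
  have 1: "?\<phi> h - ?\<phi> 0 = h * (?D (x + s *\<^sub>R u + h *\<^sub>R v) u - ?D (x + s *\<^sub>R u) u)"
    using s linear_scale[OF lin[OF inS[of s h]]] linear_scale[OF lin[OF inS[of s 0]]]
    by (simp add: algebra_simps)
  have "\<exists>t\<in>{0<..<h}. ?D (x + s *\<^sub>R u + h *\<^sub>R v) u - ?D (x + s *\<^sub>R u + 0 *\<^sub>R v) u = ?G (x + s *\<^sub>R u + t *\<^sub>R v) ((h - 0) *\<^sub>R v)"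
  proof (rule mvt_simple[OF h(1)])
    fix t assume t: "0 \<le> t" "t \<le> h"
    have "((\<lambda>t. x + s *\<^sub>R u + t *\<^sub>R v) has_derivative (\<lambda>r. r *\<^sub>R v)) (at t within {0..h})"
      by (auto intro!: derivative_eq_intros)
    from has_derivative_compose[OF this G'[OF inS]] s t
    show "((\<lambda>t. ?D (x + s *\<^sub>R u + t *\<^sub>R v) u) has_derivative (\<lambda>r. ?G (x + s *\<^sub>R u + t *\<^sub>R v) (r *\<^sub>R v))) (at t within {0..h})"
      by auto
  qed
  then obtain t where t: "0 < t" "t < h"
    "?D (x + s *\<^sub>R u + h *\<^sub>R v) u - ?D (x + s *\<^sub>R u) u = ?G (x + s *\<^sub>R u + t *\<^sub>R v) (h *\<^sub>R v)"
    by auto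
  have z: "x + s *\<^sub>R u + t *\<^sub>R v \<in> ball x e" using inS s t by simp
  have "linear (?G (x + s *\<^sub>R u + t *\<^sub>R v))" using G'[OF z] has_derivative_linear by blast
  then have "?\<phi> h - ?\<phi> 0 = h * h * ?G (x + s *\<^sub>R u + t *\<^sub>R v) v"
    using 1 t by (simp add: linear_scale)
  with z show thesis by (intro that) (auto simp: algebra_simps)
qed

text \<open>One and the same second difference is \<open>h * h\<close> times either mixed
  derivative, taken at points \<open>z\<close> and \<open>z'\<close> near \<open>x\<close>. If the
  values at \<open>x\<close> differed, continuity would keep each of these within half the gap of
  its own value, so they could not coincide.\<close>

lemma second_derivative_symmetric_real:
  fixes f :: "'a::euclidean_space \<Rightarrow> real"
  assumes f: "smooth_on S f" and x: "x \<in> S"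
  shows "frechet_derivative (\<lambda>y. frechet_derivative f (at y) u) (at x) v
       = frechet_derivative (\<lambda>y. frechet_derivative f (at y) v) (at x) u"
proof (rule ccontr)
  let ?A = "\<lambda>u v z. frechet_derivative (\<lambda>y. frechet_derivative f (at y) u) (at z) v"
  assume ne: "?A u v x \<noteq> ?A v u x"
  define d where "d = \<bar>?A u v x - ?A v u x\<bar> / 2"
  have d: "d > 0" using ne by (simp add: d_def)
  have cont: "continuous_on S (?A u v)" for u v
    by (intro smooth_on_continuous_on smooth_on_derivative f)
  have S: "open S" using f smooth_on_open by blast
  have near: "\<exists>e>0. \<forall>z\<in>S. dist z x < e \<longrightarrow> \<bar>?A u v z - ?A u v x\<bar> < d" for u v
    using cont[of u v] x d unfolding continuous_on_iff dist_real_def by blast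
  obtain e1 where e1: "e1 > 0" "\<And>z. z \<in> S \<Longrightarrow> dist z x < e1 \<Longrightarrow> \<bar>?A u v z - ?A u v x\<bar> < d"
    using near by blast
  obtain e2 where e2: "e2 > 0" "\<And>z. z \<in> S \<Longrightarrow> dist z x < e2 \<Longrightarrow> \<bar>?A v u z - ?A v u x\<bar> < d"
    using near by blast
  obtain e3 where e3: "e3 > 0" "ball x e3 \<subseteq> S" using S x openE by blast
  define e where "e = min e1 (min e2 e3)"
  have e: "e > 0" "ball x e \<subseteq> S" using e1 e2 e3 by (auto simp: e_def)
  \<comment> \<open>The summand 1 keeps \<open>h\<close> positive when \<open>u\<close> and
    \<open>v\<close> are both zero; the factor 2 keeps the parallelogram strictly inside the
    ball.\<close>
  define h where "h = e / (2 * (norm u + norm v + 1))"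
  have p: "norm u + norm v + 1 > 0" by (simp add: add_nonneg_pos)
  have "h * (norm u + norm v) \<le> e / 2"
    unfolding h_def using e(1) p by (simp add: field_simps)
  then have h2: "h * (norm u + norm v) < e" using e(1) by linarith
  have h: "0 < h" "h * (norm v + norm u) < e"
    using e(1) p h2 by (auto simp: h_def add.commute)
  obtain z where z: "z \<in> ball x e"
    "f (x + h *\<^sub>R u + h *\<^sub>R v) - f (x + h *\<^sub>R u) - f (x + h *\<^sub>R v) + f x = h * h * ?A u v z"
    using second_difference[OF f e(2) h(1) h2] by blast
  obtain z' where z': "z' \<in> ball x e"
    "f (x + h *\<^sub>R v + h *\<^sub>R u) - f (x + h *\<^sub>R v) - f (x + h *\<^sub>R u) + f x = h * h * ?A v u z'"
    using second_difference[OF f e(2) h] by blast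
  have sw: "x + h *\<^sub>R v + h *\<^sub>R u = x + h *\<^sub>R u + h *\<^sub>R v" by (simp add: algebra_simps)
  have "h * h * ?A u v z = h * h * ?A v u z'" using z(2) z'(2)[unfolded sw] by linarith
  then have eq: "?A u v z = ?A v u z'" using h(1) by simp
  have "\<bar>?A u v z - ?A u v x\<bar> < d" using e1(2)[of z] z(1) e(2) by (auto simp: e_def dist_commute)
  moreover have "\<bar>?A v u z' - ?A v u x\<bar> < d" using e2(2)[of z'] z'(1) e(2) by (auto simp: e_def dist_commute)
  moreover have "\<bar>p - q\<bar> < \<bar>q - s\<bar> / 2 \<Longrightarrow> \<bar>p - s\<bar> < \<bar>q - s\<bar> / 2 \<Longrightarrow> False" for p q s :: real
    by (auto simp: abs_if split: if_splits)
  ultimately show False using eq unfolding d_def by metis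
qed

lemma second_derivative_symmetric:
  assumes f: "smooth_on S f" and x: "x \<in> S"
  shows "frechet_derivative (\<lambda>y. frechet_derivative f (at y) u) (at x) v
       = frechet_derivative (\<lambda>y. frechet_derivative f (at y) v) (at x) u"
proof (rule euclidean_eqI)
  fix b :: 'b
  let ?g = "\<lambda>y. f y \<bullet> b"
  have g: "smooth_on S ?g" by (rule smooth_on_linear[OF bounded_linear_inner_left f])
  have 1: "frechet_derivative ?g (at y) u = frechet_derivative f (at y) u \<bullet> b" if "y \<in> S" for y u
    using frechet_derivative_at[OF bounded_linear.has_derivative[OF bounded_linear_inner_left
          smooth_on_has_derivative[OF f that]], of b] by metis
  have 2: "frechet_derivative (\<lambda>y. frechet_derivative ?g (at y) u) (at x) v
      = frechet_derivative (\<lambda>y. frechet_derivative f (at y) u) (at x) v \<bullet> b" for u v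
  proof -
    have "frechet_derivative (\<lambda>y. frechet_derivative ?g (at y) u) (at x)
        = frechet_derivative (\<lambda>y. frechet_derivative f (at y) u \<bullet> b) (at x)"
      by (rule frechet_derivative_cong_open[OF smooth_on_open[OF f] x]) (rule 1)
    also have "\<dots> = (\<lambda>v. frechet_derivative (\<lambda>y. frechet_derivative f (at y) u) (at x) v \<bullet> b)"
      using frechet_derivative_at[OF bounded_linear.has_derivative[OF bounded_linear_inner_left
            smooth_on_has_derivative[OF smooth_on_derivative[OF f] x]]] by metis
    finally show ?thesis by simp
  qed
  show "frechet_derivative (\<lambda>y. frechet_derivative f (at y) u) (at x) v \<bullet> b
       = frechet_derivative (\<lambda>y. frechet_derivative f (at y) v) (at x) u \<bullet> b"
    using second_derivative_symmetric_real[OF g x, of u v] unfolding 2 .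
qed

text \<open>Product rule for DP(r). Symmetry of second derivatives moves \<open>v\<close> into the
  inner slot, so that the sum over the basis reassembles into a derivative in the direction
  \<open>r y\<close>.\<close>

lemma derivative_of_derivative_along_field:
  assumes P: "smooth_on S P" and r: "smooth_on S r" and y: "y \<in> S"
  shows "frechet_derivative (\<lambda>z. frechet_derivative P (at z) (r z)) (at y) v
    = frechet_derivative (\<lambda>z. frechet_derivative P (at z) v) (at y) (r y)
      + frechet_derivative P (at y) (frechet_derivative r (at y) v)"
proof -
  let ?D = "\<lambda>z. frechet_derivative P (at z)" and ?r' = "frechet_derivative r (at y)"
  let ?H = "\<lambda>c. frechet_derivative (\<lambda>z. ?D z c) (at y)"
  have "((\<lambda>z. \<Sum>b\<in>Basis. (r z \<bullet> b) *\<^sub>R ?D z b) has_derivative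
      (\<lambda>v. \<Sum>b\<in>Basis. (r y \<bullet> b) *\<^sub>R ?H b v + (?r' v \<bullet> b) *\<^sub>R ?D y b)) (at y)"
    by (intro has_derivative_sum has_derivative_scaleR
        bounded_linear.has_derivative[OF bounded_linear_inner_left]
        smooth_on_has_derivative[OF r y] smooth_on_has_derivative[OF smooth_on_derivative[OF P] y])
  from frechet_derivative_at[OF this, symmetric]
  have "frechet_derivative (\<lambda>z. \<Sum>b\<in>Basis. (r z \<bullet> b) *\<^sub>R ?D z b) (at y) v
      = (\<Sum>b\<in>Basis. (r y \<bullet> b) *\<^sub>R ?H b v) + (\<Sum>b\<in>Basis. (?r' v \<bullet> b) *\<^sub>R ?D y b)"
    by (simp add: sum.distrib)
  moreover have "frechet_derivative (\<lambda>z. ?D z (r z)) (at y) = frechet_derivative (\<lambda>z. \<Sum>b\<in>Basis. (r z \<bullet> b) *\<^sub>R ?D z b) (at y)"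
    by (rule frechet_derivative_cong_open[OF smooth_on_open[OF P] y])
      (rule linear_sum_Basis[OF smooth_on_linear_derivative[OF P]])
  moreover have "(\<Sum>b\<in>Basis. (?r' v \<bullet> b) *\<^sub>R ?D y b) = ?D y (?r' v)"
    using linear_sum_Basis[OF smooth_on_linear_derivative[OF P y]] by (rule sym)
  moreover have "(\<Sum>b\<in>Basis. (r y \<bullet> b) *\<^sub>R ?H b v) = (\<Sum>b\<in>Basis. (r y \<bullet> b) *\<^sub>R ?H v b)"
    using second_derivative_symmetric[OF P y] by (intro sum.cong refl arg_cong2[where f = scaleR])
  moreover have "(\<Sum>b\<in>Basis. (r y \<bullet> b) *\<^sub>R ?H v b) = ?H v (r y)"
    using linear_sum_Basis[OF smooth_on_linear_derivative[OF smooth_on_derivative[OF P] y]] by (rule sym)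
  ultimately show ?thesis by (simp only:)
qed

text \<open>The derivative of DP(r) along \<open>w\<close> minus that of DP(w) along
  \<open>r\<close> is DP of the bracket, because the second derivatives of \<open>P\<close> cancel.
  The subtracted term is zero. In the other one \<open>X (P z)\<close> and \<open>Y (P z)\<close>
  are constant along \<open>w\<close> to first order, as DP(w) vanishes, so only the coefficients
  get differentiated.\<close>

lemma derivative_along_bracket:
  assumes P: "smooth_on S P" and w: "smooth_on S w" and r: "smooth_on S r" and y: "y \<in> S"
    and Pw: "\<And>z. z \<in> S \<Longrightarrow> frechet_derivative P (at z) (w z) = 0"
    and Pr: "\<And>z. z \<in> S \<Longrightarrow> frechet_derivative P (at z) (r z) = a z *\<^sub>R X (P z) + b z *\<^sub>R Y (P z)"
    and a: "smooth_on S a" and b: "smooth_on S b"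
    and X: "smooth_on T X" and Y: "smooth_on T Y" and T: "P ` S \<subseteq> T"
  shows "frechet_derivative P (at y) (frechet_derivative r (at y) (w y) - frechet_derivative w (at y) (r y))
    = frechet_derivative a (at y) (w y) *\<^sub>R X (P y) + frechet_derivative b (at y) (w y) *\<^sub>R Y (P y)"
proof -
  let ?D = "\<lambda>z. frechet_derivative P (at z)"
  let ?H = "\<lambda>c. frechet_derivative (\<lambda>z. ?D z c) (at y)"
  have S: "open S" using P smooth_on_open by blast
  have "frechet_derivative (\<lambda>z. ?D z (w z)) (at y) = frechet_derivative (\<lambda>z. 0) (at y)"
    by (rule frechet_derivative_cong_open[OF S y Pw])
  then have 1: "?H (r y) (w y) + ?D y (frechet_derivative w (at y) (r y)) = 0"
    using derivative_of_derivative_along_field[OF P w y, of "r y"] by simp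
  have "frechet_derivative (\<lambda>z. ?D z (r z)) (at y)
      = frechet_derivative (\<lambda>z. a z *\<^sub>R X (P z) + b z *\<^sub>R Y (P z)) (at y)"
    by (rule frechet_derivative_cong_open[OF S y Pr])
  also have "\<dots> = (\<lambda>v. (a y *\<^sub>R frechet_derivative X (at (P y)) (?D y v) + frechet_derivative a (at y) v *\<^sub>R X (P y))
      + (b y *\<^sub>R frechet_derivative Y (at (P y)) (?D y v) + frechet_derivative b (at y) v *\<^sub>R Y (P y)))"
    by (rule frechet_derivative_at[symmetric], intro has_derivative_add has_derivative_scaleR
        smooth_on_has_derivative[OF a y] smooth_on_has_derivative[OF b y]
        has_derivative_compose[OF smooth_on_has_derivative[OF P y]] smooth_on_has_derivative[OF X]
        smooth_on_has_derivative[OF Y]) (use T y in auto)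
  finally have 2: "?H (w y) (r y) + ?D y (frechet_derivative r (at y) (w y))
      = frechet_derivative a (at y) (w y) *\<^sub>R X (P y) + frechet_derivative b (at y) (w y) *\<^sub>R Y (P y)"
    using derivative_of_derivative_along_field[OF P r y, of "w y"] Pw[OF y]
      linear_0[OF smooth_on_linear_derivative[OF X, of "P y"]]
      linear_0[OF smooth_on_linear_derivative[OF Y, of "P y"]] T y by auto
  have "?H (w y) (r y) = ?H (r y) (w y)" by (rule second_derivative_symmetric[OF P y])
  then show ?thesis
    using 1 2 by (simp add: linear_diff[OF smooth_on_linear_derivative[OF P y]] add_eq_0_iff add.commute)
qed

subsection \<open>Coefficients with respect to a frame of a plane field\<close>

text \<open>The vector \<open>?Z\<close> is |Y|^2 times the component of \<open>X\<close> orthogonal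
  to \<open>Y\<close>. The Gram determinant is a factor of its squared norm, so a vanishing
  determinant produces a linear relation.\<close>

lemma gram_det_nonzero:
  fixes X Y :: "'a::real_inner"
  assumes ind: "\<And>a b. a *\<^sub>R X + b *\<^sub>R Y = 0 \<Longrightarrow> a = 0 \<and> b = 0"
  shows "(X \<bullet> X) * (Y \<bullet> Y) - (X \<bullet> Y) * (X \<bullet> Y) \<noteq> 0"
proof
  assume g: "(X \<bullet> X) * (Y \<bullet> Y) - (X \<bullet> Y) * (X \<bullet> Y) = 0"
  let ?Z = "(Y \<bullet> Y) *\<^sub>R X + (- (X \<bullet> Y)) *\<^sub>R Y"
  have "?Z \<bullet> ?Z = (Y \<bullet> Y) * ((X \<bullet> X) * (Y \<bullet> Y) - (X \<bullet> Y) * (X \<bullet> Y))"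
    by (simp add: inner_simps inner_commute algebra_simps)
  then have "?Z = 0" using g by (metis inner_eq_zero_iff mult_zero_right)
  from ind[OF this] have "Y = 0" by simp
  then show False using ind[of 0 1] by simp
qed

text \<open>Pairing \<open>V\<close> with \<open>X\<close> and \<open>Y\<close> gives two linear
  equations for the coefficients. Cramer's rule with the Gram determinant solves them by quotients
  of inner products, which are smooth.\<close>

lemma frame_coefficients:
  assumes X: "smooth_on S X" and Y: "smooth_on S Y" and V: "smooth_on S V"
    and ind: "\<And>x a b. x \<in> S \<Longrightarrow> a *\<^sub>R X x + b *\<^sub>R Y x = 0 \<Longrightarrow> a = 0 \<and> b = 0"
    and sp: "\<And>x. x \<in> S \<Longrightarrow> \<exists>a b. V x = a *\<^sub>R X x + b *\<^sub>R Y x"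
  obtains a b where "smooth_on S a" "smooth_on S b" "\<And>x. x \<in> S \<Longrightarrow> V x = a x *\<^sub>R X x + b x *\<^sub>R Y x"
proof -
  define g where "g x = (X x \<bullet> X x) * (Y x \<bullet> Y x) - (X x \<bullet> Y x) * (X x \<bullet> Y x)" for x
  define a where "a x = ((V x \<bullet> X x) * (Y x \<bullet> Y x) - (V x \<bullet> Y x) * (X x \<bullet> Y x)) / g x" for x
  define b where "b x = ((V x \<bullet> Y x) * (X x \<bullet> X x) - (V x \<bullet> X x) * (X x \<bullet> Y x)) / g x" for x
  have g0: "g x \<noteq> 0" if "x \<in> S" for x
    unfolding g_def using gram_det_nonzero[OF ind[OF that]] .
  have "smooth_on S g"
    unfolding g_def by (intro smooth_on_diff smooth_on_mult smooth_on_inner X Y)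
  note sm = this
  have "smooth_on S a"
    unfolding a_def by (intro smooth_on_divide smooth_on_diff smooth_on_mult smooth_on_inner X Y V sm g0)
  moreover have "smooth_on S b"
    unfolding b_def by (intro smooth_on_divide smooth_on_diff smooth_on_mult smooth_on_inner X Y V sm g0)
  moreover have "V x = a x *\<^sub>R X x + b x *\<^sub>R Y x" if x: "x \<in> S" for x
  proof -
    obtain p q where V: "V x = p *\<^sub>R X x + q *\<^sub>R Y x" using sp[OF x] by blast
    have "(V x \<bullet> X x) * (Y x \<bullet> Y x) - (V x \<bullet> Y x) * (X x \<bullet> Y x) = p * g x"
      "(V x \<bullet> Y x) * (X x \<bullet> X x) - (V x \<bullet> X x) * (X x \<bullet> Y x) = q * g x"
      unfolding V g_def by (simp_all add: inner_simps inner_commute algebra_simps)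
    then show ?thesis using V g0[OF x] unfolding a_def b_def by simp
  qed
  ultimately show thesis using that by blast
qed

subsection \<open>A smooth step function\<close>

text \<open>The functions t^(-n) exp(-1/t), continued by 0. With the powers included the family is
  closed under differentiation up to linear combinations, which drives the induction in
  \<open>smooth_on_flat\<close>.\<close>

definition flat :: "nat \<Rightarrow> real \<Rightarrow> real" where
  "flat n t = (if t > 0 then inverse t ^ n / exp (inverse t) else 0)"

lemma flat_has_derivative:
  "(flat n has_real_derivative flat (n + 2) t - real n * flat (n + 1) t) (at t)"
proof -
  consider "t > 0" | "t < 0" | "t = 0" by linarith
  then show ?thesis
  proof cases
    case 1
    have "((\<lambda>t. inverse t ^ n / exp (inverse t)) has_real_derivative
        flat (n + 2) t - real n * flat (n + 1) t) (at t)"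
      unfolding flat_def using 1
      by (auto intro!: derivative_eq_intros simp: field_simps power_add power2_eq_square)
        (cases n; simp add: field_simps)
    then show ?thesis
      by (rule has_field_derivative_transform_within_open[where S = "{0<..}"]) (use 1 in \<open>auto simp: flat_def\<close>)
  next
    case 2
    have "((\<lambda>t. 0) has_real_derivative flat (n + 2) t - real n * flat (n + 1) t) (at t)"
      using 2 by (simp add: flat_def)
    then show ?thesis
      by (rule has_field_derivative_transform_within_open[where S = "{..<0}"]) (use 2 in \<open>auto simp: flat_def\<close>)
  next
    case 3
    \<comment> \<open>From the right the difference quotient at 0 is u^(n+1) / exp u with u = 1 / h
      tending to infinity.\<close>
    have "((\<lambda>h. inverse h ^ (n + 1) / exp (inverse h)) \<longlongrightarrow> 0) (at_right (0::real))"
      by (rule filterlim_compose[OF tendsto_power_div_exp_0 filterlim_inverse_at_top_right])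
    then have "((\<lambda>h. flat n h / h) \<longlongrightarrow> 0) (at_right 0)"
      by (rule Lim_transform_eventually)
        (auto simp: eventually_at_right_field flat_def field_simps intro: exI[of _ 1])
    moreover have "((\<lambda>h. flat n h / h) \<longlongrightarrow> 0) (at_left 0)"
      by (rule Lim_transform_eventually[OF tendsto_const])
        (auto simp: eventually_at_left_field flat_def intro: exI[of _ "-1"])
    ultimately have "((\<lambda>h. flat n h / h) \<longlongrightarrow> 0) (at 0)"
      by (simp add: filterlim_at_split)
    then show ?thesis using 3 by (simp add: DERIV_def flat_def)
  qed
qed

lemma smooth_on_flat: "smooth_on UNIV (flat n)"
proof -
  have "Ck_on k UNIV (flat n)" for k
  proof (induction k arbitrary: n)
    case 0
    then show ?case
      using DERIV_isCont[OF flat_has_derivative] by (simp add: continuous_at_imp_continuous_on)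
  next
    case (Suc k)
    show ?case
    proof (rule Ck_on_has_derivativeI)
      show "(flat n has_derivative (\<lambda>v. (flat (n + 2) t - real n * flat (n + 1) t) * v)) (at t)" for t
        using flat_has_derivative has_field_derivative_def by blast
      show "Ck_on k UNIV (\<lambda>t. (flat (n + 2) t - real n * flat (n + 1) t) * v)" for v
      proof -
        have "Ck_on k UNIV (\<lambda>t. v * flat (n + 2) t + (- v * real n) * flat (n + 1) t)"
          by (intro Ck_on_add Ck_on_linear[OF _ bounded_linear_mult_right] Suc open_UNIV)
        then show ?thesis by (simp add: algebra_simps)
      qed
    qed auto
  qed
  then show ?thesis by (simp add: smooth_on_def)
qed

text \<open>The denominator is positive because \<open>t\<close> and \<open>1 - t\<close> are never
  both nonpositive. Reparametrizing by this function makes a curve rest at its ends.\<close>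

definition smooth_step :: "real \<Rightarrow> real" where
  "smooth_step t = flat 0 t / (flat 0 t + flat 0 (1 - t))"

lemma smooth_step_bounds: "0 \<le> smooth_step t" "smooth_step t \<le> 1"
  by (auto simp: smooth_step_def flat_def field_simps add_pos_pos)

lemma smooth_step_eq: "t \<le> 0 \<Longrightarrow> smooth_step t = 0" "t \<ge> 1 \<Longrightarrow> smooth_step t = 1"
  by (auto simp: smooth_step_def flat_def)

lemma smooth_on_smooth_step: "smooth_on UNIV smooth_step"
proof -
  have "flat 0 t + flat 0 (1 - t) > 0" for t
    by (cases "t > 0") (auto simp: flat_def add_pos_pos add_pos_nonneg)
  then have "flat 0 t + flat 0 (1 - t) \<noteq> 0" for t by (metis less_irrefl)
  moreover have "smooth_on UNIV (\<lambda>t. flat 0 (1 - t))"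
    by (intro smooth_on_compose[OF smooth_on_flat] smooth_on_diff smooth_on_const smooth_on_ident) auto
  ultimately show ?thesis unfolding smooth_step_def
    by (intro smooth_on_divide smooth_on_add smooth_on_flat) auto
qed

section \<open>Charts, smooth maps and derivatives\<close>

lemma smooth_on_open_vimage: "smooth_on S f \<Longrightarrow> open V \<Longrightarrow> open (S \<inter> f -` V)"
  using continuous_open_preimage smooth_on_continuous_on smooth_on_open by blast

text \<open>Stated apart from \<open>smooth_atlas\<close> because this is the form in which the
  atlas of the prolongation enters the chain rule.\<close>

definition inj_atlas :: "('a, 'e) atlas \<Rightarrow> bool" where
  "inj_atlas A \<longleftrightarrow> (\<forall>c\<in>A. inj_on (snd c) (fst c))"

definition smooth_atlas :: "('a, 'e::euclidean_space) atlas \<Rightarrow> bool" where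
  "smooth_atlas A \<longleftrightarrow>
     (\<forall>c\<in>A. inj_on (snd c) (fst c) \<and> open (snd c ` fst c)) \<and>
     (\<forall>c\<in>A. \<forall>d\<in>A. smooth_on (snd c ` (fst c \<inter> fst d)) (snd d \<circ> chart_inv c))"

lemma smooth_manifold_smooth_atlas: "smooth_manifold A \<Longrightarrow> smooth_atlas A"
  by (simp add: smooth_manifold_def smooth_atlas_def)

lemma smooth_atlas_inj_atlas: "smooth_atlas A \<Longrightarrow> inj_atlas A"
  by (simp add: smooth_atlas_def inj_atlas_def)

lemma chart_inv_left: "inj_on (snd c) (fst c) \<Longrightarrow> x \<in> fst c \<Longrightarrow> chart_inv c (snd c x) = x"
  by (simp add: chart_inv_def)

lemma chart_inv_right:
  assumes "y \<in> snd c ` fst c"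
  shows "snd c (chart_inv c y) = y" "chart_inv c y \<in> fst c"
  using assms by (simp_all add: chart_inv_def f_inv_into_f inv_into_into)

lemma chart_atD:
  assumes "x \<in> mcarrier A"
  shows "chart_at A x \<in> A" "x \<in> fst (chart_at A x)"
proof -
  have "\<exists>c. c \<in> A \<and> x \<in> fst c" using assms by (auto simp: mcarrier_def)
  from someI_ex[OF this] show "chart_at A x \<in> A" "x \<in> fst (chart_at A x)"
    by (auto simp: chart_at_def)
qed

lemma chart_subset_mcarrier: "c \<in> A \<Longrightarrow> fst c \<subseteq> mcarrier A"
  by (auto simp: mcarrier_def)

lemma openin_mtop_chart: "c \<in> A \<Longrightarrow> open V \<Longrightarrow> openin (mtop A) (fst c \<inter> snd c -` V)"
  unfolding mtop_def by (rule topology_generated_by_Basis) blast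

lemma openin_mtop_chart_domain: "c \<in> A \<Longrightarrow> openin (mtop A) (fst c)"
  using openin_mtop_chart[of c A UNIV] by simp

lemma topspace_mtop: "topspace (mtop A) = mcarrier A"
proof
  show "topspace (mtop A) \<subseteq> mcarrier A" by (auto simp: mtop_def mcarrier_def)
  show "mcarrier A \<subseteq> topspace (mtop A)"
    using openin_subset[OF openin_mtop_chart_domain] unfolding mcarrier_def by blast
qed

lemma openin_mcarrier: "openin (mtop A) (mcarrier A)"
  by (metis topspace_mtop openin_topspace)

lemma openin_mtop_subset: "openin (mtop A) U \<Longrightarrow> U \<subseteq> mcarrier A"
  using openin_subset topspace_mtop by metis

lemma chart_image_Int_vimage:
  assumes "inj_on (snd c) (fst c)"
  shows "snd c ` (fst c \<inter> U \<inter> f -` (fst d \<inter> snd d -` V))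
    = snd c ` (fst c \<inter> U \<inter> f -` fst d) \<inter> (snd d \<circ> f \<circ> chart_inv c) -` V"
  using chart_inv_left[OF assms] by auto

lemma chart_image_Int_eq:
  assumes "inj_on (snd d) (fst d)"
  shows "fst d \<inter> snd d -` (snd d ` (fst d \<inter> V)) = fst d \<inter> V"
  using assms by (auto simp: inj_on_def)

text \<open>Induction over the generation of the topology. For a generator the image is the preimage
  of an open set under a transition map, which is continuous on an open domain.\<close>

lemma open_chart_image:
  assumes A: "smooth_atlas A" and c: "c \<in> A" and U: "openin (mtop A) U"
  shows "open (snd c ` (fst c \<inter> U))"
proof -
  have inj: "inj_on (snd c) (fst c)" using A c by (simp add: smooth_atlas_def)
  have "generate_topology_on {fst c \<inter> snd c -` V | c V. c \<in> A \<and> open V} U"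
    using U unfolding mtop_def openin_topology_generated_by_iff .
  then show ?thesis
  proof induction
    case (Int a b)
    have "snd c ` (fst c \<inter> (a \<inter> b)) = snd c ` (fst c \<inter> a) \<inter> snd c ` (fst c \<inter> b)"
      using inj by (auto simp: inj_on_def)
    with Int show ?case by auto
  next
    case (UN K)
    have "snd c ` (fst c \<inter> \<Union>K) = (\<Union>k\<in>K. snd c ` (fst c \<inter> k))" by auto
    with UN show ?case by auto
  next
    case (Basis s)
    then obtain d V where d: "d \<in> A" "open V" "s = fst d \<inter> snd d -` V" by blast
    have "smooth_on (snd c ` (fst c \<inter> fst d)) (snd d \<circ> chart_inv c)"
      using A c d by (simp add: smooth_atlas_def)
    then have "open (snd c ` (fst c \<inter> fst d) \<inter> (snd d \<circ> chart_inv c) -` V)"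
      using d(2) by (rule smooth_on_open_vimage)
    moreover have "snd c ` (fst c \<inter> s) = snd c ` (fst c \<inter> fst d) \<inter> (snd d \<circ> chart_inv c) -` V"
      using chart_image_Int_vimage[OF inj, of UNIV id d V] d(3) by simp
    ultimately show ?case by simp
  qed simp
qed

lemma openin_mtopI:
  assumes A: "inj_atlas A" and U: "U \<subseteq> mcarrier A"
    and op: "\<And>c. c \<in> A \<Longrightarrow> open (snd c ` (fst c \<inter> U))"
  shows "openin (mtop A) U"
proof (subst openin_subopen, intro ballI)
  fix x assume x: "x \<in> U"
  then obtain c where c: "c \<in> A" "x \<in> fst c" using U by (auto simp: mcarrier_def)
  then have "fst c \<inter> snd c -` (snd c ` (fst c \<inter> U)) = fst c \<inter> U"
    using A by (auto simp: inj_atlas_def inj_on_def)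
  then have "openin (mtop A) (fst c \<inter> U)" using openin_mtop_chart[OF c(1) op[OF c(1)]] by simp
  then show "\<exists>T. openin (mtop A) T \<and> x \<in> T \<and> T \<subseteq> U" using x c by blast
qed

lemma smooth_map_on_rep:
  "smooth_map_on A B U f \<Longrightarrow> c \<in> A \<Longrightarrow> d \<in> B \<Longrightarrow>
    smooth_on (snd c ` (fst c \<inter> U \<inter> f -` fst d)) (snd d \<circ> f \<circ> chart_inv c)"
  by (simp add: smooth_map_on_def)

lemma smooth_map_on_openin: "smooth_map_on A B U f \<Longrightarrow> openin (mtop A) U"
  by (simp only: smooth_map_on_def)

lemma smooth_map_on_into: "smooth_map_on A B U f \<Longrightarrow> x \<in> U \<Longrightarrow> f x \<in> mcarrier B"
  by (auto simp only: smooth_map_on_def)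

text \<open>This is continuity, recovered from the openness clause in \<open>smooth_on\<close>: the
  preimage is covered by preimages under coordinate expressions, one for each chart of the
  target.\<close>

lemma smooth_map_on_vimage:
  assumes A: "inj_atlas A" and B: "smooth_atlas B" and f: "smooth_map_on A B U f"
    and V: "openin (mtop B) V"
  shows "openin (mtop A) (U \<inter> f -` V)"
proof (rule openin_mtopI[OF A])
  show "U \<inter> f -` V \<subseteq> mcarrier A" using openin_mtop_subset[OF smooth_map_on_openin[OF f]] by blast
  fix c assume c: "c \<in> A"
  then have inj: "inj_on (snd c) (fst c)" using A by (simp add: inj_atlas_def)
  let ?T = "\<lambda>d. snd c ` (fst c \<inter> U \<inter> f -` fst d) \<inter> (snd d \<circ> f \<circ> chart_inv c) -` (snd d ` (fst d \<inter> V))"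
  have "open (?T d)" if "d \<in> B" for d
    by (rule smooth_on_open_vimage[OF smooth_map_on_rep[OF f c that] open_chart_image[OF B that V]])
  moreover have "snd c ` (fst c \<inter> (U \<inter> f -` V)) = (\<Union>d\<in>B. ?T d)"
  proof -
    have T: "?T d = snd c ` (fst c \<inter> U \<inter> f -` (fst d \<inter> V))" if "d \<in> B" for d
      using B that chart_image_Int_vimage[OF inj, of U f d "snd d ` (fst d \<inter> V)"] chart_image_Int_eq[of d V]
      by (simp add: smooth_atlas_def)
    have "V \<subseteq> mcarrier B" using V openin_mtop_subset by blast
    then have "snd c ` (fst c \<inter> (U \<inter> f -` V)) = (\<Union>d\<in>B. snd c ` (fst c \<inter> U \<inter> f -` (fst d \<inter> V)))"
      by (fastforce simp: mcarrier_def)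
    also have "\<dots> = (\<Union>d\<in>B. ?T d)" using T by (intro SUP_cong) auto
    finally show ?thesis .
  qed
  ultimately show "open (snd c ` (fst c \<inter> (U \<inter> f -` V)))" by auto
qed

lemma smooth_map_on_compose:
  assumes A: "inj_atlas A" and B: "smooth_atlas B"
    and f: "smooth_map_on A B U f" and g: "smooth_map_on B C V g" and UV: "f ` U \<subseteq> V"
  shows "smooth_map_on A C U (g \<circ> f)"
  unfolding smooth_map_on_def
proof (intro conjI ballI)
  show "openin (mtop A) U" by (rule smooth_map_on_openin[OF f])
  show "(g \<circ> f) ` U \<subseteq> mcarrier C" using smooth_map_on_into[OF g] UV by auto
  fix c e assume c: "c \<in> A" and e: "e \<in> C"
  have inj: "inj_on (snd c) (fst c)" using A c by (simp add: inj_atlas_def)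
  show "smooth_on (snd c ` (fst c \<inter> U \<inter> (g \<circ> f) -` fst e)) (snd e \<circ> (g \<circ> f) \<circ> chart_inv c)"
  proof (rule smooth_on_locally)
    fix y assume "y \<in> snd c ` (fst c \<inter> U \<inter> (g \<circ> f) -` fst e)"
    then obtain x where x: "x \<in> fst c" "x \<in> U" "g (f x) \<in> fst e" "y = snd c x" by auto
    obtain d where d: "d \<in> B" "f x \<in> fst d"
      using smooth_map_on_into[OF f x(2)] by (auto simp: mcarrier_def)
    have injd: "inj_on (snd d) (fst d)" using B d by (simp add: smooth_atlas_def)
    define O1 where "O1 = snd d ` (fst d \<inter> V \<inter> g -` fst e)"
    have sg: "smooth_on O1 (snd e \<circ> g \<circ> chart_inv d)"
      unfolding O1_def by (rule smooth_map_on_rep[OF g d(1) e])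
    define T where "T = snd c ` (fst c \<inter> U \<inter> f -` fst d) \<inter> (snd d \<circ> f \<circ> chart_inv c) -` O1"
    have sf: "smooth_on (snd c ` (fst c \<inter> U \<inter> f -` fst d)) (snd d \<circ> f \<circ> chart_inv c)"
      by (rule smooth_map_on_rep[OF f c d(1)])
    have "open T" unfolding T_def by (rule smooth_on_open_vimage[OF sf smooth_on_open[OF sg]])
    then have "smooth_on T (snd d \<circ> f \<circ> chart_inv c)"
      by (rule smooth_on_subset[OF sf]) (auto simp: T_def)
    then have "smooth_on T (\<lambda>y. (snd e \<circ> g \<circ> chart_inv d) ((snd d \<circ> f \<circ> chart_inv c) y))"
      by (rule smooth_on_compose[OF sg]) (auto simp: T_def)
    then have "smooth_on T (snd e \<circ> (g \<circ> f) \<circ> chart_inv c)"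
      by (rule smooth_on_cong) (auto simp: T_def chart_inv_left[OF inj] chart_inv_left[OF injd])
    moreover have "y \<in> T" "T \<subseteq> snd c ` (fst c \<inter> U \<inter> (g \<circ> f) -` fst e)"
      using x d UV by (auto simp: T_def O1_def chart_inv_left[OF inj] dest!: inj_onD[OF injd])
    ultimately show "\<exists>T. y \<in> T \<and> T \<subseteq> snd c ` (fst c \<inter> U \<inter> (g \<circ> f) -` fst e) \<and>
        smooth_on T (snd e \<circ> (g \<circ> f) \<circ> chart_inv c)" by blast
  qed
qed

lemma smooth_map_on_id:
  assumes A: "smooth_atlas A" shows "smooth_map_on A A (mcarrier A) id"
  unfolding smooth_map_on_def
proof (intro conjI ballI)
  fix c d assume cd: "c \<in> A" "d \<in> A"
  have "fst c \<inter> mcarrier A \<inter> id -` fst d = fst c \<inter> fst d" using cd by (auto simp: mcarrier_def)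
  then show "smooth_on (snd c ` (fst c \<inter> mcarrier A \<inter> id -` fst d)) (snd d \<circ> id \<circ> chart_inv c)"
    using A cd by (simp add: smooth_atlas_def)
qed (auto simp: openin_mcarrier)

lemma smooth_map_on_locally:
  assumes "\<And>x. x \<in> U \<Longrightarrow> \<exists>T. x \<in> T \<and> T \<subseteq> U \<and> smooth_map_on A B T f"
  shows "smooth_map_on A B U f"
  unfolding smooth_map_on_def
proof (intro conjI ballI)
  show "openin (mtop A) U"
  proof (subst openin_subopen, intro ballI)
    fix x assume "x \<in> U"
    then obtain T where "x \<in> T" "T \<subseteq> U" "smooth_map_on A B T f" using assms by blast
    then show "\<exists>T. openin (mtop A) T \<and> x \<in> T \<and> T \<subseteq> U" unfolding smooth_map_on_def by blast
  qed
  show "f ` U \<subseteq> mcarrier B" using assms unfolding smooth_map_on_def by blast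
  fix c d assume cd: "c \<in> A" "d \<in> B"
  show "smooth_on (snd c ` (fst c \<inter> U \<inter> f -` fst d)) (snd d \<circ> f \<circ> chart_inv c)"
  proof (rule smooth_on_locally)
    fix y assume "y \<in> snd c ` (fst c \<inter> U \<inter> f -` fst d)"
    then obtain x where x: "x \<in> fst c" "x \<in> U" "f x \<in> fst d" "y = snd c x" by auto
    obtain T where T: "x \<in> T" "T \<subseteq> U" "smooth_map_on A B T f" using assms[OF x(2)] by blast
    show "\<exists>T. y \<in> T \<and> T \<subseteq> snd c ` (fst c \<inter> U \<inter> f -` fst d) \<and> smooth_on T (snd d \<circ> f \<circ> chart_inv c)"
      using x T smooth_map_on_rep[OF T(3) cd]
      by (intro exI[of _ "snd c ` (fst c \<inter> T \<inter> f -` fst d)"]) auto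
  qed
qed

lemma smooth_map_on_cong:
  assumes f: "smooth_map_on A B U f" and eq: "\<And>x. x \<in> U \<Longrightarrow> f x = g x" and A: "inj_atlas A"
  shows "smooth_map_on A B U g"
  unfolding smooth_map_on_def
proof (intro conjI ballI)
  show "openin (mtop A) U" by (rule smooth_map_on_openin[OF f])
  show "g ` U \<subseteq> mcarrier B" using smooth_map_on_into[OF f] eq by auto
  fix c d assume cd: "c \<in> A" "d \<in> B"
  have inj: "inj_on (snd c) (fst c)" using A cd by (simp add: inj_atlas_def)
  have "fst c \<inter> U \<inter> g -` fst d = fst c \<inter> U \<inter> f -` fst d" using eq by auto
  moreover have "smooth_on (snd c ` (fst c \<inter> U \<inter> f -` fst d)) (snd d \<circ> g \<circ> chart_inv c)"
    by (rule smooth_on_cong[OF smooth_map_on_rep[OF f cd]]) (auto simp: chart_inv_left[OF inj] eq)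
  ultimately show "smooth_on (snd c ` (fst c \<inter> U \<inter> g -` fst d)) (snd d \<circ> g \<circ> chart_inv c)" by simp
qed

subsection \<open>Derivatives in charts\<close>

text \<open>\<open>mderiv\<close>, \<open>tcoord\<close> and \<open>tvec\<close> are all instances,
  the last two with the map \<open>id\<close>. A single chain rule thus serves derivatives and
  changes of components alike.\<close>

definition cderiv :: "('a, 'e::euclidean_space) chart \<Rightarrow> ('b, 'f::euclidean_space) chart \<Rightarrow> ('a \<Rightarrow> 'b) \<Rightarrow> 'a \<Rightarrow> 'e \<Rightarrow> 'f" where
  "cderiv c d f x = frechet_derivative (snd d \<circ> f \<circ> chart_inv c) (at (snd c x))"

lemma mderiv_cderiv: "mderiv A B f x = cderiv (chart_at A x) (chart_at B (f x)) f x"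
  by (simp add: mderiv_def cderiv_def)

lemma tcoord_cderiv: "tcoord A c x = cderiv (chart_at A x) c id x"
  by (simp add: tcoord_def cderiv_def)

lemma tvec_cderiv: "tvec A c x = cderiv c (chart_at A x) id x"
  by (simp add: tvec_def cderiv_def)

lemma linear_cderiv:
  assumes "smooth_map_on A B U f" "c \<in> A" "d \<in> B" "x \<in> U" "x \<in> fst c" "f x \<in> fst d"
  shows "linear (cderiv c d f x)"
  unfolding cderiv_def
  by (rule smooth_on_linear_derivative[OF smooth_map_on_rep[OF assms(1-3)]]) (use assms in auto)

lemma cderiv_compose:
  assumes f: "smooth_map_on A B U f" and g: "smooth_map_on B C V g"
    and A: "inj_atlas A" and B: "inj_atlas B"
    and c: "c \<in> A" "x \<in> fst c" and d: "d \<in> B" "f x \<in> fst d" and e: "e \<in> C" "g (f x) \<in> fst e"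
    and x: "x \<in> U" "f x \<in> V"
  shows "cderiv c e (g \<circ> f) x v = cderiv d e g (f x) (cderiv c d f x v)"
proof -
  have injc: "inj_on (snd c) (fst c)" and injd: "inj_on (snd d) (fst d)"
    using A B c d by (auto simp: inj_atlas_def)
  let ?S = "snd c ` (fst c \<inter> U \<inter> f -` fst d)"
  have sf: "smooth_on ?S (snd d \<circ> f \<circ> chart_inv c)" by (rule smooth_map_on_rep[OF f c(1) d(1)])
  have sg: "smooth_on (snd d ` (fst d \<inter> V \<inter> g -` fst e)) (snd e \<circ> g \<circ> chart_inv d)"
    by (rule smooth_map_on_rep[OF g d(1) e(1)])
  have y: "snd c x \<in> ?S" using c x d by auto
  have fx: "(snd d \<circ> f \<circ> chart_inv c) (snd c x) = snd d (f x)" by (simp add: chart_inv_left[OF injc c(2)])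
  have "((\<lambda>y. (snd e \<circ> g \<circ> chart_inv d) ((snd d \<circ> f \<circ> chart_inv c) y)) has_derivative
      (\<lambda>v. cderiv d e g (f x) (cderiv c d f x v))) (at (snd c x))"
    unfolding cderiv_def
    by (rule has_derivative_compose[OF smooth_on_has_derivative[OF sf y]], subst fx)
      (rule smooth_on_has_derivative[OF sg], use d x e in auto)
  from frechet_derivative_at[OF this]
  have "(\<lambda>v. cderiv d e g (f x) (cderiv c d f x v)) =
      frechet_derivative (\<lambda>y. (snd e \<circ> g \<circ> chart_inv d) ((snd d \<circ> f \<circ> chart_inv c) y)) (at (snd c x))" .
  also have "\<dots> = cderiv c e (g \<circ> f) x"
    unfolding cderiv_def
    by (rule frechet_derivative_cong_open[OF smooth_on_open[OF sf] y])
      (auto simp: chart_inv_left[OF injc] chart_inv_left[OF injd])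
  finally show ?thesis by metis
qed

lemma cderiv_cong:
  assumes A: "smooth_atlas A" and c: "c \<in> A" and x: "x \<in> U" "x \<in> fst c" and U: "openin (mtop A) U"
    and eq: "\<And>y. y \<in> U \<Longrightarrow> f y = g y"
  shows "cderiv c d f x = cderiv c d g x"
  unfolding cderiv_def
  by (rule frechet_derivative_cong_open[OF open_chart_image[OF A c U]])
    (use A c x in \<open>auto simp: smooth_atlas_def chart_inv_left eq\<close>)

lemma cderiv_id:
  assumes A: "smooth_atlas A" and c: "c \<in> A" and x: "x \<in> fst c"
  shows "cderiv c c id x = id"
proof -
  have "cderiv c c id x = frechet_derivative id (at (snd c x))"
    unfolding cderiv_def
    by (rule frechet_derivative_cong_open[of "snd c ` fst c"])
      (use A c x in \<open>auto simp: smooth_atlas_def chart_inv_left\<close>)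
  then show ?thesis by simp
qed

lemma mderiv_cong:
  assumes A: "smooth_atlas A" and x: "x \<in> U" and U: "openin (mtop A) U"
    and eq: "\<And>y. y \<in> U \<Longrightarrow> f y = g y"
  shows "mderiv A B f x = mderiv A B g x"
proof -
  have "x \<in> mcarrier A" using x U openin_mtop_subset by blast
  then show ?thesis
    unfolding mderiv_cderiv using eq[OF x] cderiv_cong[OF A _ x _ U, of _ f g] eq chart_atD[of x A] by simp
qed

lemma mderiv_id:
  assumes A: "smooth_atlas A" and x: "x \<in> mcarrier A"
  shows "mderiv A A id x = id"
  unfolding mderiv_cderiv using cderiv_id[OF A] chart_atD[OF x] by simp

lemma linear_mderiv:
  assumes "smooth_map_on A B U f" "x \<in> U"
  shows "linear (mderiv A B f x)"
proof -
  have "x \<in> mcarrier A" "f x \<in> mcarrier B" using openin_mtop_subset[OF smooth_map_on_openin[OF assms(1)]] smooth_map_on_into[OF assms] assms(2) by auto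
  then show ?thesis unfolding mderiv_cderiv by (intro linear_cderiv[OF assms(1)]) (auto simp: chart_atD assms(2))
qed

lemma mderiv_compose:
  assumes f: "smooth_map_on A B U f" and g: "smooth_map_on B C V g"
    and A: "inj_atlas A" and B: "inj_atlas B" and x: "x \<in> U" "f x \<in> V"
  shows "mderiv A C (g \<circ> f) x v = mderiv B C g (f x) (mderiv A B f x v)"
proof -
  have m: "x \<in> mcarrier A" "f x \<in> mcarrier B" "g (f x) \<in> mcarrier C"
    using openin_mtop_subset[OF smooth_map_on_openin[OF f]] smooth_map_on_into[OF f] smooth_map_on_into[OF g] x by auto
  have "cderiv (chart_at A x) (chart_at C (g (f x))) (g \<circ> f) x v =
     cderiv (chart_at B (f x)) (chart_at C (g (f x))) g (f x) (cderiv (chart_at A x) (chart_at B (f x)) f x v)"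
    by (intro cderiv_compose[OF f g A B]) (auto simp: x m chart_atD)
  then show ?thesis by (simp add: mderiv_cderiv)
qed

text \<open>Both sides are the derivative of \<open>f\<close> from the preferred chart at
  \<open>x\<close> to the chart \<open>d\<close>, factored as \<open>f \<circ> id\<close> and as
  \<open>id \<circ> f\<close>.\<close>

lemma cderiv_tcoord:
  assumes A: "smooth_atlas A" and B: "smooth_atlas B" and f: "smooth_map_on A B U f"
    and c: "c \<in> A" "x \<in> fst c" and d: "d \<in> B" "f x \<in> fst d" and x: "x \<in> U"
  shows "cderiv c d f x (tcoord A c x v) = tcoord B d (f x) (mderiv A B f x v)"
proof -
  have m: "x \<in> mcarrier A" "f x \<in> mcarrier B"
    using c d by (auto simp: mcarrier_def)
  note iA = smooth_atlas_inj_atlas[OF A] and iB = smooth_atlas_inj_atlas[OF B]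
  have 1: "cderiv (chart_at A x) d (f \<circ> id) x v = cderiv c d f (id x) (cderiv (chart_at A x) c id x v)"
    by (rule cderiv_compose[OF smooth_map_on_id[OF A] f iA iA])
      (simp_all add: chart_atD m c d x)
  have 2: "cderiv (chart_at A x) d (id \<circ> f) x v
      = cderiv (chart_at B (f x)) d id (f x) (cderiv (chart_at A x) (chart_at B (f x)) f x v)"
    by (rule cderiv_compose[OF f smooth_map_on_id[OF B] iA iB])
      (simp_all add: chart_atD m c d x)
  show ?thesis
    unfolding tcoord_cderiv mderiv_cderiv using 1 2 by simp
qed

lemma tvec_tcoord:
  assumes A: "smooth_atlas A" and c: "c \<in> A" "x \<in> fst c"
  shows "tvec A c x (tcoord A c x v) = v" "tcoord A c x (tvec A c x v) = v"
proof -
  note iA = smooth_atlas_inj_atlas[OF A]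
  have m: "x \<in> mcarrier A" using c by (auto simp: mcarrier_def)
  have cc: "cderiv a b id x (cderiv b a id x v) = v"
    if "a \<in> A" "x \<in> fst a" "b \<in> A" "x \<in> fst b" for a b
  proof -
    have "cderiv b b (id \<circ> id) x v = cderiv a b id (id x) (cderiv b a id x v)"
      by (rule cderiv_compose[OF smooth_map_on_id[OF A] smooth_map_on_id[OF A] iA iA])
        (use that m in simp_all)
    then show ?thesis using cderiv_id[OF A that(3,4)] by simp
  qed
  show "tvec A c x (tcoord A c x v) = v" "tcoord A c x (tvec A c x v) = v"
    unfolding tvec_cderiv tcoord_cderiv using cc c chart_atD[OF m] by simp_all
qed

lemma linear_tcoord:
  assumes A: "smooth_atlas A" and c: "c \<in> A" "x \<in> fst c"
  shows "linear (tcoord A c x)"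
proof -
  have m: "x \<in> mcarrier A" using c by (auto simp: mcarrier_def)
  show ?thesis unfolding tcoord_cderiv
    using chart_atD[OF m] m c by (intro linear_cderiv[OF smooth_map_on_id[OF A]]) auto
qed

lemma tcoord_eq_0_iff:
  assumes A: "smooth_atlas A" and c: "c \<in> A" "x \<in> fst c"
  shows "tcoord A c x v = 0 \<longleftrightarrow> v = 0"
  by (metis assms linear_0 linear_tcoord tvec_tcoord(1))

lemma tcoord_chart_at: "smooth_atlas A \<Longrightarrow> x \<in> mcarrier A \<Longrightarrow> tcoord A (chart_at A x) x = id"
  by (simp add: tcoord_cderiv cderiv_id chart_atD)

subsection \<open>Vector fields\<close>

definition vrep :: "('a, 'e::euclidean_space) atlas \<Rightarrow> ('a, 'e) chart \<Rightarrow> ('a \<Rightarrow> 'e) \<Rightarrow> 'e \<Rightarrow> 'e" where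
  "vrep A c X y = tcoord A c (chart_inv c y) (X (chart_inv c y))"

lemma vrep_chart: "inj_on (snd c) (fst c) \<Longrightarrow> x \<in> fst c \<Longrightarrow> vrep A c X (snd c x) = tcoord A c x (X x)"
  by (simp add: vrep_def chart_inv_left)

lemma smooth_vf_vrep: "smooth_vf A U X \<Longrightarrow> c \<in> A \<Longrightarrow> smooth_on (snd c ` (fst c \<inter> U)) (vrep A c X)"
  by (simp add: smooth_vf_def vrep_def[abs_def])

lemma smooth_vf_openin: "smooth_vf A U X \<Longrightarrow> openin (mtop A) U"
  by (simp add: smooth_vf_def)

lemma smooth_vfI:
  "openin (mtop A) U \<Longrightarrow> (\<And>c. c \<in> A \<Longrightarrow> smooth_on (snd c ` (fst c \<inter> U)) (vrep A c X)) \<Longrightarrow> smooth_vf A U X"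
  by (simp add: smooth_vf_def vrep_def[abs_def])

lemma smooth_vf_subset:
  assumes A: "smooth_atlas A" and X: "smooth_vf A U X" and V: "openin (mtop A) V" "V \<subseteq> U"
  shows "smooth_vf A V X"
proof (rule smooth_vfI[OF V(1)])
  fix c assume c: "c \<in> A"
  show "smooth_on (snd c ` (fst c \<inter> V)) (vrep A c X)"
    by (rule smooth_on_subset[OF smooth_vf_vrep[OF X c] open_chart_image[OF A c V(1)]]) (use V in auto)
qed

lemma smooth_vf_scaleR:
  assumes A: "smooth_atlas A" and X: "smooth_vf A U X"
    and f: "\<And>c. c \<in> A \<Longrightarrow> smooth_on (snd c ` (fst c \<inter> U)) (f \<circ> chart_inv c)"
  shows "smooth_vf A U (\<lambda>x. f x *\<^sub>R X x)"
proof (rule smooth_vfI[OF smooth_vf_openin[OF X]])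
  fix c assume c: "c \<in> A"
  show "smooth_on (snd c ` (fst c \<inter> U)) (vrep A c (\<lambda>x. f x *\<^sub>R X x))"
  proof (rule smooth_on_cong[OF smooth_on_scaleR[OF f[OF c] smooth_vf_vrep[OF X c]]])
    fix y assume "y \<in> snd c ` (fst c \<inter> U)"
    then have "chart_inv c y \<in> fst c" by (auto intro: chart_inv_right(2))
    then show "(f \<circ> chart_inv c) y *\<^sub>R vrep A c X y = vrep A c (\<lambda>x. f x *\<^sub>R X x) y"
      by (simp add: vrep_def linear_scale[OF linear_tcoord[OF A c]])
  qed
qed

lemma smooth_vf_add:
  assumes A: "smooth_atlas A" and X: "smooth_vf A U X" and Y: "smooth_vf A U Y"
  shows "smooth_vf A U (\<lambda>x. X x + Y x)"
proof (rule smooth_vfI[OF smooth_vf_openin[OF X]])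
  fix c assume c: "c \<in> A"
  show "smooth_on (snd c ` (fst c \<inter> U)) (vrep A c (\<lambda>x. X x + Y x))"
  proof (rule smooth_on_cong[OF smooth_on_add[OF smooth_vf_vrep[OF X c] smooth_vf_vrep[OF Y c]]])
    fix y assume "y \<in> snd c ` (fst c \<inter> U)"
    then have "chart_inv c y \<in> fst c" by (auto intro: chart_inv_right(2))
    then show "vrep A c X y + vrep A c Y y = vrep A c (\<lambda>x. X x + Y x) y"
      by (simp add: vrep_def linear_add[OF linear_tcoord[OF A c]])
  qed
qed

lemma smooth_vf_scaleR_const:
  assumes A: "smooth_atlas A" and X: "smooth_vf A U X"
  shows "smooth_vf A U (\<lambda>x. a *\<^sub>R X x)"
  by (rule smooth_vf_scaleR[OF A X])
    (use open_chart_image[OF A _ smooth_vf_openin[OF X]] in \<open>auto simp: o_def intro: smooth_on_const\<close>)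

section \<open>Leaves of line fields\<close>

lemma chart_inv_id: "chart_inv (UNIV, id) = id"
  by (simp add: chart_inv_def)

lemma mcarrier_eucl_atlas: "mcarrier eucl_atlas = UNIV"
  by (simp add: mcarrier_def eucl_atlas_def)

lemma smooth_atlas_eucl_atlas: "smooth_atlas eucl_atlas"
  by (simp add: smooth_atlas_def eucl_atlas_def chart_inv_id smooth_on_ident[unfolded id_def[symmetric]])

lemma chart_at_eucl_atlas: "chart_at eucl_atlas x = (UNIV, id)"
  using chart_atD[of x eucl_atlas] unfolding mcarrier_eucl_atlas by (simp add: eucl_atlas_def)

lemma openin_eucl_atlas: "openin (mtop eucl_atlas) U \<longleftrightarrow> open U"
proof
  have "(UNIV, id) \<in> eucl_atlas" by (simp add: eucl_atlas_def)
  from open_chart_image[OF smooth_atlas_eucl_atlas this, of U]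
  show "openin (mtop eucl_atlas) U \<Longrightarrow> open U" by simp
  show "openin (mtop eucl_atlas) U" if "open U"
    by (rule openin_mtopI[OF smooth_atlas_inj_atlas[OF smooth_atlas_eucl_atlas]])
      (use that in \<open>simp_all add: mcarrier_eucl_atlas\<close>, simp add: eucl_atlas_def)
qed

lemma smooth_map_on_eucl_atlas: "smooth_on U f \<Longrightarrow> smooth_map_on eucl_atlas eucl_atlas U f"
  unfolding smooth_map_on_def openin_eucl_atlas mcarrier_eucl_atlas
  by (simp add: eucl_atlas_def chart_inv_id smooth_on_open)

section \<open>Curves tangent to a field of subspaces, and leaves as equivalence classes\<close>

definition tangent_curve :: "('a, 'e::euclidean_space) atlas \<Rightarrow> ('a \<Rightarrow> 'e set) \<Rightarrow> real set \<Rightarrow> (real \<Rightarrow> 'a) \<Rightarrow> bool" where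
  "tangent_curve A W J \<gamma> \<longleftrightarrow> smooth_curve A J \<gamma> \<and> (\<forall>t\<in>J. velocity A \<gamma> t \<in> W (\<gamma> t))"

lemma leaf_iff:
  "y \<in> leaf A W x \<longleftrightarrow>
    (\<exists>\<gamma> J. open J \<and> is_interval J \<and> {0..1} \<subseteq> J \<and> tangent_curve A W J \<gamma> \<and> \<gamma> 0 = x \<and> \<gamma> 1 = y)"
  by (auto simp: leaf_def tangent_curve_def)

lemma tangent_curve_smooth: "tangent_curve A W J \<gamma> \<Longrightarrow> smooth_map_on eucl_atlas A J \<gamma>"
  by (simp add: tangent_curve_def smooth_curve_def)

text \<open>The velocity is multiplied by the derivative of \<tau>, and a subspace is closed under
  scaling. The factor may be zero, so curves are allowed to stop.\<close>

lemma tangent_curve_reparam: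
  assumes \<gamma>: "tangent_curve A W J \<gamma>" and \<tau>: "smooth_on I \<tau>" "\<tau> ` I \<subseteq> J"
    and W: "\<And>x. x \<in> mcarrier A \<Longrightarrow> subspace (W x)"
  shows "tangent_curve A W I (\<gamma> \<circ> \<tau>)"
  unfolding tangent_curve_def smooth_curve_def
proof (intro conjI ballI)
  note iE = smooth_atlas_inj_atlas[OF smooth_atlas_eucl_atlas]
  have s\<gamma>: "smooth_map_on eucl_atlas A J \<gamma>" using \<gamma> by (rule tangent_curve_smooth)
  have s\<tau>: "smooth_map_on eucl_atlas eucl_atlas I \<tau>" using \<tau>(1) by (rule smooth_map_on_eucl_atlas)
  show "smooth_map_on eucl_atlas A I (\<gamma> \<circ> \<tau>)"
    by (rule smooth_map_on_compose[OF iE smooth_atlas_eucl_atlas s\<tau> s\<gamma> \<tau>(2)])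
  fix t assume t: "t \<in> I"
  then have \<tau>t: "\<tau> t \<in> J" using \<tau>(2) by auto
  let ?r = "mderiv eucl_atlas eucl_atlas \<tau> t 1"
  have "velocity A (\<gamma> \<circ> \<tau>) t = mderiv eucl_atlas A \<gamma> (\<tau> t) ?r"
    unfolding velocity_def by (rule mderiv_compose[OF s\<tau> s\<gamma> iE iE t \<tau>t])
  also have "\<dots> = ?r *\<^sub>R velocity A \<gamma> (\<tau> t)"
    unfolding velocity_def using linear_scale[OF linear_mderiv[OF s\<gamma> \<tau>t], of ?r 1] by simp
  also have "\<dots> \<in> W (\<gamma> (\<tau> t))"
    using W[OF smooth_map_on_into[OF s\<gamma> \<tau>t]] \<gamma> \<tau>t by (auto simp: tangent_curve_def intro: subspace_scale)
  finally show "velocity A (\<gamma> \<circ> \<tau>) t \<in> W ((\<gamma> \<circ> \<tau>) t)" by simp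
qed

lemma tangent_curve_cong:
  assumes \<gamma>: "tangent_curve A W J \<gamma>" and eq: "\<And>t. t \<in> J \<Longrightarrow> \<gamma> t = \<delta> t"
  shows "tangent_curve A W J \<delta>"
  unfolding tangent_curve_def smooth_curve_def
proof (intro conjI ballI)
  note s\<gamma> = tangent_curve_smooth[OF \<gamma>]
  show "smooth_map_on eucl_atlas A J \<delta>"
    by (rule smooth_map_on_cong[OF s\<gamma> eq smooth_atlas_inj_atlas[OF smooth_atlas_eucl_atlas]])
  fix t assume t: "t \<in> J"
  have "mderiv eucl_atlas A \<gamma> t = mderiv eucl_atlas A \<delta> t"
    by (rule mderiv_cong[OF smooth_atlas_eucl_atlas t smooth_map_on_openin[OF s\<gamma>] eq])
  then show "velocity A \<delta> t \<in> W (\<delta> t)"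
    using \<gamma> t eq[OF t] unfolding velocity_def tangent_curve_def by auto
qed

lemma tangent_curve_locally:
  assumes "\<And>t. t \<in> J \<Longrightarrow> \<exists>T. t \<in> T \<and> T \<subseteq> J \<and> tangent_curve A W T \<gamma>"
  shows "tangent_curve A W J \<gamma>"
  unfolding tangent_curve_def smooth_curve_def
proof (intro conjI ballI)
  show "smooth_map_on eucl_atlas A J \<gamma>"
  proof (rule smooth_map_on_locally)
    fix t assume "t \<in> J"
    from assms[OF this] show "\<exists>T. t \<in> T \<and> T \<subseteq> J \<and> smooth_map_on eucl_atlas A T \<gamma>"
      using tangent_curve_smooth by blast
  qed
  fix t assume "t \<in> J"
  from assms[OF this] show "velocity A \<gamma> t \<in> W (\<gamma> t)" by (auto simp: tangent_curve_def)
qed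

lemma tangent_curve_const:
  assumes x: "x \<in> mcarrier A" and W: "subspace (W x)"
  shows "tangent_curve A W UNIV (\<lambda>_. x)"
  unfolding tangent_curve_def smooth_curve_def smooth_map_on_def
proof (intro conjI ballI)
  fix c :: "(real, real) chart" and d assume c: "c \<in> eucl_atlas" and d: "d \<in> A"
  have S: "snd c ` (fst c \<inter> UNIV \<inter> (\<lambda>_. x) -` fst d) = (if x \<in> fst d then UNIV else {})"
    using c by (auto simp: eucl_atlas_def)
  have "smooth_on (snd c ` (fst c \<inter> UNIV \<inter> (\<lambda>_. x) -` fst d)) (\<lambda>_. snd d x)"
    unfolding S by (rule smooth_on_const) simp
  then show "smooth_on (snd c ` (fst c \<inter> UNIV \<inter> (\<lambda>_. x) -` fst d)) (snd d \<circ> (\<lambda>_. x) \<circ> chart_inv c)"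
    by (simp add: o_def)
next
  fix t :: real
  have "velocity A (\<lambda>_. x) t = 0" by (simp add: velocity_def mderiv_def o_def)
  then show "velocity A (\<lambda>_. x) t \<in> W x" using W subspace_0 by simp
qed (use x in \<open>auto simp: openin_eucl_atlas\<close>)

lemma leaf_refl: "x \<in> mcarrier A \<Longrightarrow> subspace (W x) \<Longrightarrow> x \<in> leaf A W x"
  unfolding leaf_iff using tangent_curve_const[of x A W]
  by (intro exI[of _ "\<lambda>_. x"] exI[of _ UNIV]) auto

lemma leafI:
  assumes "tangent_curve A W UNIV \<gamma>" "\<gamma> 0 = x" "\<gamma> 1 = y"
  shows "y \<in> leaf A W x"
  unfolding leaf_iff using assms by (intro exI[of _ \<gamma>] exI[of _ UNIV]) auto

text \<open>Precomposition with \<open>smooth_step\<close> turns a curve on an interval around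
  \<open>{0..1}\<close> into one on the whole line that rests outside the unit interval. Such curves
  can be reversed and concatenated without losing smoothness.\<close>

lemma leafE:
  assumes y: "y \<in> leaf A W x" and W: "\<And>x. x \<in> mcarrier A \<Longrightarrow> subspace (W x)"
  obtains \<gamma> where "tangent_curve A W UNIV \<gamma>" "\<And>t. t \<le> 0 \<Longrightarrow> \<gamma> t = x" "\<And>t. t \<ge> 1 \<Longrightarrow> \<gamma> t = y"
proof -
  obtain \<gamma> J where \<gamma>: "{0..1} \<subseteq> J" "tangent_curve A W J \<gamma>" "\<gamma> 0 = x" "\<gamma> 1 = y"
    using y unfolding leaf_iff by blast
  have "tangent_curve A W UNIV (\<gamma> \<circ> smooth_step)"
    by (rule tangent_curve_reparam[OF \<gamma>(2) smooth_on_smooth_step _ W])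
      (use \<gamma>(1) smooth_step_bounds in force)+
  then show thesis by (rule that) (use \<gamma> smooth_step_eq in auto)
qed

lemma smooth_on_affine: "open I \<Longrightarrow> smooth_on I (\<lambda>t::real. a * t + b)"
  by (intro smooth_on_add smooth_on_mult smooth_on_const smooth_on_ident)

lemma leaf_sym:
  assumes y: "y \<in> leaf A W x" and W: "\<And>x. x \<in> mcarrier A \<Longrightarrow> subspace (W x)"
  shows "x \<in> leaf A W y"
proof -
  obtain \<gamma> where \<gamma>: "tangent_curve A W UNIV \<gamma>" "\<And>t. t \<le> 0 \<Longrightarrow> \<gamma> t = x" "\<And>t. t \<ge> 1 \<Longrightarrow> \<gamma> t = y"
    using leafE[OF y W] by blast
  have "tangent_curve A W UNIV (\<gamma> \<circ> (\<lambda>t. (-1) * t + 1))"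
    by (rule tangent_curve_reparam[OF \<gamma>(1) smooth_on_affine _ W]) auto
  then show ?thesis by (rule leafI) (use \<gamma> in auto)
qed

lemma leaf_trans:
  assumes y: "y \<in> leaf A W x" and z: "z \<in> leaf A W y" and W: "\<And>x. x \<in> mcarrier A \<Longrightarrow> subspace (W x)"
  shows "z \<in> leaf A W x"
proof -
  obtain \<gamma> where \<gamma>: "tangent_curve A W UNIV \<gamma>" "\<And>t. t \<le> 0 \<Longrightarrow> \<gamma> t = x" "\<And>t. t \<ge> 1 \<Longrightarrow> \<gamma> t = y"
    using leafE[OF y W] by blast
  obtain \<delta> where \<delta>: "tangent_curve A W UNIV \<delta>" "\<And>t. t \<le> 0 \<Longrightarrow> \<delta> t = y" "\<And>t. t \<ge> 1 \<Longrightarrow> \<delta> t = z"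
    using leafE[OF z W] by blast
  \<comment> \<open>The first curve has arrived at \<open>y\<close> by time 1/3 and the second
    leaves it only after 2/3. Both pieces equal \<open>y\<close> on the overlap of the two open sets
    used below, so switching at 1/2 is smooth.\<close>
  define \<eta> where "\<eta> t = (if t < 1/2 then \<gamma> (3 * t + 0) else \<delta> (3 * t + (-2)))" for t :: real
  have 1: "tangent_curve A W {..<2/3} \<eta>"
  proof (rule tangent_curve_cong)
    show "tangent_curve A W {..<2/3} (\<gamma> \<circ> (\<lambda>t. 3 * t + 0))"
      by (rule tangent_curve_reparam[OF \<gamma>(1) smooth_on_affine _ W]) auto
  qed (auto simp: \<eta>_def \<gamma> \<delta>)
  have 2: "tangent_curve A W {1/3<..} \<eta>"
  proof (rule tangent_curve_cong)
    show "tangent_curve A W {1/3<..} (\<delta> \<circ> (\<lambda>t. 3 * t + (-2)))"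
      by (rule tangent_curve_reparam[OF \<delta>(1) smooth_on_affine _ W]) auto
  qed (auto simp: \<eta>_def \<gamma> \<delta>)
  have "tangent_curve A W UNIV \<eta>"
  proof (rule tangent_curve_locally)
    fix t :: real
    show "\<exists>T. t \<in> T \<and> T \<subseteq> UNIV \<and> tangent_curve A W T \<eta>"
    proof (cases "t < 2/3")
      case True then show ?thesis using 1 by (intro exI[of _ "{..<2/3}"]) auto
    next
      case False then show ?thesis using 2 by (intro exI[of _ "{1/3<..}"]) auto
    qed
  qed
  then show ?thesis by (rule leafI) (auto simp: \<eta>_def \<gamma> \<delta>)
qed

lemma leaf_eq:
  assumes y: "y \<in> leaf A W x" and W: "\<And>x. x \<in> mcarrier A \<Longrightarrow> subspace (W x)"
  shows "leaf A W y = leaf A W x"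
  using leaf_trans[OF y _ W] leaf_trans[OF leaf_sym[OF y W] _ W] by blast

lemma tangent_curve_in_leaf:
  assumes \<gamma>: "tangent_curve A W J \<gamma>" and J: "is_interval J" "0 \<in> J" "t \<in> J"
    and W: "\<And>x. x \<in> mcarrier A \<Longrightarrow> subspace (W x)"
  shows "\<gamma> t \<in> leaf A W (\<gamma> 0)"
proof -
  \<comment> \<open>This runs from 0 to \<open>t\<close> within the segment between them, for either
    sign of \<open>t\<close>.\<close>
  let ?\<tau> = "\<lambda>s. t * smooth_step s"
  have "?\<tau> s \<in> J" for s
  proof -
    have "?\<tau> s \<in> closed_segment 0 t"
      using smooth_step_bounds[of s] by (auto simp: in_segment mult.commute intro!: exI[of _ "smooth_step s"])
    moreover have "closed_segment 0 t \<subseteq> J"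
      using J by (intro closed_segment_subset is_interval_convex) auto
    ultimately show ?thesis by blast
  qed
  then have "tangent_curve A W UNIV (\<gamma> \<circ> ?\<tau>)"
    by (intro tangent_curve_reparam[OF \<gamma>] W smooth_on_mult smooth_on_const smooth_on_smooth_step) auto
  then show ?thesis by (rule leafI) (auto simp: smooth_step_eq)
qed

text \<open>The times at which the curve sits at its starting point form a closed set, by the
  Hausdorff property, and an open one: near such a time the curve is in \<open>V\<close>, has zero
  velocity and is locally constant in a chart. Connectedness of \<open>J\<close> concludes.\<close>

lemma tangent_curve_stationary:
  assumes A: "smooth_atlas A" and haus: "Hausdorff_space (mtop A)"
    and \<gamma>: "tangent_curve A W J \<gamma>" and J: "is_interval J" "0 \<in> J"
    and V: "openin (mtop A) V" "\<gamma> 0 \<in> V"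
    and vel: "\<And>t. t \<in> J \<Longrightarrow> \<gamma> t \<in> V \<Longrightarrow> velocity A \<gamma> t = 0" and t: "t \<in> J"
  shows "\<gamma> t = \<gamma> 0"
proof -
  let ?x = "\<gamma> 0"
  note s\<gamma> = tangent_curve_smooth[OF \<gamma>] and iE = smooth_atlas_inj_atlas[OF smooth_atlas_eucl_atlas]
  have op: "open (J \<inter> \<gamma> -` U)" if "openin (mtop A) U" for U
    using smooth_map_on_vimage[OF iE A s\<gamma> that] by (simp add: openin_eucl_atlas)
  have xA: "?x \<in> mcarrier A" using smooth_map_on_into[OF s\<gamma> J(2)] .
  have "closedin (mtop A) {?x}"
    using closedin_Hausdorff_singleton[OF haus] xA by (simp add: topspace_mtop)
  then have "openin (mtop A) (mcarrier A - {?x})"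
    by (simp add: closedin_def topspace_mtop)
  from op[OF this] have "open (J \<inter> \<gamma> -` (mcarrier A - {?x}))" .
  moreover have "open (J \<inter> \<gamma> -` {?x})"
  proof (subst openI)
    fix s assume s: "s \<in> J \<inter> \<gamma> -` {?x}"
    obtain c where c: "c \<in> A" "?x \<in> fst c" using xA by (auto simp: mcarrier_def)
    have inj: "inj_on (snd c) (fst c)" using A c by (simp add: smooth_atlas_def)
    have "open (J \<inter> \<gamma> -` (V \<inter> fst c))"
      by (intro op openin_Int V openin_mtop_chart_domain c)
    moreover have "s \<in> J \<inter> \<gamma> -` (V \<inter> fst c)" using s V c by auto
    ultimately obtain e where e: "e > 0" "ball s e \<subseteq> J \<inter> \<gamma> -` (V \<inter> fst c)"
      using openE by blast
    have E: "(UNIV, id) \<in> (eucl_atlas :: (real, real) atlas)" by (simp add: eucl_atlas_def)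
    have sm: "smooth_on (J \<inter> \<gamma> -` fst c) (snd c \<circ> \<gamma>)"
      using smooth_map_on_rep[OF s\<gamma> E c(1)] by (simp add: chart_inv_id)
    have "((snd c \<circ> \<gamma>) has_derivative (\<lambda>h. 0)) (at r within ball s e)" if r: "r \<in> ball s e" for r
    proof -
      have rJ: "r \<in> J" "\<gamma> r \<in> V" "\<gamma> r \<in> fst c" using e r by auto
      have "cderiv (UNIV, id) c \<gamma> r 1 = tcoord A c (\<gamma> r) (velocity A \<gamma> r)"
        using cderiv_tcoord[OF smooth_atlas_eucl_atlas A s\<gamma> E _ c(1) rJ(3,1), of 1]
          tcoord_chart_at[OF smooth_atlas_eucl_atlas, of r]
        by (simp add: chart_at_eucl_atlas mcarrier_eucl_atlas velocity_def)
      also have "\<dots> = 0" using vel[OF rJ(1,2)] tcoord_eq_0_iff[OF A c(1) rJ(3)] by simp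
      finally have "frechet_derivative (snd c \<circ> \<gamma>) (at r) 1 = 0"
        by (simp add: cderiv_def chart_inv_id)
      moreover have "linear (frechet_derivative (snd c \<circ> \<gamma>) (at r))"
        using smooth_on_linear_derivative[OF sm] rJ by blast
      ultimately have "frechet_derivative (snd c \<circ> \<gamma>) (at r) h = 0" for h
        using linear_scale[of "frechet_derivative (snd c \<circ> \<gamma>) (at r)" h 1] by simp
      then have "frechet_derivative (snd c \<circ> \<gamma>) (at r) = (\<lambda>h. 0)" by blast
      then show ?thesis
        using smooth_on_has_derivative[OF sm, of r] rJ has_derivative_at_withinI by fastforce
    qed
    then have "\<exists>k. \<forall>r\<in>ball s e. (snd c \<circ> \<gamma>) r = k"
      by (intro has_derivative_zero_constant convex_ball)
    then have "(snd c \<circ> \<gamma>) r = (snd c \<circ> \<gamma>) s" if "r \<in> ball s e" for r using that e(1) by force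
    then have "\<gamma> r = ?x" if "r \<in> ball s e" for r
      using inj_onD[OF inj, of "\<gamma> r" ?x] that e(2) c(2) s by auto
    then show "\<exists>e>0. ball s e \<subseteq> J \<inter> \<gamma> -` {?x}" using e by blast
  qed auto
  moreover have "connected J" using J(1) is_interval_connected by blast
  moreover have "J \<subseteq> (J \<inter> \<gamma> -` {?x}) \<union> (J \<inter> \<gamma> -` (mcarrier A - {?x}))"
    using smooth_map_on_into[OF s\<gamma>] by auto
  moreover have "(J \<inter> \<gamma> -` {?x}) \<inter> J \<noteq> {}" using J(2) by auto
  ultimately have "(J \<inter> \<gamma> -` (mcarrier A - {?x})) \<inter> J = {}"
    using connectedD[of J "J \<inter> \<gamma> -` {?x}" "J \<inter> \<gamma> -` (mcarrier A - {?x})"] by blast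
  then show ?thesis using t smooth_map_on_into[OF s\<gamma> t] by auto
qed

section \<open>Local frames and the kernel of the leaf projection\<close>

lemma distributionE:
  assumes "distribution A k D" "x \<in> mcarrier A"
  obtains U X where "openin (mtop A) U" "x \<in> U" "\<And>i. i < k \<Longrightarrow> smooth_vf A U (X i)"
    "\<And>y. y \<in> U \<Longrightarrow> inj_on (\<lambda>i::nat. X i y) {..<k}"
    "\<And>y. y \<in> U \<Longrightarrow> independent ((\<lambda>i. X i y) ` {..<k})"
    "\<And>y. y \<in> U \<Longrightarrow> D y = span ((\<lambda>i. X i y) ` {..<k})"
proof -
  let ?P = "\<lambda>U X. openin (mtop A) U \<and> x \<in> U \<and> (\<forall>i<k. smooth_vf A U (X i)) \<and>
        (\<forall>y\<in>U. inj_on (\<lambda>i::nat. X i y) {..<k} \<and> independent ((\<lambda>i. X i y) ` {..<k}) \<and>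
           D y = span ((\<lambda>i. X i y) ` {..<k}))"
  from assms have "\<exists>U X. ?P U X"
    unfolding distribution_def by (rule bspec)
  then obtain U X where "?P U X" by (elim exE)
  then show thesis by (intro that[of U X]) simp_all
qed

lemma distribution_subspace: "distribution A k D \<Longrightarrow> x \<in> mcarrier A \<Longrightarrow> subspace (D x)"
  by (erule (1) distributionE) simp

lemma distribution_1_frame:
  assumes "distribution A 1 W" "x \<in> mcarrier A"
  obtains U X where "smooth_vf A U X" "x \<in> U" "\<And>y. y \<in> U \<Longrightarrow> X y \<noteq> 0 \<and> W y = span {X y}"
proof -
  obtain U X where U: "x \<in> U" "\<And>i. i < 1 \<Longrightarrow> smooth_vf A U (X i)"
    "\<And>y. y \<in> U \<Longrightarrow> independent ((\<lambda>i::nat. X i y) ` {..<1})"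
    "\<And>y. y \<in> U \<Longrightarrow> W y = span ((\<lambda>i. X i y) ` {..<1})"
    using distributionE[OF assms] by metis
  have im: "(\<lambda>i. X i y) ` {..<1} = {X 0 y}" for y by auto
  show thesis
  proof (rule that[of U "X 0"])
    show "X 0 y \<noteq> 0 \<and> W y = span {X 0 y}" if "y \<in> U" for y
      using U(3,4)[OF that] unfolding im by simp
  qed (use U in simp_all)
qed

text \<open>If the differential of the leaf projection did not vanish on \<open>W\<close> near \<open>x\<close>, curves tangent to
  \<open>W\<close>, being contained in fibres, would be stationary there. Hence the leaves near \<open>x\<close> would be points
  and the projection would be injective, which invariance of dimension rules out. This avoids
  integrating \<open>W\<close>.\<close>

lemma mderiv_leaf_eq_0:
  fixes A :: "('a, 'e::euclidean_space) atlas" and L :: "('a set, 'f::euclidean_space) atlas"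
  assumes A: "smooth_manifold A" and L: "smooth_atlas L" and W: "distribution A 1 W"
    and p: "smooth_map_on A L (mcarrier A) (leaf A W)" and dim: "DIM('f) < DIM('e)"
    and x: "x \<in> mcarrier A" and w: "w \<in> W x"
  shows "mderiv A L (leaf A W) x w = 0"
proof (rule ccontr)
  let ?p = "leaf A W"
  assume ne: "mderiv A L ?p x w \<noteq> 0"
  have At: "smooth_atlas A" and haus: "Hausdorff_space (mtop A)"
    using A smooth_manifold_smooth_atlas by (auto simp: smooth_manifold_def)
  note sub = distribution_subspace[OF W]
  obtain U X where X: "smooth_vf A U X" "x \<in> U" and WX: "\<And>y. y \<in> U \<Longrightarrow> X y \<noteq> 0 \<and> W y = span {X y}"
    using distribution_1_frame[OF W x] by metis
  have linp: "linear (mderiv A L ?p y)" if "y \<in> mcarrier A" for y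
    by (rule linear_mderiv[OF p that])
  obtain c where c: "c \<in> A" "x \<in> fst c" using x by (auto simp: mcarrier_def)
  obtain d where d: "d \<in> L" "?p x \<in> fst d" using smooth_map_on_into[OF p x] by (auto simp: mcarrier_def)
  have injc: "inj_on (snd c) (fst c)" and injd: "inj_on (snd d) (fst d)"
    using At L c d by (auto simp: smooth_atlas_def)
  define S where "S = snd c ` (fst c \<inter> mcarrier A \<inter> ?p -` fst d) \<inter> snd c ` (fst c \<inter> U)"
  have S: "open S" unfolding S_def
    by (intro open_Int smooth_on_open[OF smooth_map_on_rep[OF p c(1) d(1)]]
        smooth_on_open[OF smooth_vf_vrep[OF X(1) c(1)]])
  let ?P = "snd d \<circ> ?p \<circ> chart_inv c"
  have sP: "smooth_on S ?P"
    by (rule smooth_on_subset[OF smooth_map_on_rep[OF p c(1) d(1)] S]) (auto simp: S_def)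
  \<comment> \<open>\<open>G\<close> is the coordinate expression of dp(X) for a local generator
    \<open>X\<close> of \<open>W\<close>. Being continuous, it stays nonzero near \<open>x\<close>;
    the set \<open>O'\<close> below is the neighbourhood where it does.\<close>
  define G where "G y = frechet_derivative ?P (at y) (vrep A c X y)" for y
  have "smooth_on S (vrep A c X)"
    by (rule smooth_on_subset[OF smooth_vf_vrep[OF X(1) c(1)] S]) (auto simp: S_def)
  then have sG: "smooth_on S G" unfolding G_def[abs_def] by (rule smooth_on_derivative_field[OF sP])
  have G: "G (snd c y) = tcoord L d (?p y) (mderiv A L ?p y (X y))" if "y \<in> fst c" "?p y \<in> fst d" for y
    using cderiv_tcoord[OF At L p c(1) that(1) d(1) that(2), of "X y"] that chart_subset_mcarrier[OF c(1)]
    by (auto simp: G_def cderiv_def vrep_chart[OF injc])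
  define O' where "O' = fst c \<inter> snd c -` (S \<inter> G -` (- {0}))"
  have oO: "open (S \<inter> G -` (- {0}))" by (rule smooth_on_open_vimage[OF sG]) auto
  have O': "openin (mtop A) O'" unfolding O'_def by (rule openin_mtop_chart[OF c(1) oO])
  have O'D: "y \<in> fst c" "y \<in> U" "?p y \<in> fst d" "mderiv A L ?p y (X y) \<noteq> 0" if "y \<in> O'" for y
  proof -
    show 1: "y \<in> fst c" "y \<in> U" "?p y \<in> fst d"
      using that injc by (auto simp: O'_def S_def inj_on_def)
    have "G (snd c y) \<noteq> 0" using that by (simp add: O'_def)
    then show "mderiv A L ?p y (X y) \<noteq> 0"
      using G[OF 1(1,3)] tcoord_eq_0_iff[OF L d(1) 1(3)] by auto
  qed
  have "x \<in> O'"
  proof -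
    obtain k where "w = k *\<^sub>R X x" using w WX[OF X(2)] by (auto simp: span_singleton)
    then have "mderiv A L ?p x (X x) \<noteq> 0" using ne linear_scale[OF linp[OF x]] by auto
    then have "G (snd c x) \<noteq> 0" using G[OF c(2) d(2)] tcoord_eq_0_iff[OF L d] by simp
    then show ?thesis using c d x X(2) by (auto simp: O'_def S_def)
  qed
  \<comment> \<open>A curve within the leaf of \<open>z\<close> has constant image under p, so dp
    kills its velocity. Inside \<open>O'\<close> the velocity is a multiple of \<open>X\<close>, on
    which dp does not vanish, and hence is zero.\<close>
  have leaf1: "?p z = {z}" if z: "z \<in> O'" for z
  proof -
    have zA: "z \<in> mcarrier A" using O'D(1)[OF z] chart_subset_mcarrier[OF c(1)] by auto
    have "y = z" if yz: "y \<in> ?p z" for y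
    proof -
      obtain \<gamma> where \<gamma>: "tangent_curve A W UNIV \<gamma>" "\<gamma> 0 = z" "\<gamma> 1 = y"
        using leafE[OF yz sub] by (metis order_refl)
      note s\<gamma> = tangent_curve_smooth[OF \<gamma>(1)]
      have const: "?p (\<gamma> t) = ?p z" for t
        using leaf_eq[OF tangent_curve_in_leaf[OF \<gamma>(1) _ _ _ sub]  sub, of t] \<gamma>(2) by simp
      have "velocity A \<gamma> t = 0" if t: "\<gamma> t \<in> O'" for t
      proof -
        have \<gamma>A: "\<gamma> t \<in> mcarrier A" using smooth_map_on_into[OF s\<gamma>] by simp
        obtain k where k: "velocity A \<gamma> t = k *\<^sub>R X (\<gamma> t)"
          using \<gamma>(1) WX[OF O'D(2)[OF t]] by (auto simp: tangent_curve_def span_singleton)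
        have "mderiv A L ?p (\<gamma> t) (velocity A \<gamma> t) = mderiv eucl_atlas L (?p \<circ> \<gamma>) t 1"
          unfolding velocity_def
          by (rule mderiv_compose[OF s\<gamma> p smooth_atlas_inj_atlas[OF smooth_atlas_eucl_atlas]
                smooth_atlas_inj_atlas[OF At] UNIV_I \<gamma>A, symmetric])
        also have "\<dots> = 0" by (simp add: const mderiv_def o_def)
        finally show ?thesis
          using O'D(4)[OF t] linear_scale[OF linp[OF \<gamma>A]] by (simp add: k)
      qed
      then have "\<gamma> 1 = \<gamma> 0"
        using z \<gamma>(2) by (intro tangent_curve_stationary[OF At haus \<gamma>(1) _ _ O']) auto
      then show ?thesis using \<gamma> by simp
    qed
    then show ?thesis using leaf_refl[of z A W, OF zA sub[OF zA]] by blast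
  qed
  have "inj_on ?P (S \<inter> G -` (- {0}))"
  proof (rule inj_onI)
    fix y z assume y: "y \<in> S \<inter> G -` (- {0})" and z: "z \<in> S \<inter> G -` (- {0})" and eq: "?P y = ?P z"
    have yc: "y \<in> snd c ` fst c" "z \<in> snd c ` fst c" using y z by (auto simp: S_def)
    have "chart_inv c y \<in> O'" "chart_inv c z \<in> O'"
      using y z chart_inv_right[OF yc(1)] chart_inv_right[OF yc(2)] by (auto simp: O'_def)
    then have "chart_inv c y = chart_inv c z"
      using eq O'D(3) inj_onD[OF injd, of "?p (chart_inv c y)" "?p (chart_inv c z)"] leaf1 by auto
    then have "snd c (chart_inv c y) = snd c (chart_inv c z)" by (rule arg_cong)
    then show "y = z" unfolding chart_inv_right(1)[OF yc(1)] chart_inv_right(1)[OF yc(2)] .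
  qed
  moreover have "continuous_on (S \<inter> G -` (- {0})) ?P"
    using continuous_on_subset[OF smooth_on_continuous_on[OF sP]] by blast
  moreover have "S \<inter> G -` (- {0}) \<noteq> {}" using \<open>x \<in> O'\<close> by (auto simp: O'_def)
  ultimately have "DIM('e) \<le> DIM('f)" using invariance_of_dimension oO by blast
  then show False using dim by simp
qed

text \<open>Two independent kernel vectors extend to a basis of the source. The images of the
  remaining basis vectors would have to span the target, and there is one too few of them.\<close>

lemma surj_kernel_line:
  fixes f :: "'e::euclidean_space \<Rightarrow> 'f::euclidean_space"
  assumes f: "linear f" "surj f" and dim: "DIM('e) = DIM('f) + 1" and w: "f w = 0" "w \<noteq> 0" and v: "f v = 0"
  shows "v \<in> span {w}"
proof (rule ccontr)
  assume nv: "v \<notin> span {w}"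
  then have ind: "independent {v, w}" and vw: "v \<noteq> w"
    using w by (auto simp: independent_insert span_base)
  obtain B where "{v, w} \<subseteq> B" "B \<subseteq> UNIV" "independent B" "UNIV \<subseteq> span B"
    by (rule maximal_independent_subset_extend[OF subset_UNIV ind])
  then have B: "{v, w} \<subseteq> B" "independent B" "span B = UNIV" by (simp_all add: top.extremum_uniqueI)
  have finB: "finite B" and cardB: "card B = DIM('e)"
    using B independent_bound dim_eq_card_independent[OF B(2)] dim_span[of B] by auto
  have "f ` B \<subseteq> insert 0 (f ` (B - {v, w}))" using w v by auto
  then have "span (f ` B) \<subseteq> span (insert 0 (f ` (B - {v, w})))" by (rule span_mono)
  then have "span (f ` B) \<subseteq> span (f ` (B - {v, w}))" by simp
  moreover have "span (f ` B) = UNIV" using B(3) f linear_span_image[OF f(1), of B] by simp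
  ultimately have "DIM('f) \<le> card (f ` (B - {v, w}))"
    using dim_le_card[of UNIV "f ` (B - {v, w})"] finB by auto
  also have "\<dots> \<le> card (B - {v, w})" using finB card_image_le by blast
  also have "\<dots> = card B - 2" using B(1) finB vw by (simp add: card_Diff_subset)
  \<comment> \<open>\<open>DIM_positive\<close> guards against truncated subtraction: with a target
    of dimension 0 the inequality would hold.\<close>
  finally show False using cardB dim DIM_positive[where 'a = 'f] by linarith
qed

text \<open>The kernel contains the line \<open>W x\<close>; surjectivity and a drop in dimension of
  one leave room for nothing more.\<close>

lemma mderiv_leaf_eq_0_iff:
  fixes A :: "('a, 'e::euclidean_space) atlas" and L :: "('a set, 'f::euclidean_space) atlas"
  assumes A: "smooth_manifold A" and W: "distribution A 1 W" and L: "leaf_manifold A W L"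
    and dim: "DIM('e) = DIM('f) + 1" and x: "x \<in> mcarrier A"
  shows "mderiv A L (leaf A W) x v = 0 \<longleftrightarrow> v \<in> W x"
proof
  have Lt: "smooth_atlas L" and p: "smooth_map_on A L (mcarrier A) (leaf A W)"
    and sj: "surj (mderiv A L (leaf A W) x)"
    using L x smooth_manifold_smooth_atlas by (auto simp: leaf_manifold_def submersion_def)
  have ker: "mderiv A L (leaf A W) x w = 0" if "w \<in> W x" for w
    using mderiv_leaf_eq_0[OF A Lt W p _ x that] dim by simp
  then show "mderiv A L (leaf A W) x v = 0" if "v \<in> W x" using that .
  assume v: "mderiv A L (leaf A W) x v = 0"
  obtain w where "w \<noteq> 0" "W x = span {w}"
    using distribution_1_frame[OF W x] by metis
  then show "v \<in> W x"
    using surj_kernel_line[OF linear_mderiv[OF p x] sj dim ker _ v, of w] by (simp add: span_base)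
qed

section \<open>Brackets of sections\<close>

lemma lie_bracket_vrep:
  "lie_bracket A X Y x = (let c = chart_at A x; y = snd c x in
     frechet_derivative (vrep A c Y) (at y) (vrep A c X y) - frechet_derivative (vrep A c X) (at y) (vrep A c Y y))"
  by (simp add: lie_bracket_def vrep_def[abs_def] Let_def)

text \<open>\<open>[X, f Y] = Y\<close> at a point where \<open>f\<close> vanishes and has derivative one along \<open>X\<close>.\<close>

lemma distribution_subset_dist_bracket:
  assumes A: "smooth_atlas A" and D: "distribution A k D" and k: "k > 0" and x: "x \<in> mcarrier A"
  shows "D x \<subseteq> dist_bracket A D D x"
proof -
  obtain U X where U: "openin (mtop A) U" "x \<in> U" and X: "\<And>i. i < k \<Longrightarrow> smooth_vf A U (X i)"
    and ind: "independent ((\<lambda>i::nat. X i x) ` {..<k})"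
    and span: "\<And>y. y \<in> U \<Longrightarrow> D y = span ((\<lambda>i. X i y) ` {..<k})"
    using distributionE[OF D x] by metis
  define c where "c = chart_at A x"
  have c: "c \<in> A" "x \<in> fst c" using chart_atD[OF x] by (auto simp: c_def)
  have inj: "inj_on (snd c) (fst c)" using A c by (simp add: smooth_atlas_def)
  have id: "tcoord A c x = id" unfolding c_def by (rule tcoord_chart_at[OF A x])
  define V where "V = U \<inter> fst c"
  have V: "openin (mtop A) V" "V \<subseteq> U" "V \<subseteq> fst c" "x \<in> V"
    using U c(2) openin_Int[OF U(1) openin_mtop_chart_domain[OF c(1)]] by (auto simp: V_def)
  have XV: "smooth_vf A V (X i)" if "i < k" for i by (rule smooth_vf_subset[OF A X[OF that] V(1,2)])
  have X0: "X 0 x \<noteq> 0" using ind k dependent_zero by (metis (no_types, lifting) image_eqI lessThan_iff)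
  \<comment> \<open>The normalization makes the derivative of \<open>f\<close> along
    \<open>X 0\<close> equal to one at \<open>x\<close>. The vector \<open>X 0 x\<close> is its own
    component vector there, as \<open>c\<close> is the preferred chart.\<close>
  define u where "u = (1 / (X 0 x \<bullet> X 0 x)) *\<^sub>R X 0 x"
  have Xu: "X 0 x \<bullet> u = 1" using X0 by (simp add: u_def)
  define f where "f z = (snd c z - snd c x) \<bullet> u" for z
  have f: "smooth_on (snd d ` (fst d \<inter> V)) (f \<circ> chart_inv d)" if d: "d \<in> A" for d
  proof -
    have "smooth_on (snd d ` (fst d \<inter> fst c)) (snd c \<circ> chart_inv d)"
      using A d c by (simp add: smooth_atlas_def)
    then have "smooth_on (snd d ` (fst d \<inter> V)) (snd c \<circ> chart_inv d)"
      by (rule smooth_on_subset[OF _ open_chart_image[OF A d V(1)]]) (use V in auto)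
    then show ?thesis
      unfolding f_def o_def
      by (intro smooth_on_inner smooth_on_diff smooth_on_const open_chart_image[OF A d V(1)])
  qed
  have sec: "section_on A D V (X i)" "section_on A D V (\<lambda>z. f z *\<^sub>R X i z)" if "i < k" for i
  proof -
    have "X i y \<in> D y" if "y \<in> V" for y
      using that V(2) \<open>i < k\<close> by (auto simp: span subset_iff intro: span_base)
    moreover from this have "f y *\<^sub>R X i y \<in> D y" if "y \<in> V" for y
      using that V(2) by (simp add: span subset_iff span_scale)
    ultimately show "section_on A D V (X i)" "section_on A D V (\<lambda>z. f z *\<^sub>R X i z)"
      using XV[OF that] smooth_vf_scaleR[OF A XV[OF that] f] by (auto simp: section_on_def)
  qed
  have "lie_bracket A (X 0) (\<lambda>z. f z *\<^sub>R X i z) x = X i x" if i: "i < k" for i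
  proof -
    let ?S = "snd c ` (fst c \<inter> V)" and ?y = "snd c x"
    have y: "?y \<in> ?S" and S: "open ?S" using V c open_chart_image[OF A c(1) V(1)] by auto
    have Xi: "smooth_on ?S (vrep A c (X i))" by (rule smooth_vf_vrep[OF XV[OF i] c(1)])
    have X0: "smooth_on ?S (vrep A c (X 0))" by (rule smooth_vf_vrep[OF XV[OF k] c(1)])
    have at: "vrep A c Z ?y = Z x" for Z by (simp add: vrep_chart[OF inj c(2)] id)
    have "frechet_derivative (vrep A c (\<lambda>z. f z *\<^sub>R X i z)) (at ?y)
        = frechet_derivative (\<lambda>y. ((y - ?y) \<bullet> u) *\<^sub>R vrep A c (X i) y) (at ?y)"
    proof (rule frechet_derivative_cong_open[OF S y])
      fix y assume "y \<in> ?S"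
      then have y: "chart_inv c y \<in> fst c" "snd c (chart_inv c y) = y" by (auto simp: chart_inv_left[OF inj])
      show "vrep A c (\<lambda>z. f z *\<^sub>R X i z) y = ((y - ?y) \<bullet> u) *\<^sub>R vrep A c (X i) y"
        using linear_scale[OF linear_tcoord[OF A c(1) y(1)]] y(2) by (simp add: vrep_def f_def)
    qed
    also have "\<dots> = (\<lambda>h. ((?y - ?y) \<bullet> u) *\<^sub>R frechet_derivative (vrep A c (X i)) (at ?y) h + (h \<bullet> u) *\<^sub>R vrep A c (X i) ?y)"
      by (rule frechet_derivative_at[symmetric], rule has_derivative_scaleR[OF _ smooth_on_has_derivative[OF Xi y]])
        (auto intro!: derivative_eq_intros)
    finally have d: "frechet_derivative (vrep A c (\<lambda>z. f z *\<^sub>R X i z)) (at ?y) h = (h \<bullet> u) *\<^sub>R X i x" for h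
      by (simp add: at)
    show ?thesis
      unfolding lie_bracket_vrep c_def[symmetric] Let_def d
      using linear_0[OF smooth_on_linear_derivative[OF X0 y]] Xu by (simp add: at f_def)
  qed
  then have br: "X i x = lie_bracket A (X 0) (\<lambda>z. f z *\<^sub>R X i z) x" if "i < k" for i
    using that by simp
  have "X i x \<in> dist_bracket A D D x" if i: "i < k" for i
    unfolding dist_bracket_def
    by (rule span_base, subst br[OF i]) (use sec(1)[OF k] sec(2)[OF i] V(4) in blast)
  then have "(\<lambda>i. X i x) ` {..<k} \<subseteq> dist_bracket A D D x" by auto
  then show ?thesis
    unfolding span[OF U(2)] by (intro span_minimal) (simp_all add: dist_bracket_def)
qed

text \<open>Differentiating the coefficients contributes only multiples of \<open>w\<close> and
  \<open>r\<close>. The remaining part is bilinear and alternating in the coefficient pairs, whence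
  their determinant.\<close>

lemma bracket_combination:
  assumes w: "smooth_on S w" and r: "smooth_on S r" and y: "y \<in> S"
    and f: "smooth_on S f1" "smooth_on S g1" "smooth_on S f2" "smooth_on S g2"
    and X: "\<And>z. z \<in> S \<Longrightarrow> X z = f1 z *\<^sub>R w z + g1 z *\<^sub>R r z"
    and Y: "\<And>z. z \<in> S \<Longrightarrow> Y z = f2 z *\<^sub>R w z + g2 z *\<^sub>R r z"
  shows "\<exists>a b. frechet_derivative Y (at y) (X y) - frechet_derivative X (at y) (Y y) =
      a *\<^sub>R w y + b *\<^sub>R r y + (f1 y * g2 y - f2 y * g1 y) *\<^sub>R
        (frechet_derivative r (at y) (w y) - frechet_derivative w (at y) (r y))"
proof -
  let ?w = "frechet_derivative w (at y)" and ?r = "frechet_derivative r (at y)"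
  have S: "open S" using w smooth_on_open by blast
  have der: "frechet_derivative Z (at y) h = f y *\<^sub>R ?w h + frechet_derivative f (at y) h *\<^sub>R w y
      + (g y *\<^sub>R ?r h + frechet_derivative g (at y) h *\<^sub>R r y)"
    if "smooth_on S f" "smooth_on S g" "\<And>z. z \<in> S \<Longrightarrow> Z z = f z *\<^sub>R w z + g z *\<^sub>R r z" for Z f g h
  proof -
    have "frechet_derivative Z (at y) = frechet_derivative (\<lambda>z. f z *\<^sub>R w z + g z *\<^sub>R r z) (at y)"
      by (rule frechet_derivative_cong_open[OF S y that(3)])
    also have "\<dots> = (\<lambda>h. f y *\<^sub>R ?w h + frechet_derivative f (at y) h *\<^sub>R w y
      + (g y *\<^sub>R ?r h + frechet_derivative g (at y) h *\<^sub>R r y))"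
      by (rule frechet_derivative_at[symmetric], intro has_derivative_add has_derivative_scaleR
          smooth_on_has_derivative[OF _ y] that w r)
    finally show ?thesis by simp
  qed
  have lw: "linear ?w" and lr: "linear ?r"
    using smooth_on_linear_derivative[OF w y] smooth_on_linear_derivative[OF r y] .
  have dX: "frechet_derivative X (at y) h = f1 y *\<^sub>R ?w h + frechet_derivative f1 (at y) h *\<^sub>R w y
      + (g1 y *\<^sub>R ?r h + frechet_derivative g1 (at y) h *\<^sub>R r y)" for h
    by (rule der[OF f(1,2)]) (rule X)
  have dY: "frechet_derivative Y (at y) h = f2 y *\<^sub>R ?w h + frechet_derivative f2 (at y) h *\<^sub>R w y
      + (g2 y *\<^sub>R ?r h + frechet_derivative g2 (at y) h *\<^sub>R r y)" for h
    by (rule der[OF f(3,4)]) (rule Y)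
  let ?p = "frechet_derivative f2 (at y) (X y) - frechet_derivative f1 (at y) (Y y)"
  let ?q = "frechet_derivative g2 (at y) (X y) - frechet_derivative g1 (at y) (Y y)"
  have "frechet_derivative Y (at y) (X y) - frechet_derivative X (at y) (Y y) =
      ?p *\<^sub>R w y + ?q *\<^sub>R r y + (f2 y *\<^sub>R ?w (X y) + g2 y *\<^sub>R ?r (X y) - f1 y *\<^sub>R ?w (Y y) - g1 y *\<^sub>R ?r (Y y))"
    unfolding dX dY by (simp add: algebra_simps)
  also have "f2 y *\<^sub>R ?w (X y) + g2 y *\<^sub>R ?r (X y) - f1 y *\<^sub>R ?w (Y y) - g1 y *\<^sub>R ?r (Y y)
      = (f1 y * g2 y - f2 y * g1 y) *\<^sub>R (?r (w y) - ?w (r y))"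
    unfolding X[OF y] Y[OF y] linear_add[OF lw] linear_add[OF lr] linear_scale[OF lw] linear_scale[OF lr]
    by (simp add: algebra_simps)
  finally show ?thesis by blast
qed

lemma span_pair_iff: "v \<in> span {w, r} \<longleftrightarrow> (\<exists>a b. v = a *\<^sub>R w + b *\<^sub>R r)"
  by (auto simp: span_insert span_singleton algebra_simps)

text \<open>Otherwise all brackets of sections of \<open>D\<close> would lie in \<open>D\<close>, which has rank two only.\<close>

lemma lie_bracket_frame_notin:
  assumes A: "smooth_atlas A" and E: "distribution A 3 (dist_bracket A D D)" and x: "x \<in> U"
    and w: "smooth_vf A U w" and r: "smooth_vf A U r"
    and ind: "\<And>y a b. y \<in> U \<Longrightarrow> a *\<^sub>R w y + b *\<^sub>R r y = 0 \<Longrightarrow> a = 0 \<and> b = 0"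
    and D: "\<And>y. y \<in> U \<Longrightarrow> D y = span {w y, r y}"
  shows "lie_bracket A w r x \<notin> D x"
proof
  assume br: "lie_bracket A w r x \<in> D x"
  have xA: "x \<in> mcarrier A" using x openin_mtop_subset[OF smooth_vf_openin[OF w]] by blast
  define c where "c = chart_at A x"
  have c: "c \<in> A" "x \<in> fst c" using chart_atD[OF xA] by (auto simp: c_def)
  have inj: "inj_on (snd c) (fst c)" using A c by (simp add: smooth_atlas_def)
  let ?y = "snd c x"
  have at: "vrep A c Z ?y = Z x" for Z
    using tcoord_chart_at[OF A xA] by (simp add: vrep_chart[OF inj c(2)] c_def[symmetric])
  \<comment> \<open>Both sections have smooth coefficients in the frame, which reduces their bracket
    to that of the frame, assumed to lie in \<open>D x\<close>.\<close>
  have "lie_bracket A X Y x \<in> D x" if V: "x \<in> V" "section_on A D V X" "section_on A D V Y" for X Y V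
  proof -
    have vf: "smooth_vf A V X" "smooth_vf A V Y" and XD: "\<And>y. y \<in> V \<Longrightarrow> X y \<in> D y \<and> Y y \<in> D y"
      using V by (auto simp: section_on_def)
    let ?V = "V \<inter> U"
    have oV: "openin (mtop A) ?V" by (rule openin_Int[OF smooth_vf_openin[OF vf(1)] smooth_vf_openin[OF w]])
    let ?S = "snd c ` (fst c \<inter> ?V)"
    have S: "open ?S" and yS: "?y \<in> ?S" using open_chart_image[OF A c(1) oV] V x c by auto
    have sm: "smooth_on ?S (vrep A c Z)" if "smooth_vf A V Z \<or> smooth_vf A U Z" for Z
      using that smooth_vf_vrep[OF smooth_vf_subset[OF A _ oV] c(1), of _ Z] by blast
    have sw: "smooth_on ?S (vrep A c w)" and sr: "smooth_on ?S (vrep A c r)"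
      using sm w r by auto
    have indS: "a = 0 \<and> b = 0" if y: "y \<in> ?S" and "a *\<^sub>R vrep A c w y + b *\<^sub>R vrep A c r y = 0" for y a b
    proof -
      obtain z where z: "z \<in> fst c" "z \<in> U" "y = snd c z" using y by auto
      note lin = linear_tcoord[OF A c(1) z(1)]
      have "tcoord A c z (a *\<^sub>R w z + b *\<^sub>R r z) = 0"
        using that(2) by (simp add: z(3) vrep_chart[OF inj z(1)] linear_add[OF lin] linear_scale[OF lin])
      then show ?thesis using tcoord_eq_0_iff[OF A c(1) z(1)] ind[OF z(2)] by simp
    qed
    have comb: "\<exists>a b. vrep A c Z y = a *\<^sub>R vrep A c w y + b *\<^sub>R vrep A c r y"
      if y: "y \<in> ?S" and Z: "\<And>z. z \<in> V \<Longrightarrow> Z z \<in> D z" for Z y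
    proof -
      obtain z where z: "z \<in> fst c" "z \<in> U" "z \<in> V" "y = snd c z" using y by auto
      note lin = linear_tcoord[OF A c(1) z(1)]
      obtain a b where "Z z = a *\<^sub>R w z + b *\<^sub>R r z"
        using Z[OF z(3)] D[OF z(2)] span_pair_iff by blast
      then have "vrep A c Z y = a *\<^sub>R vrep A c w y + b *\<^sub>R vrep A c r y"
        by (simp add: z(4) vrep_chart[OF inj z(1)] linear_add[OF lin] linear_scale[OF lin])
      then show ?thesis by blast
    qed
    have cX: "\<exists>a b. vrep A c X y = a *\<^sub>R vrep A c w y + b *\<^sub>R vrep A c r y" if "y \<in> ?S" for y
      using comb[OF that] XD by blast
    have cY: "\<exists>a b. vrep A c Y y = a *\<^sub>R vrep A c w y + b *\<^sub>R vrep A c r y" if "y \<in> ?S" for y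
      using comb[OF that] XD by blast
    have sX: "smooth_on ?S (vrep A c X)" and sY: "smooth_on ?S (vrep A c Y)" using sm vf by auto
    obtain f1 g1 where 1: "smooth_on ?S f1" "smooth_on ?S g1"
      "\<And>y. y \<in> ?S \<Longrightarrow> vrep A c X y = f1 y *\<^sub>R vrep A c w y + g1 y *\<^sub>R vrep A c r y"
      by (rule frame_coefficients[OF sw sr sX indS cX]) (assumption | rule that, assumption+)+
    obtain f2 g2 where 2: "smooth_on ?S f2" "smooth_on ?S g2"
      "\<And>y. y \<in> ?S \<Longrightarrow> vrep A c Y y = f2 y *\<^sub>R vrep A c w y + g2 y *\<^sub>R vrep A c r y"
      by (rule frame_coefficients[OF sw sr sY indS cY]) (assumption | rule that, assumption+)+
    obtain a b where "lie_bracket A X Y x = a *\<^sub>R w x + b *\<^sub>R r x +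
        (f1 ?y * g2 ?y - f2 ?y * g1 ?y) *\<^sub>R lie_bracket A w r x"
      using bracket_combination[OF sw sr yS 1(1,2) 2(1,2) 1(3) 2(3)]
      unfolding lie_bracket_vrep c_def[symmetric] Let_def at by blast
    then show ?thesis
      using br unfolding D[OF x]
      by (auto intro!: span_add[of _ "{w x, r x}"] span_scale intro: span_base)
  qed
  then have sub: "dist_bracket A D D x \<subseteq> D x"
    unfolding dist_bracket_def using D[OF x] by (intro span_minimal) auto
  obtain U' X where "x \<in> U'" "inj_on (\<lambda>i::nat. X i x) {..<3}"
    "independent ((\<lambda>i. X i x) ` {..<3})" "dist_bracket A D D x = span ((\<lambda>i. X i x) ` {..<3})"
    using distributionE[OF E xA] by metis
  then have "dim (dist_bracket A D D x) = 3" by (simp add: dim_eq_card_independent card_image)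
  moreover have "dim (D x) \<le> card {w x, r x}" unfolding D[OF x] dim_span by (intro dim_le_card') simp
  moreover have "card {w x, r x} \<le> 2" by (simp add: card_insert_if)
  ultimately show False using dim_subset[OF sub] by linarith
qed

section \<open>The Cartan prolongation\<close>

lemma ray_self: "v \<in> ray v"
  by (auto simp: ray_def intro: exI[of _ 1])

lemma ray_eq_iff: "ray u = ray v \<longleftrightarrow> (\<exists>t>0. u = t *\<^sub>R v)"
proof
  show "ray u = ray v \<Longrightarrow> \<exists>t>0. u = t *\<^sub>R v" using ray_self[of u] by (auto simp: ray_def)
  assume "\<exists>t>0. u = t *\<^sub>R v"
  then obtain t where t: "t > 0" "u = t *\<^sub>R v" by blast
  have "\<exists>r. s *\<^sub>R v = r *\<^sub>R t *\<^sub>R v \<and> 0 < r" if "s > 0" for s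
    using that t(1) by (intro exI[of _ "s / t"]) simp
  then show "ray u = ray v" using t by (auto simp: ray_def intro: mult_pos_pos)
qed

lemma span_ray: "span (ray v) = span {v}"
proof
  show "span (ray v) \<subseteq> span {v}"
    by (rule span_minimal[OF _ subspace_span]) (auto simp: ray_def span_singleton)
  show "span {v} \<subseteq> span (ray v)" using ray_self by (intro span_mono) auto
qed

lemma linear_image_ray: "linear f \<Longrightarrow> f ` ray v = ray (f v)"
proof -
  have ray: "ray u = (\<lambda>t. t *\<^sub>R u) ` {0<..}" for u :: "'z::real_vector" by (auto simp: ray_def)
  assume "linear f"
  then show ?thesis unfolding ray image_image by (simp add: linear_scale)
qed

text \<open>The condition on the two fields in \<open>cartan_atlas\<close>. Spanning \<xi> is not
  demanded; it follows from independence when \<xi> has rank two, by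
  \<open>plane_frame_span\<close>.\<close>

definition plane_frame ::
    "('a, 'e::euclidean_space) atlas \<Rightarrow> ('a \<Rightarrow> 'e set) \<Rightarrow> 'a set \<Rightarrow> ('a \<Rightarrow> 'e) \<Rightarrow> ('a \<Rightarrow> 'e) \<Rightarrow> bool" where
  "plane_frame A \<xi> U X Y \<longleftrightarrow> section_on A \<xi> U X \<and> section_on A \<xi> U Y \<and>
     (\<forall>x\<in>U. \<forall>a b. a *\<^sub>R X x + b *\<^sub>R Y x = 0 \<longrightarrow> a = 0 \<and> b = 0)"

lemma plane_frame_independent:
  "plane_frame A \<xi> U X Y \<Longrightarrow> x \<in> U \<Longrightarrow> a *\<^sub>R X x + b *\<^sub>R Y x = 0 \<Longrightarrow> a = 0 \<and> b = 0"
  by (simp add: plane_frame_def)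

lemma plane_frame_openin: "plane_frame A \<xi> U X Y \<Longrightarrow> openin (mtop A) U"
  by (auto simp: plane_frame_def section_on_def intro: smooth_vf_openin)

lemma cartan_atlas_frame:
  "cartan_atlas A \<xi> = {cartan_chart A \<xi> c U X Y | c U X Y. c \<in> A \<and> U \<subseteq> fst c \<and> plane_frame A \<xi> U X Y}"
  by (simp add: cartan_atlas_def plane_frame_def)

text \<open>Independence is a property of sets, and \<open>{v, w}\<close> collapses to one vector
  when \<open>v = w\<close>; hence the inequality on the left.\<close>

lemma independent_pair_iff:
  "v \<noteq> w \<and> independent {v, w} \<longleftrightarrow> (\<forall>a b. a *\<^sub>R v + b *\<^sub>R w = (0::'a::real_vector) \<longrightarrow> a = 0 \<and> b = 0)"
proof
  assume vw: "v \<noteq> w \<and> independent {v, w}"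
  then have w: "w \<noteq> 0" and v: "v \<notin> span {w}" using dependent_zero[of "{v, w}"] independent_insert[of v "{w}"] by auto
  show "\<forall>a b. a *\<^sub>R v + b *\<^sub>R w = 0 \<longrightarrow> a = 0 \<and> b = 0"
  proof (intro allI impI)
    fix a b assume eq: "a *\<^sub>R v + b *\<^sub>R w = 0"
    have a: "a = 0"
    proof (rule ccontr)
      assume "a \<noteq> 0"
      have "a *\<^sub>R v = - b *\<^sub>R w" using eq by (simp add: eq_neg_iff_add_eq_0)
      then have "(1 / a) *\<^sub>R a *\<^sub>R v = (1 / a) *\<^sub>R (- b *\<^sub>R w)" by (rule arg_cong)
      then have "v = (- b / a) *\<^sub>R w" using \<open>a \<noteq> 0\<close> by simp
      then show False using v by (metis span_base span_scale singletonI)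
    qed
    then show "a = 0 \<and> b = 0" using eq w by simp
  qed
next
  assume ind: "\<forall>a b. a *\<^sub>R v + b *\<^sub>R w = 0 \<longrightarrow> a = 0 \<and> b = 0"
  have "w \<noteq> 0" using ind[rule_format, of 0 1] by auto
  moreover have nv: "v \<notin> span {w}"
  proof
    assume "v \<in> span {w}"
    then obtain k where "v = k *\<^sub>R w" by (auto simp: span_singleton)
    then show False using ind[rule_format, of 1 "-k"] by simp
  qed
  moreover have "v \<noteq> w" using nv by (auto intro: span_base)
  ultimately show "v \<noteq> w \<and> independent {v, w}" by (simp add: independent_insert)
qed

lemma distribution_2_frame:
  assumes A: "distribution A 2 \<xi>" "x \<in> mcarrier A"
  obtains U X Y where "x \<in> U" "plane_frame A \<xi> U X Y"
proof -
  obtain U X where U: "x \<in> U" "\<And>i. i < 2 \<Longrightarrow> smooth_vf A U (X i)"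
    "\<And>y. y \<in> U \<Longrightarrow> inj_on (\<lambda>i::nat. X i y) {..<2}"
    "\<And>y. y \<in> U \<Longrightarrow> independent ((\<lambda>i. X i y) ` {..<2})"
    "\<And>y. y \<in> U \<Longrightarrow> \<xi> y = span ((\<lambda>i. X i y) ` {..<2})"
    by (rule distributionE[OF A]) (rule that, assumption+)
  have im: "(\<lambda>i::nat. X i y) ` {..<2} = {X 0 y, X 1 y}" for y
    by (auto simp: lessThan_Suc numeral_2_eq_2)
  have "X 0 y \<noteq> X 1 y \<and> independent {X 0 y, X 1 y}" if "y \<in> U" for y
  proof
    show "X 0 y \<noteq> X 1 y" using inj_onD[OF U(3)[OF that], of 0 1] by auto
    show "independent {X 0 y, X 1 y}" using U(4)[OF that] unfolding im .
  qed
  then have "plane_frame A \<xi> U (X 0) (X 1)"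
    using U(2) U(5) unfolding plane_frame_def section_on_def im independent_pair_iff
    by (auto intro: span_base)
  then show thesis using that U(1) by blast
qed

lemma plane_frame_span:
  assumes \<xi>: "distribution A 2 \<xi>" and fr: "plane_frame A \<xi> U X Y" and x: "x \<in> U"
  shows "\<xi> x = span {X x, Y x}"
proof -
  have xA: "x \<in> mcarrier A" using x openin_mtop_subset[OF plane_frame_openin[OF fr]] by blast
  obtain V Z where Z: "inj_on (\<lambda>i::nat. Z i x) {..<2}" "independent ((\<lambda>i. Z i x) ` {..<2})"
    "\<xi> x = span ((\<lambda>i. Z i x) ` {..<2})"
    using distributionE[OF \<xi> xA] by metis
  then have dim: "dim (\<xi> x) = 2" by (simp add: dim_eq_card_independent card_image)
  have XY: "X x \<noteq> Y x" "independent {X x, Y x}"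
    using plane_frame_independent[OF fr x] independent_pair_iff[of "X x" "Y x"] by blast+
  have "{X x, Y x} \<subseteq> \<xi> x" using fr x by (auto simp: plane_frame_def section_on_def)
  then have "span {X x, Y x} \<subseteq> \<xi> x" using Z(3) by (intro span_minimal) auto
  moreover have "dim (span {X x, Y x}) = 2" using XY by (simp add: dim_eq_card_independent)
  ultimately show ?thesis
    using subspace_dim_equal[of "span {X x, Y x}" "\<xi> x"] dim Z(3) by auto
qed

text \<open>The change of frame is a rotation up to scale, with determinant a^2 + b^2. Its purpose
  is to let any prescribed nonzero combination of \<open>X\<close> and \<open>Y\<close> be the first
  member of a frame.\<close>

lemma plane_frame_change:
  assumes A: "smooth_atlas A" and \<xi>: "distribution A 2 \<xi>" and fr: "plane_frame A \<xi> U X Y"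
    and ab: "a \<noteq> 0 \<or> b \<noteq> 0"
  shows "plane_frame A \<xi> U (\<lambda>x. a *\<^sub>R X x + b *\<^sub>R Y x) (\<lambda>x. (- b) *\<^sub>R X x + a *\<^sub>R Y x)"
proof -
  have vf: "smooth_vf A U X" "smooth_vf A U Y" using fr by (auto simp: plane_frame_def section_on_def)
  have "p = 0 \<and> q = 0"
    if x: "x \<in> U" and eq: "p *\<^sub>R (a *\<^sub>R X x + b *\<^sub>R Y x) + q *\<^sub>R ((- b) *\<^sub>R X x + a *\<^sub>R Y x) = 0" for x p q
  proof -
    have "(p * a - q * b) *\<^sub>R X x + (p * b + q * a) *\<^sub>R Y x = 0"
      using eq by (simp add: algebra_simps)
    then have 0: "p * a - q * b = 0" "p * b + q * a = 0" using plane_frame_independent[OF fr x] by blast+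
    have "p * (a\<^sup>2 + b\<^sup>2) = a * (p * a - q * b) + b * (p * b + q * a)"
      "q * (a\<^sup>2 + b\<^sup>2) = a * (p * b + q * a) - b * (p * a - q * b)"
      by (simp_all add: algebra_simps power2_eq_square)
    then have "p * (a\<^sup>2 + b\<^sup>2) = 0" "q * (a\<^sup>2 + b\<^sup>2) = 0" using 0 by simp_all
    moreover have "a\<^sup>2 + b\<^sup>2 \<noteq> 0" using ab by (simp add: sum_power2_eq_zero_iff)
    ultimately show ?thesis by (simp only: mult_eq_0_iff simp_thms)
  qed
  moreover have "p *\<^sub>R X x + q *\<^sub>R Y x \<in> \<xi> x" if "x \<in> U" for x p q
    unfolding plane_frame_span[OF \<xi> fr that] span_pair_iff by blast
  ultimately show ?thesis
    unfolding plane_frame_def section_on_def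
    by (auto intro!: smooth_vf_add[OF A] smooth_vf_scaleR_const[OF A] vf simp del: scaleR_minus_left)
qed

section \<open>Charts of the prolongation\<close>

context
  fixes A :: "('a, 'e::euclidean_space) atlas" and \<xi> and c and U and X Y :: "'a \<Rightarrow> 'e"
  assumes A: "smooth_atlas A" and c: "c \<in> A" "U \<subseteq> fst c" and fr: "plane_frame A \<xi> U X Y"
begin

text \<open>The coefficient of \<open>X\<close> is normalized to 1, which forces the factor between
  the two generators to be 1. This makes the description of the fibre coordinate by
  \<open>THE\<close> meaningful.\<close>

lemma ray_frame_inj:
  assumes x: "x \<in> U" and eq: "ray (X x + s *\<^sub>R Y x) = ray (X x + t *\<^sub>R Y x)"
  shows "s = t"
proof -
  obtain k where k: "X x + s *\<^sub>R Y x = k *\<^sub>R (X x + t *\<^sub>R Y x)" using eq unfolding ray_eq_iff by blast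
  then have "(1 - k) *\<^sub>R X x + (s - k * t) *\<^sub>R Y x = 0" by (simp add: algebra_simps)
  from plane_frame_independent[OF fr x this] show ?thesis by simp
qed

lemma fst_cartan_chart:
  assumes \<xi>: "distribution A 2 \<xi>"
  shows "fst (cartan_chart A \<xi> c U X Y) = {(x, ray (X x + s *\<^sub>R Y x)) | x s. x \<in> U}"
proof -
  have "(x, ray (X x + s *\<^sub>R Y x)) \<in> cartan_prolongation A \<xi>" if x: "x \<in> U" for x s
  proof -
    have "1 *\<^sub>R X x + s *\<^sub>R Y x \<noteq> 0" using plane_frame_independent[OF fr x, of 1 s] by auto
    moreover have "1 *\<^sub>R X x + s *\<^sub>R Y x \<in> \<xi> x"
      unfolding plane_frame_span[OF \<xi> fr x] span_pair_iff by blast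
    moreover have "x \<in> mcarrier A" using x c chart_subset_mcarrier by blast
    ultimately show ?thesis by (auto simp: cartan_prolongation_def)
  qed
  then show ?thesis by (auto simp: cartan_chart_def)
qed

lemma snd_cartan_chart:
  assumes x: "x \<in> U"
  shows "snd (cartan_chart A \<xi> c U X Y) (x, ray (X x + s *\<^sub>R Y x)) = (snd c x, s)"
proof -
  have "(THE t. ray (X x + s *\<^sub>R Y x) = ray (X x + t *\<^sub>R Y x)) = s"
    using ray_frame_inj[OF x] by (intro the_equality) auto
  then show ?thesis by (simp add: cartan_chart_def)
qed

lemma inj_on_cartan_chart:
  assumes \<xi>: "distribution A 2 \<xi>"
  shows "inj_on (snd (cartan_chart A \<xi> c U X Y)) (fst (cartan_chart A \<xi> c U X Y))"
proof -
  have "inj_on (snd c) (fst c)" using A c by (simp add: smooth_atlas_def)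
  then have "x = y" if "x \<in> U" "y \<in> U" "snd c x = snd c y" for x y
    using that c(2) by (meson inj_onD subsetD)
  note inj = this
  show ?thesis
  proof (rule inj_onI)
    fix z z' assume "z \<in> fst (cartan_chart A \<xi> c U X Y)" "z' \<in> fst (cartan_chart A \<xi> c U X Y)"
      and eq: "snd (cartan_chart A \<xi> c U X Y) z = snd (cartan_chart A \<xi> c U X Y) z'"
    then obtain x s x' s' where z: "x \<in> U" "z = (x, ray (X x + s *\<^sub>R Y x))"
      "x' \<in> U" "z' = (x', ray (X x' + s' *\<^sub>R Y x'))"
      unfolding fst_cartan_chart[OF \<xi>] by blast
    then have "snd c x = snd c x'" "s = s'" using eq by (simp_all add: snd_cartan_chart)
    then show "z = z'" using inj[OF z(1,3)] z(2,4) by simp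
  qed
qed

lemma cartan_chart_image:
  assumes \<xi>: "distribution A 2 \<xi>"
  shows "snd (cartan_chart A \<xi> c U X Y) ` (fst (cartan_chart A \<xi> c U X Y) \<inter> fst -` V) = snd c ` (U \<inter> V) \<times> UNIV"
proof
  show "snd (cartan_chart A \<xi> c U X Y) ` (fst (cartan_chart A \<xi> c U X Y) \<inter> fst -` V) \<subseteq> snd c ` (U \<inter> V) \<times> UNIV"
    unfolding fst_cartan_chart[OF \<xi>] by (auto simp: snd_cartan_chart)
  show "snd c ` (U \<inter> V) \<times> UNIV \<subseteq> snd (cartan_chart A \<xi> c U X Y) ` (fst (cartan_chart A \<xi> c U X Y) \<inter> fst -` V)"
  proof clarify
    fix x s assume x: "x \<in> U" "x \<in> V"
    then show "(snd c x, s) \<in> snd (cartan_chart A \<xi> c U X Y) ` (fst (cartan_chart A \<xi> c U X Y) \<inter> fst -` V)"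
      unfolding fst_cartan_chart[OF \<xi>]
      by (intro image_eqI[where x = "(x, ray (X x + s *\<^sub>R Y x))"]) (auto simp: snd_cartan_chart)
  qed
qed

lemma fst_chart_inv_cartan_chart:
  assumes \<xi>: "distribution A 2 \<xi>" and x: "x \<in> U"
  shows "fst (chart_inv (cartan_chart A \<xi> c U X Y) (snd c x, s)) = x"
proof -
  have "(x, ray (X x + s *\<^sub>R Y x)) \<in> fst (cartan_chart A \<xi> c U X Y)"
    unfolding fst_cartan_chart[OF \<xi>] using x by blast
  from chart_inv_left[OF inj_on_cartan_chart[OF \<xi>] this] show ?thesis
    by (simp add: snd_cartan_chart[OF x])
qed

end

lemma inj_atlas_cartan:
  assumes A: "smooth_atlas A" and \<xi>: "distribution A 2 \<xi>"
  shows "inj_atlas (cartan_atlas A \<xi>)"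
  unfolding inj_atlas_def
proof
  fix d assume "d \<in> cartan_atlas A \<xi>"
  then obtain c U X Y where "c \<in> A" "U \<subseteq> fst c" "plane_frame A \<xi> U X Y" "d = cartan_chart A \<xi> c U X Y"
    unfolding cartan_atlas_frame by blast
  then show "inj_on (snd d) (fst d)" using inj_on_cartan_chart[OF A _ _ _ \<xi>] by simp
qed

lemma mcarrier_cartan_atlas:
  assumes A: "smooth_atlas A" and \<xi>: "distribution A 2 \<xi>"
  shows "mcarrier (cartan_atlas A \<xi>) = cartan_prolongation A \<xi>"
proof
  show "mcarrier (cartan_atlas A \<xi>) \<subseteq> cartan_prolongation A \<xi>"
    by (auto simp: mcarrier_def cartan_atlas_def cartan_chart_def)
  show "cartan_prolongation A \<xi> \<subseteq> mcarrier (cartan_atlas A \<xi>)"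
  proof
    fix z assume "z \<in> cartan_prolongation A \<xi>"
    then obtain x v where z: "z = (x, ray v)" "x \<in> mcarrier A" "v \<in> \<xi> x" "v \<noteq> 0"
      by (auto simp: cartan_prolongation_def)
    obtain U X Y where U: "x \<in> U" and fr: "plane_frame A \<xi> U X Y"
      using distribution_2_frame[OF \<xi> z(2)] by blast
    obtain a b where v: "v = a *\<^sub>R X x + b *\<^sub>R Y x"
      using z(3) unfolding plane_frame_span[OF \<xi> fr U] span_pair_iff by blast
    then have ab: "a \<noteq> 0 \<or> b \<noteq> 0" using z(4) by auto
    obtain c where c: "c \<in> A" "x \<in> fst c" using z(2) by (auto simp: mcarrier_def)
    have V: "openin (mtop A) (U \<inter> fst c)"
      by (rule openin_Int[OF plane_frame_openin[OF fr] openin_mtop_chart_domain[OF c(1)]])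
    \<comment> \<open>The first field of this frame takes the value \<open>v\<close> at
      \<open>x\<close>, so the ray of \<open>v\<close> appears in the chart with fibre coordinate
      0.\<close>
    let ?X = "\<lambda>x. a *\<^sub>R X x + b *\<^sub>R Y x" and ?Y = "\<lambda>x. (- b) *\<^sub>R X x + a *\<^sub>R Y x"
    have fr': "plane_frame A \<xi> (U \<inter> fst c) ?X ?Y"
      using plane_frame_change[OF A \<xi> fr ab] smooth_vf_subset[OF A _ V Int_lower1]
      unfolding plane_frame_def section_on_def by blast
    have "(x, ray (?X x + 0 *\<^sub>R ?Y x)) \<in> fst (cartan_chart A \<xi> c (U \<inter> fst c) ?X ?Y)"
      unfolding fst_cartan_chart[OF A c(1) Int_lower2 fr' \<xi>] using U c(2) by blast
    then have "z \<in> fst (cartan_chart A \<xi> c (U \<inter> fst c) ?X ?Y)" using z(1) v by simp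
    moreover have "cartan_chart A \<xi> c (U \<inter> fst c) ?X ?Y \<in> cartan_atlas A \<xi>"
      unfolding cartan_atlas_frame by (intro CollectI exI conjI, rule refl, rule c(1), rule Int_lower2, rule fr')
    ultimately show "z \<in> mcarrier (cartan_atlas A \<xi>)" by (auto simp: mcarrier_def)
  qed
qed

text \<open>In coordinates the projection drops the fibre coordinate and applies a transition map of
  \<open>A\<close>.\<close>

lemma smooth_map_on_cartan_fst:
  assumes A: "smooth_atlas A" and \<xi>: "distribution A 2 \<xi>"
  shows "smooth_map_on (cartan_atlas A \<xi>) A (mcarrier (cartan_atlas A \<xi>)) fst"
  unfolding smooth_map_on_def
proof (intro conjI ballI)
  show "openin (mtop (cartan_atlas A \<xi>)) (mcarrier (cartan_atlas A \<xi>))" by (rule openin_mcarrier)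
  show "fst ` mcarrier (cartan_atlas A \<xi>) \<subseteq> mcarrier A"
    unfolding mcarrier_cartan_atlas[OF A \<xi>] by (auto simp: cartan_prolongation_def)
  fix d e assume d: "d \<in> cartan_atlas A \<xi>" and e: "e \<in> A"
  obtain c U X Y where c: "c \<in> A" "U \<subseteq> fst c" and fr: "plane_frame A \<xi> U X Y"
    and d_def: "d = cartan_chart A \<xi> c U X Y"
    using d unfolding cartan_atlas_frame by blast
  let ?S = "snd c ` (U \<inter> fst e)"
  have U: "openin (mtop A) (U \<inter> fst e)"
    by (rule openin_Int[OF plane_frame_openin[OF fr] openin_mtop_chart_domain[OF e]])
  have "fst d \<inter> mcarrier (cartan_atlas A \<xi>) \<inter> fst -` fst e = fst d \<inter> fst -` fst e"
    using chart_subset_mcarrier[OF d] by auto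
  then have im: "snd d ` (fst d \<inter> mcarrier (cartan_atlas A \<xi>) \<inter> fst -` fst e) = ?S \<times> UNIV"
    using cartan_chart_image[OF A c fr \<xi>] d_def by simp
  have "fst c \<inter> (U \<inter> fst e) = U \<inter> fst e" using c by auto
  then have S: "open ?S" using open_chart_image[OF A c(1) U] by simp
  have "smooth_on (snd c ` (fst c \<inter> fst e)) (snd e \<circ> chart_inv c)"
    using A c e by (simp add: smooth_atlas_def)
  then have "smooth_on ?S (snd e \<circ> chart_inv c)"
    by (rule smooth_on_subset[OF _ S]) (use c in auto)
  then have "smooth_on (?S \<times> UNIV) (\<lambda>z. (snd e \<circ> chart_inv c) (fst z))"
    by (rule smooth_on_compose[OF _ smooth_on_bounded_linear[OF bounded_linear_fst]])
      (use S in \<open>auto intro: open_Times\<close>)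
  then have "smooth_on (?S \<times> UNIV) (snd e \<circ> fst \<circ> chart_inv d)"
  proof (rule smooth_on_cong)
    fix z :: "'b \<times> real" assume "z \<in> ?S \<times> UNIV"
    then obtain x s where x: "x \<in> U" "z = (snd c x, s)" by auto
    have "inj_on (snd c) (fst c)" using A c by (simp add: smooth_atlas_def)
    then have "chart_inv c (snd c x) = x" by (rule chart_inv_left) (use x(1) c(2) in auto)
    then show "(snd e \<circ> chart_inv c) (fst z) = (snd e \<circ> fst \<circ> chart_inv d) z"
      using fst_chart_inv_cartan_chart[OF A c fr \<xi> x(1), of s] x(2) d_def by simp
  qed
  then show "smooth_on (snd d ` (fst d \<inter> mcarrier (cartan_atlas A \<xi>) \<inter> fst -` fst e)) (snd e \<circ> fst \<circ> chart_inv d)"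
    unfolding im .
qed

section \<open>The prolongation map\<close>

lemma oriented_line_field_frame:
  assumes "oriented_line_field A R" "x \<in> mcarrier A"
  obtains U r where "x \<in> U" "smooth_vf A U r" "\<And>y. y \<in> U \<Longrightarrow> r y \<noteq> 0 \<and> R y = ray (r y)"
  using assms unfolding oriented_line_field_def by meson

text \<open>The situation once the leaf space is identified with \<open>N\<close>: \<open>P\<close>
  stands for the leaf projection followed by \<psi>. Its kernel is an assumption here, so that the
  facts about leaves stay separate from the study of \<Phi>.\<close>

locale circle_engel =
  fixes Q :: "('q, real ^ 4) atlas" and N :: "('n, real ^ 3) atlas" and \<xi> :: "'n \<Rightarrow> (real ^ 3) set"
    and D W R :: "'q \<Rightarrow> (real ^ 4) set" and P :: "'q \<Rightarrow> 'n" and \<Phi> :: "'q \<Rightarrow> 'n \<times> (real ^ 3) set"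
  assumes Q: "smooth_atlas Q" and N: "smooth_atlas N" and \<xi>: "distribution N 2 \<xi>"
    and P: "smooth_map_on Q N (mcarrier Q) P"
    and ker: "\<And>x v. x \<in> mcarrier Q \<Longrightarrow> mderiv Q N P x v = 0 \<longleftrightarrow> v \<in> W x"
    and W: "distribution Q 1 W" and R: "oriented_line_field Q R"
    and D: "\<And>x. x \<in> mcarrier Q \<Longrightarrow> direct_sum (unoriented R x) (W x) (D x)"
    and E: "distribution Q 3 (dist_bracket Q D D)"
    and PR: "\<And>x v. x \<in> mcarrier Q \<Longrightarrow> v \<in> R x \<Longrightarrow> mderiv Q N P x v \<in> \<xi> (P x)"
    and \<Phi>: "\<And>x. x \<in> mcarrier Q \<Longrightarrow> \<Phi> x = (P x, mderiv Q N P x ` R x)"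
begin

abbreviation B :: "('n \<times> (real ^ 3) set, (real ^ 3) \<times> real) atlas" where
  "B \<equiv> cartan_atlas N \<xi>"

lemma linear_dP: "x \<in> mcarrier Q \<Longrightarrow> linear (mderiv Q N P x)"
  by (rule linear_mderiv[OF P])

lemma local_fields:
  assumes x: "x \<in> mcarrier Q"
  obtains U w r where "openin (mtop Q) U" "x \<in> U" "smooth_vf Q U w" "smooth_vf Q U r"
    "\<And>y. y \<in> U \<Longrightarrow> W y = span {w y}" "\<And>y. y \<in> U \<Longrightarrow> R y = ray (r y)"
    "\<And>y a b. y \<in> U \<Longrightarrow> a *\<^sub>R w y + b *\<^sub>R r y = 0 \<Longrightarrow> a = 0 \<and> b = 0"
    "\<And>y. y \<in> U \<Longrightarrow> D y = span {w y, r y}"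
proof -
  obtain U1 w where w: "smooth_vf Q U1 w" "x \<in> U1" "\<And>y. y \<in> U1 \<Longrightarrow> w y \<noteq> 0 \<and> W y = span {w y}"
    using distribution_1_frame[OF W x] by metis
  obtain U2 r where r: "x \<in> U2" "smooth_vf Q U2 r" "\<And>y. y \<in> U2 \<Longrightarrow> r y \<noteq> 0 \<and> R y = ray (r y)"
    using oriented_line_field_frame[OF R x] by metis
  let ?U = "U1 \<inter> U2"
  have U: "openin (mtop Q) ?U" by (rule openin_Int[OF smooth_vf_openin[OF w(1)] smooth_vf_openin[OF r(2)]])
  have sum: "direct_sum (span {r y}) (span {w y}) (D y)" if "y \<in> ?U" for y
    using D[of y] that openin_mtop_subset[OF U] w(3) r(3) by (auto simp: unoriented_def span_ray)
  show thesis
  proof (rule that[OF U])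
    show "smooth_vf Q ?U w" "smooth_vf Q ?U r"
      by (rule smooth_vf_subset[OF Q w(1) U Int_lower1] smooth_vf_subset[OF Q r(2) U Int_lower2])+
    show "a = 0 \<and> b = 0" if y: "y \<in> ?U" and eq: "a *\<^sub>R w y + b *\<^sub>R r y = 0" for y a b
    proof -
      have "b *\<^sub>R r y = (- a) *\<^sub>R w y" using eq by (simp add: add_eq_0_iff)
      then have "b *\<^sub>R r y \<in> span {r y} \<inter> span {w y}"
        by (metis IntI singletonI span_base span_scale)
      moreover have "span {r y} \<inter> span {w y} = {0}" using sum[OF y] by (simp add: direct_sum_def)
      ultimately have "b *\<^sub>R r y = 0" by blast
      then show ?thesis using eq w(3) r(3) y by simp
    qed
    show "D y = span {w y, r y}" if "y \<in> ?U" for y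
    proof -
      have "D y = {u + v | u v. u \<in> span {r y} \<and> v \<in> span {w y}}"
        using sum[OF that] by (simp add: direct_sum_def)
      also have "\<dots> = span {w y, r y}"
      proof (rule set_eqI)
        fix z
        show "z \<in> {u + v | u v. u \<in> span {r y} \<and> v \<in> span {w y}} \<longleftrightarrow> z \<in> span {w y, r y}"
          unfolding span_pair_iff span_singleton by (simp add: image_iff Bex_def) (metis add.commute)
      qed
      finally show ?thesis .
    qed
  qed (use w r in auto)
qed

lemma \<Phi>_ray:
  assumes x: "x \<in> mcarrier Q" and r: "R x = ray v"
  shows "\<Phi> x = (P x, ray (mderiv Q N P x v))"
  unfolding \<Phi>[OF x] r linear_image_ray[OF linear_dP[OF x]] ..

text \<open>The circle direction is independent of \<open>W\<close>, the kernel of dP, so its image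
  in \<xi> is nonzero and spans a ray.\<close>

lemma \<Phi>_in_prolongation:
  assumes x: "x \<in> mcarrier Q" shows "\<Phi> x \<in> mcarrier B"
proof -
  obtain U w r where f: "x \<in> U" "\<And>y. y \<in> U \<Longrightarrow> W y = span {w y}" "\<And>y. y \<in> U \<Longrightarrow> R y = ray (r y)"
    "\<And>y a b. y \<in> U \<Longrightarrow> a *\<^sub>R w y + b *\<^sub>R r y = 0 \<Longrightarrow> a = 0 \<and> b = 0"
    by (rule local_fields[OF x]) (rule that, assumption+)
  have "r x \<notin> W x"
  proof
    assume "r x \<in> W x"
    then obtain k where "r x = k *\<^sub>R w x" using f(1,2) by (auto simp: span_singleton)
    then have "(- k) *\<^sub>R w x + 1 *\<^sub>R r x = 0" by simp
    then show False using f(4)[OF f(1)] by fastforce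
  qed
  then have "mderiv Q N P x (r x) \<noteq> 0" using ker[OF x] by simp
  moreover have "mderiv Q N P x (r x) \<in> \<xi> (P x)" using PR[OF x, of "r x"] f(3)[OF f(1)] ray_self[of "r x"] by simp
  moreover have "P x \<in> mcarrier N" by (rule smooth_map_on_into[OF P x])
  ultimately show ?thesis
    unfolding mcarrier_cartan_atlas[OF N \<xi>] \<Phi>_ray[OF x f(3)[OF f(1)]] by (auto simp: cartan_prolongation_def)
qed

text \<open>In a chart of the prolongation given by a frame \<open>X\<close>, \<open>Y\<close> of \<open>\<xi>\<close>, the fibre coordinate of \<open>\<Phi>\<close>
  is \<open>b / a\<close>, where \<open>dP(r) = a X + b Y\<close>. Along the kernel \<open>w\<close> one has
  \<open>dP([w, r]) = (w a) X + (w b) Y\<close>, so a vanishing derivative \<open>w (b / a)\<close> would put \<open>[w, r]\<close>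
  into \<open>D\<close>.\<close>

lemma \<Phi>_in_charts:
  assumes x: "x \<in> mcarrier Q" and c: "c \<in> Q" "x \<in> fst c" and d: "d \<in> B" "\<Phi> x \<in> fst d"
  obtains V where "openin (mtop Q) V" "x \<in> V" "V \<subseteq> fst c \<inter> \<Phi> -` fst d"
    "smooth_on (snd c ` V) (snd d \<circ> \<Phi> \<circ> chart_inv c)"
    "c = chart_at Q x \<Longrightarrow> inj (frechet_derivative (snd d \<circ> \<Phi> \<circ> chart_inv c) (at (snd c x)))"
proof -
  obtain e U X Y where e: "e \<in> N" "U \<subseteq> fst e" and fr: "plane_frame N \<xi> U X Y"
    and d_def: "d = cartan_chart N \<xi> e U X Y"
    using d(1) unfolding cartan_atlas_frame by blast
  note fst_d = fst_cartan_chart[OF N e fr \<xi>, folded d_def]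
    and snd_d = snd_cartan_chart[OF N e fr, folded d_def]
  have vfX: "smooth_vf N U X" and vfY: "smooth_vf N U Y" using fr by (auto simp: plane_frame_def section_on_def)
  have injc: "inj_on (snd c) (fst c)" and inje: "inj_on (snd e) (fst e)"
    using Q N c e by (auto simp: smooth_atlas_def)
  obtain U0 w r where U0: "openin (mtop Q) U0" "x \<in> U0" and vf: "smooth_vf Q U0 w" "smooth_vf Q U0 r"
    and Ww: "\<And>y. y \<in> U0 \<Longrightarrow> W y = span {w y}" and Rr: "\<And>y. y \<in> U0 \<Longrightarrow> R y = ray (r y)"
    and ind: "\<And>y a b. y \<in> U0 \<Longrightarrow> a *\<^sub>R w y + b *\<^sub>R r y = 0 \<Longrightarrow> a = 0 \<and> b = 0"
    and Dwr: "\<And>y. y \<in> U0 \<Longrightarrow> D y = span {w y, r y}"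
    by (rule local_fields[OF x]) (rule that, assumption+)
  have U: "openin (mtop N) U" by (rule plane_frame_openin[OF fr])
  \<comment> \<open>On \<open>V0\<close> all local data are available together: the chart
    \<open>c\<close>, the fields \<open>w\<close> and \<open>r\<close>, and the frame
    \<open>X\<close>, \<open>Y\<close> at the image point.\<close>
  define V0 where "V0 = fst c \<inter> U0 \<inter> (mcarrier Q \<inter> P -` U)"
  have V0: "openin (mtop Q) V0" unfolding V0_def
    by (intro openin_Int openin_mtop_chart_domain c U0 smooth_map_on_vimage[OF smooth_atlas_inj_atlas[OF Q] N P U])
  have V0D: "z \<in> fst c" "z \<in> U0" "z \<in> mcarrier Q" "P z \<in> U" "P z \<in> fst e" if "z \<in> V0" for z
    using that e(2) by (auto simp: V0_def)
  obtain s where Us: "P x \<in> U" and s: "ray (mderiv Q N P x (r x)) = ray (X (P x) + s *\<^sub>R Y (P x))"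
    using d(2) unfolding fst_d \<Phi>_ray[OF x Rr[OF U0(2)]] by blast
  have xV0: "x \<in> V0" using x c U0 Us by (simp add: V0_def)
  define S where "S = snd c ` V0"
  have "S = snd c ` (fst c \<inter> V0)" unfolding S_def V0_def by (rule arg_cong[where f = "(`) (snd c)"]) auto
  then have S: "open S" using open_chart_image[OF Q c(1) V0] by simp
  have SD: "\<exists>z\<in>V0. y = snd c z \<and> chart_inv c y = z" if "y \<in> S" for y
    using that V0D(1) by (auto simp: S_def chart_inv_left[OF injc])
  define p where "p = snd e \<circ> P \<circ> chart_inv c"
  have sp: "smooth_on S p" unfolding p_def
    by (rule smooth_on_subset[OF smooth_map_on_rep[OF P c(1) e(1)] S]) (auto simp: S_def dest: V0D)
  have sw: "smooth_on S (vrep Q c w)" and sr: "smooth_on S (vrep Q c r)"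
    using V0D(1,2) by (auto simp: S_def intro!: smooth_on_subset[OF smooth_vf_vrep[OF vf(1) c(1)] S[unfolded S_def]]
        smooth_on_subset[OF smooth_vf_vrep[OF vf(2) c(1)] S[unfolded S_def]])
  let ?T = "snd e ` (fst e \<inter> U)"
  have sX: "smooth_on ?T (vrep N e X)" and sY: "smooth_on ?T (vrep N e Y)"
    by (rule smooth_vf_vrep[OF vfX e(1)] smooth_vf_vrep[OF vfY e(1)])+
  have pz: "p (snd c z) = snd e (P z)" if "z \<in> V0" for z
    by (simp add: p_def chart_inv_left[OF injc V0D(1)[OF that]])
  have pT: "p ` S \<subseteq> ?T"
  proof
    fix u assume "u \<in> p ` S"
    then obtain z where "z \<in> V0" "u = snd e (P z)" using pz by (auto simp: S_def)
    then show "u \<in> ?T" using V0D by blast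
  qed
  have Dp: "frechet_derivative p (at (snd c z)) (vrep Q c Z (snd c z)) = tcoord N e (P z) (mderiv Q N P z (Z z))"
    if z: "z \<in> V0" for z Z
    using cderiv_tcoord[OF Q N P c(1) V0D(1)[OF z] e(1) V0D(5)[OF z] V0D(3)[OF z], of "Z z"]
    by (simp add: p_def cderiv_def vrep_chart[OF injc V0D(1)[OF z]])
  have lin_e: "linear (tcoord N e (P z))" if "z \<in> V0" for z by (rule linear_tcoord[OF N e(1) V0D(5)[OF that]])
  have sXp: "smooth_on S (\<lambda>y. vrep N e X (p y))" and sYp: "smooth_on S (\<lambda>y. vrep N e Y (p y))"
    by (rule smooth_on_compose[OF sX sp pT] smooth_on_compose[OF sY sp pT])+
  have comb: "a *\<^sub>R vrep N e X (p (snd c z)) + b *\<^sub>R vrep N e Y (p (snd c z))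
      = tcoord N e (P z) (a *\<^sub>R X (P z) + b *\<^sub>R Y (P z))" if z: "z \<in> V0" for z a b
    unfolding pz[OF z] vrep_chart[OF inje V0D(5)[OF z]]
    by (simp add: linear_add[OF lin_e[OF z]] linear_scale[OF lin_e[OF z]])
  have indXY: "a = 0 \<and> b = 0"
    if y: "y \<in> S" and eq: "a *\<^sub>R vrep N e X (p y) + b *\<^sub>R vrep N e Y (p y) = 0" for y a b
  proof -
    obtain z where z: "z \<in> V0" "y = snd c z" using SD[OF y] by blast
    have "a *\<^sub>R X (P z) + b *\<^sub>R Y (P z) = 0"
      using eq unfolding z(2) comb[OF z(1)] tcoord_eq_0_iff[OF N e(1) V0D(5)[OF z(1)]] .
    then show ?thesis by (rule plane_frame_independent[OF fr V0D(4)[OF z(1)]])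
  qed
  have spXY: "\<exists>a b. frechet_derivative p (at y) (vrep Q c r y) = a *\<^sub>R vrep N e X (p y) + b *\<^sub>R vrep N e Y (p y)"
    if y: "y \<in> S" for y
  proof -
    obtain z where z: "z \<in> V0" "y = snd c z" using SD[OF y] by blast
    have "mderiv Q N P z (r z) \<in> \<xi> (P z)" 
      using PR[OF V0D(3)[OF z(1)], of "r z"] Rr[OF V0D(2)[OF z(1)]] ray_self[of "r z"] by simp
    then obtain a b where "mderiv Q N P z (r z) = a *\<^sub>R X (P z) + b *\<^sub>R Y (P z)"
      unfolding plane_frame_span[OF \<xi> fr V0D(4)[OF z(1)]] span_pair_iff by blast
    then have "frechet_derivative p (at y) (vrep Q c r y) = a *\<^sub>R vrep N e X (p y) + b *\<^sub>R vrep N e Y (p y)"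
      unfolding z(2) Dp[OF z(1)] comb[OF z(1)] by simp
    then show ?thesis by blast
  qed
  have sDr: "smooth_on S (\<lambda>y. frechet_derivative p (at y) (vrep Q c r y))"
    by (rule smooth_on_derivative_field[OF sp sr])
  \<comment> \<open>The frame of \<xi> is pulled back along \<open>p\<close>, so the coefficients
    are smooth functions in the chart of \<open>Q\<close>.\<close>
  obtain a b where a: "smooth_on S a" and b: "smooth_on S b"
    and ab: "\<And>y. y \<in> S \<Longrightarrow> frechet_derivative p (at y) (vrep Q c r y)
        = a y *\<^sub>R vrep N e X (p y) + b y *\<^sub>R vrep N e Y (p y)"
    by (rule frame_coefficients[OF sXp sYp sDr indXY spXY]) (assumption | rule that, assumption+)+
  have dPr: "mderiv Q N P z (r z) = a (snd c z) *\<^sub>R X (P z) + b (snd c z) *\<^sub>R Y (P z)" if z: "z \<in> V0" for z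
  proof -
    have "snd c z \<in> S" using z by (simp add: S_def)
    from ab[OF this] have "tcoord N e (P z) (mderiv Q N P z (r z))
        = tcoord N e (P z) (a (snd c z) *\<^sub>R X (P z) + b (snd c z) *\<^sub>R Y (P z))"
      unfolding Dp[OF z] comb[OF z] .
    then show ?thesis using tvec_tcoord(1)[OF N e(1) V0D(5)[OF z]] by metis
  qed
  \<comment> \<open>The chart \<open>d\<close> consists of rays with a positive \<open>X\<close>
    component. Positivity of \<open>a\<close> therefore keeps \<Phi> inside it and allows division
    by \<open>a\<close>; it holds at \<open>x\<close> because \<open>\<Phi> x\<close> lies in the
    domain of \<open>d\<close>.\<close>
  define O' where "O' = S \<inter> a -` {0<..}"
  define V where "V = V0 \<inter> (fst c \<inter> snd c -` O')"
  have O': "open O'" unfolding O'_def by (rule smooth_on_open_vimage[OF a]) simp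
  have V: "openin (mtop Q) V" unfolding V_def by (rule openin_Int[OF V0 openin_mtop_chart[OF c(1) O']])
  have yS: "snd c x \<in> S" using xV0 by (simp add: S_def)
  have ax: "a (snd c x) > 0"
  proof -
    obtain k where k: "k > 0" "mderiv Q N P x (r x) = k *\<^sub>R (X (P x) + s *\<^sub>R Y (P x))"
      using s unfolding ray_eq_iff by blast
    then have "(a (snd c x) - k) *\<^sub>R X (P x) + (b (snd c x) - k * s) *\<^sub>R Y (P x) = 0"
      using dPr[OF xV0] by (simp add: algebra_simps)
    from plane_frame_independent[OF fr Us this] k(1) show ?thesis by simp
  qed
  have xV: "x \<in> V" using xV0 ax c yS by (simp add: V_def O'_def)
  have im: "snd c ` V = O'"
  proof
    show "O' \<subseteq> snd c ` V"
    proof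
      fix y assume y: "y \<in> O'"
      then obtain z where "z \<in> V0" "y = snd c z" by (auto simp: O'_def S_def)
      then show "y \<in> snd c ` V" using y V0D(1) by (auto simp: V_def)
    qed
  qed (auto simp: V_def)
  have \<Phi>V: "\<Phi> z = (P z, ray (X (P z) + (b (snd c z) / a (snd c z)) *\<^sub>R Y (P z)))" if z: "z \<in> V" for z
  proof -
    have z0: "z \<in> V0" and az: "a (snd c z) > 0" using z by (auto simp: V_def O'_def)
    have "mderiv Q N P z (r z) = a (snd c z) *\<^sub>R (X (P z) + (b (snd c z) / a (snd c z)) *\<^sub>R Y (P z))"
      using az by (simp add: dPr[OF z0] scaleR_add_right)
    then have "ray (mderiv Q N P z (r z)) = ray (X (P z) + (b (snd c z) / a (snd c z)) *\<^sub>R Y (P z))"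
      using az unfolding ray_eq_iff by blast
    then show ?thesis using \<Phi>_ray[OF V0D(3)[OF z0] Rr[OF V0D(2)[OF z0]]] by simp
  qed
  have Vd: "V \<subseteq> fst c \<inter> \<Phi> -` fst d"
  proof
    fix z assume z: "z \<in> V"
    then have "z \<in> V0" by (simp add: V_def)
    from V0D[OF this] show "z \<in> fst c \<inter> \<Phi> -` fst d" unfolding fst_d using \<Phi>V[OF z] by auto
  qed
  let ?h = "\<lambda>y. (p y, b y / a y)"
  have h: "(snd d \<circ> \<Phi> \<circ> chart_inv c) y = ?h y" if y: "y \<in> O'" for y
  proof -
    obtain z where z: "z \<in> V" "y = snd c z" using y im by blast
    then have z0: "z \<in> V0" by (simp add: V_def)
    show ?thesis
      unfolding z(2) using V0D[OF z0] \<Phi>V[OF z(1)] snd_d[of "P z"] pz[OF z0]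
      by (simp add: chart_inv_left[OF injc])
  qed
  have OS: "O' \<subseteq> S" by (auto simp: O'_def)
  have sp': "smooth_on O' p" and sa': "smooth_on O' a" and sb': "smooth_on O' b"
    by (rule smooth_on_subset[OF sp O' OS] smooth_on_subset[OF a O' OS] smooth_on_subset[OF b O' OS])+
  have sba: "smooth_on O' (\<lambda>y. b y / a y)"
    by (intro smooth_on_divide sa' sb') (auto simp: O'_def)
  have "smooth_on O' ?h" by (intro smooth_on_Pair sp' sba)
  then have sm: "smooth_on (snd c ` V) (snd d \<circ> \<Phi> \<circ> chart_inv c)"
    unfolding im by (rule smooth_on_cong) (simp only: h)
  have yO: "snd c x \<in> O'" using xV im by blast
  \<comment> \<open>In the preferred chart a vector at \<open>x\<close> is its own component vector,
    which is the fact \<open>at\<close>, and \<open>lie_bracket\<close> is computed in that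
    chart.\<close>
  have "inj (frechet_derivative (snd d \<circ> \<Phi> \<circ> chart_inv c) (at (snd c x)))" if cx: "c = chart_at Q x"
  proof -
    let ?y = "snd c x"
    have at: "vrep Q c Z ?y = Z x" for Z
      using tcoord_chart_at[OF Q x] by (simp add: vrep_chart[OF injc c(2)] cx[symmetric])
    have lh: "linear (frechet_derivative (snd d \<circ> \<Phi> \<circ> chart_inv c) (at ?y))"
      by (rule smooth_on_linear_derivative[OF sm]) (use xV in blast)
    let ?ba = "\<lambda>v. frechet_derivative (\<lambda>y. b y / a y) (at ?y) v"
    have "frechet_derivative (snd d \<circ> \<Phi> \<circ> chart_inv c) (at ?y) = frechet_derivative ?h (at ?y)"
      by (rule frechet_derivative_cong_open[OF O' yO h])
    also have "\<dots> = (\<lambda>v. (frechet_derivative p (at ?y) v, ?ba v))"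
      by (rule frechet_derivative_at[symmetric], intro has_derivative_Pair
          smooth_on_has_derivative[OF sp' yO] smooth_on_has_derivative[OF sba yO])
    finally have dh: "frechet_derivative (snd d \<circ> \<Phi> \<circ> chart_inv c) (at ?y)
        = (\<lambda>v. (frechet_derivative p (at ?y) v, ?ba v))" .
    have kerp: "frechet_derivative p (at ?y) v = 0 \<longleftrightarrow> v \<in> W x" for v
      using Dp[OF xV0, of "\<lambda>_. v"] tcoord_eq_0_iff[OF N e(1) V0D(5)[OF xV0]] ker[OF x] by (simp add: at)
    have "?ba (w x) \<noteq> 0"
    proof
      assume 0: "?ba (w x) = 0"
      let ?a = "frechet_derivative a (at ?y) (w x)" and ?b = "frechet_derivative b (at ?y) (w x)"
      let ?br = "lie_bracket Q w r x"
      have a0: "a ?y \<noteq> 0" using ax by simp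
      have "((\<lambda>y. b y / a y) has_derivative (\<lambda>v. (frechet_derivative b (at ?y) v * a ?y - b ?y * frechet_derivative a (at ?y) v) / (a ?y * a ?y))) (at ?y)"
        by (rule has_derivative_divide'[OF smooth_on_has_derivative[OF b yS] smooth_on_has_derivative[OF a yS] a0])
      from frechet_derivative_at[OF this, symmetric]
      have "?b * a ?y - b ?y * ?a = 0" using 0 a0 by simp
      \<comment> \<open>The numerator in the quotient rule vanishes, so the derivatives of
        \<open>a\<close> and \<open>b\<close> along \<open>w\<close> are proportional to
        \<open>a\<close> and \<open>b\<close>, with the common factor
        \<open>?a / a ?y\<close>.\<close>
      then have b: "?b = (?a / a ?y) * b ?y" using a0 by (simp add: field_simps)
      have pw: "frechet_derivative p (at y) (vrep Q c w y) = 0" if y: "y \<in> S" for y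
      proof -
        obtain z where z: "z \<in> V0" "y = snd c z" using SD[OF y] by blast
        have "w z \<in> W z" using Ww[OF V0D(2)[OF z(1)]] by (simp add: span_base)
        then have "mderiv Q N P z (w z) = 0" using ker[OF V0D(3)[OF z(1)]] by simp
        then show ?thesis unfolding z(2) Dp[OF z(1)] using linear_0[OF lin_e[OF z(1)]] by simp
      qed
      have br: "?br = frechet_derivative (vrep Q c r) (at ?y) (vrep Q c w ?y)
          - frechet_derivative (vrep Q c w) (at ?y) (vrep Q c r ?y)"
        unfolding lie_bracket_vrep cx[symmetric] Let_def ..
      have "frechet_derivative p (at ?y) ?br = ?a *\<^sub>R vrep N e X (p ?y) + ?b *\<^sub>R vrep N e Y (p ?y)"
        using derivative_along_bracket[OF sp sw sr yS pw ab a \<open>smooth_on S b\<close> sX sY pT] unfolding br at .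
      also have "\<dots> = (?a / a ?y) *\<^sub>R frechet_derivative p (at ?y) (vrep Q c r ?y)"
        unfolding ab[OF yS] scaleR_add_right scaleR_scaleR b[symmetric] using a0 by simp
      \<comment> \<open>With this factor dP([w, r]) is a multiple of dP(r). Subtracting the same
        multiple of \<open>r\<close> from the bracket leaves a vector in the kernel, that is, in
        \<open>W\<close>.\<close>
      finally have "frechet_derivative p (at ?y) (?br - (?a / a ?y) *\<^sub>R r x) = 0"
        by (simp add: at linear_diff[OF smooth_on_linear_derivative[OF sp yS]]
            linear_scale[OF smooth_on_linear_derivative[OF sp yS]])
      then obtain k where "?br - (?a / a ?y) *\<^sub>R r x = k *\<^sub>R w x"
        unfolding kerp Ww[OF U0(2)] by (auto simp: span_singleton)
      then have "?br = k *\<^sub>R w x + (?a / a ?y) *\<^sub>R r x" by (simp add: algebra_simps)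
      then have "?br \<in> D x" unfolding Dwr[OF U0(2)] span_pair_iff by blast
      moreover have "?br \<notin> D x"
        by (rule lie_bracket_frame_notin[OF Q E U0(2) vf]) (rule ind Dwr, assumption+)+
      ultimately show False by blast
    qed
    moreover have "linear ?ba" by (rule smooth_on_linear_derivative[OF sba yO])
    \<comment> \<open>A vector killed by the base component lies on the line \<open>W x\<close>, and
      on this line the fibre component is injective.\<close>
    ultimately have "v = 0" if "frechet_derivative p (at ?y) v = 0" "?ba v = 0" for v
      using that unfolding kerp Ww[OF U0(2)] by (auto simp: span_singleton linear_scale)
    then show ?thesis unfolding linear_injective_0[OF lh] unfolding dh by (simp add: zero_prod_def)
  qed
  then show thesis using that V xV Vd sm by blast
qed

lemma smooth_\<Phi>:
  assumes U: "openin (mtop Q) U"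
  shows "smooth_map_on Q B U \<Phi>"
  unfolding smooth_map_on_def
proof (intro conjI ballI)
  have UQ: "U \<subseteq> mcarrier Q" by (rule openin_mtop_subset[OF U])
  show "\<Phi> ` U \<subseteq> mcarrier B" using \<Phi>_in_prolongation UQ by blast
  fix c d assume c: "c \<in> Q" and d: "d \<in> B"
  show "smooth_on (snd c ` (fst c \<inter> U \<inter> \<Phi> -` fst d)) (snd d \<circ> \<Phi> \<circ> chart_inv c)"
  proof (rule smooth_on_locally)
    fix y assume "y \<in> snd c ` (fst c \<inter> U \<inter> \<Phi> -` fst d)"
    then obtain x where x: "x \<in> fst c" "x \<in> U" "\<Phi> x \<in> fst d" "y = snd c x" by blast
    then have xQ: "x \<in> mcarrier Q" using UQ by blast
    obtain V where V: "openin (mtop Q) V" "x \<in> V" "V \<subseteq> fst c \<inter> \<Phi> -` fst d"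
      "smooth_on (snd c ` V) (snd d \<circ> \<Phi> \<circ> chart_inv c)"
      by (rule \<Phi>_in_charts[OF xQ c x(1) d x(3)]) (rule that, assumption+)
    have eq: "fst c \<inter> (V \<inter> U) = V \<inter> U" using V(3) by blast
    have "open (snd c ` (V \<inter> U))"
      using open_chart_image[OF Q c openin_Int[OF V(1) U]] unfolding eq .
    then have "smooth_on (snd c ` (V \<inter> U)) (snd d \<circ> \<Phi> \<circ> chart_inv c)"
      by (rule smooth_on_subset[OF V(4)]) blast
    then show "\<exists>T. y \<in> T \<and> T \<subseteq> snd c ` (fst c \<inter> U \<inter> \<Phi> -` fst d) \<and>
        smooth_on T (snd d \<circ> \<Phi> \<circ> chart_inv c)"
      using x V(2,3) by (intro exI[of _ "snd c ` (V \<inter> U)"]) blast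
  qed
qed (rule U)

text \<open>Replacing the source chart composes the derivative with the isomorphism
  \<open>tvec\<close>, which transfers injectivity from the preferred chart to any other.\<close>

lemma inj_cderiv_\<Phi>:
  assumes x: "x \<in> mcarrier Q" and c: "c \<in> Q" "x \<in> fst c" and d: "d \<in> B" "\<Phi> x \<in> fst d"
  shows "inj (cderiv c d \<Phi> x)"
proof -
  let ?c = "chart_at Q x"
  note iQ = smooth_atlas_inj_atlas[OF Q] and s\<Phi> = smooth_\<Phi>[OF openin_mcarrier]
  have "inj (frechet_derivative (snd d \<circ> \<Phi> \<circ> chart_inv ?c) (at (snd ?c x)))"
    by (rule \<Phi>_in_charts[OF x chart_atD[OF x] d]) simp
  then have inj: "inj (cderiv ?c d \<Phi> x)" unfolding cderiv_def .
  have "cderiv c d (\<Phi> \<circ> id) x v = cderiv ?c d \<Phi> (id x) (tvec Q c x v)" for v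
    unfolding tvec_cderiv
    by (rule cderiv_compose[OF smooth_map_on_id[OF Q] s\<Phi> iQ iQ]) (simp_all add: x c d chart_atD)
  then have eq: "cderiv c d \<Phi> x = cderiv ?c d \<Phi> x \<circ> tvec Q c x" by auto
  have "inj (tvec Q c x)" by (rule inj_on_inverseI[of _ "tcoord Q c x"]) (rule tvec_tcoord(2)[OF Q c])
  then show ?thesis unfolding eq by (rule inj_compose[OF inj])
qed

text \<open>Source and target both have dimension four, so an injective derivative suffices for the
  inverse function theorem; one pair of charts yields \<open>U\<close>. Smoothness of the inverse is
  verified in every pair of charts, the derivative being injective in each of them.\<close>

lemma local_diffeo_\<Phi>: "local_diffeo Q B \<Phi>"
  unfolding local_diffeo_def
proof
  fix x assume x: "x \<in> mcarrier Q"
  obtain c where c: "c \<in> Q" "x \<in> fst c" using x by (auto simp: mcarrier_def)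
  obtain d where d: "d \<in> B" "\<Phi> x \<in> fst d" using \<Phi>_in_prolongation[OF x] by (auto simp: mcarrier_def)
  have injQ: "inj_on (snd c) (fst c)" if "c \<in> Q" for c using Q that by (simp add: smooth_atlas_def)
  have injB: "inj_on (snd d) (fst d)" if "d \<in> B" for d
    using inj_atlas_cartan[OF N \<xi>] that by (simp add: inj_atlas_def)
  have dim: "DIM((real ^ 3) \<times> real) = CARD(4)" by simp
  let ?f = "snd d \<circ> \<Phi> \<circ> chart_inv c" and ?S = "snd c ` (fst c \<inter> mcarrier Q \<inter> \<Phi> -` fst d)"
  have "snd c x \<in> ?S" using x c d by blast
  from local_inverse[OF dim smooth_map_on_rep[OF smooth_\<Phi>[OF openin_mcarrier] c(1) d(1)] this
      inj_cderiv_\<Phi>[OF x c d, unfolded cderiv_def]]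
  obtain O' where O': "open O'" "snd c x \<in> O'" "O' \<subseteq> ?S" "open (?f ` O')" "inj_on ?f O'" by metis
  define U where "U = fst c \<inter> snd c -` O'"
  have U: "openin (mtop Q) U" unfolding U_def by (rule openin_mtop_chart[OF c(1) O'(1)])
  have xU: "x \<in> U" using c O' by (simp add: U_def)
  have UD: "z \<in> fst c" "z \<in> mcarrier Q" "\<Phi> z \<in> fst d" "?f (snd c z) = snd d (\<Phi> z)" if z: "z \<in> U" for z
  proof -
    show zc: "z \<in> fst c" using z by (simp add: U_def)
    have "snd c z \<in> ?S" using z O'(3) by (auto simp: U_def)
    then obtain z' where "z' \<in> fst c" "z' \<in> mcarrier Q" "\<Phi> z' \<in> fst d" "snd c z = snd c z'" by auto
    moreover from this have "z = z'" using inj_onD[OF injQ[OF c(1)] _ zc] by blast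
    ultimately show "z \<in> mcarrier Q" "\<Phi> z \<in> fst d" by simp_all
    show "?f (snd c z) = snd d (\<Phi> z)" by (simp add: chart_inv_left[OF injQ[OF c(1)] zc])
  qed
  have inj\<Phi>: "inj_on \<Phi> U"
  proof (rule inj_onI)
    fix z z' assume z: "z \<in> U" "z' \<in> U" and eq: "\<Phi> z = \<Phi> z'"
    have "?f (snd c z) = ?f (snd c z')" using UD(4)[OF z(1)] UD(4)[OF z(2)] eq by simp
    then have "snd c z = snd c z'" using inj_onD[OF O'(5)] z by (simp add: U_def)
    then show "z = z'" using inj_onD[OF injQ[OF c(1)]] UD(1)[OF z(1)] UD(1)[OF z(2)] by blast
  qed
  define V where "V = \<Phi> ` U"
  \<comment> \<open>As the preimage of an open set under a chart, the image is a generator of the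
    topology of the prolongation and hence open.\<close>
  have V_eq: "V = fst d \<inter> snd d -` (?f ` O')"
  proof
    show "V \<subseteq> fst d \<inter> snd d -` (?f ` O')"
    proof
      fix u assume "u \<in> V"
      then obtain z where z: "z \<in> U" "u = \<Phi> z" by (auto simp: V_def)
      then have "snd d u = ?f (snd c z)" "snd c z \<in> O'" using UD(4)[OF z(1)] by (simp_all add: U_def)
      then show "u \<in> fst d \<inter> snd d -` (?f ` O')" using UD(3)[OF z(1)] z(2) by blast
    qed
    show "fst d \<inter> snd d -` (?f ` O') \<subseteq> V"
    proof
      fix u assume "u \<in> fst d \<inter> snd d -` (?f ` O')"
      then obtain y where u: "u \<in> fst d" "snd d u = ?f y" "y \<in> O'" by blast
      then obtain z where z: "z \<in> fst c" "y = snd c z" using O'(3) by blast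
      then have zU: "z \<in> U" using u by (simp add: U_def)
      then have "snd d u = snd d (\<Phi> z)" using u(2) z(2) UD(4) by simp
      then have "u = \<Phi> z" using inj_onD[OF injB[OF d(1)]] u(1) UD(3)[OF zU] by blast
      then show "u \<in> V" using zU by (simp add: V_def)
    qed
  qed
  have V: "openin (mtop B) V" unfolding V_eq by (rule openin_mtop_chart[OF d(1) O'(4)])
  have bij: "bij_betw \<Phi> U V" using inj\<Phi> by (simp add: bij_betw_def V_def)
  let ?g = "inv_into U \<Phi>"
  have g\<Phi>: "?g (\<Phi> z) = z" if "z \<in> U" for z using inv_into_f_f[OF inj\<Phi> that] .
  have "smooth_map_on B Q V ?g"
    unfolding smooth_map_on_def
  proof (intro conjI ballI)
    show "?g ` V \<subseteq> mcarrier Q" using g\<Phi> UD(2) by (auto simp: V_def)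
    fix d' c' assume d': "d' \<in> B" and c': "c' \<in> Q"
    \<comment> \<open>On \<open>?T\<close> the coordinate expression \<open>?h\<close> of \<Phi> is
      an injective immersion between equal dimensions, so its inverse is smooth. The fact
      \<open>eqT\<close> identifies its image with the set on which the inverse of \<Phi> has to be
      smooth in these charts.\<close>
    let ?T = "snd c' ` (fst c' \<inter> U \<inter> \<Phi> -` fst d')" and ?h = "snd d' \<circ> \<Phi> \<circ> chart_inv c'"
    have hz: "?h (snd c' z) = snd d' (\<Phi> z)" if "z \<in> fst c'" for z
      by (simp add: chart_inv_left[OF injQ[OF c'] that])
    have sh: "smooth_on ?T ?h" by (rule smooth_map_on_rep[OF smooth_\<Phi>[OF U] c' d'])
    have injh: "inj_on ?h ?T"
    proof (rule inj_onI)
      fix y y' assume "y \<in> ?T" "y' \<in> ?T" and eq: "?h y = ?h y'"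
      then obtain z z' where z: "z \<in> fst c'" "z \<in> U" "\<Phi> z \<in> fst d'" "y = snd c' z"
        and z': "z' \<in> fst c'" "z' \<in> U" "\<Phi> z' \<in> fst d'" "y' = snd c' z'" by blast
      then have "snd d' (\<Phi> z) = snd d' (\<Phi> z')" using eq hz by simp
      then have "\<Phi> z = \<Phi> z'" using inj_onD[OF injB[OF d']] z(3) z'(3) by blast
      then show "y = y'" using inj_onD[OF inj\<Phi> _ z(2) z'(2)] z(4) z'(4) by simp
    qed
    have "inj (frechet_derivative ?h (at y))" if y: "y \<in> ?T" for y
    proof -
      obtain z where z: "z \<in> fst c'" "z \<in> U" "\<Phi> z \<in> fst d'" "y = snd c' z" using y by blast
      show ?thesis using inj_cderiv_\<Phi>[OF UD(2)[OF z(2)] c' z(1) d' z(3)] unfolding cderiv_def z(4) .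
    qed
    from smooth_inverse[OF dim sh injh this] have inv: "smooth_on (?h ` ?T) (inv_into ?T ?h)" .
    have eqT: "?h ` ?T = snd d' ` (fst d' \<inter> V \<inter> ?g -` fst c')"
    proof
      show "?h ` ?T \<subseteq> snd d' ` (fst d' \<inter> V \<inter> ?g -` fst c')"
      proof
        fix u assume "u \<in> ?h ` ?T"
        then obtain z where z: "z \<in> fst c'" "z \<in> U" "\<Phi> z \<in> fst d'" "u = ?h (snd c' z)" by blast
        then have "u = snd d' (\<Phi> z)" "\<Phi> z \<in> V" "?g (\<Phi> z) \<in> fst c'"
          using hz g\<Phi> by (simp_all add: V_def)
        then show "u \<in> snd d' ` (fst d' \<inter> V \<inter> ?g -` fst c')" using z(3) by blast
      qed
      show "snd d' ` (fst d' \<inter> V \<inter> ?g -` fst c') \<subseteq> ?h ` ?T"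
      proof
        fix u assume "u \<in> snd d' ` (fst d' \<inter> V \<inter> ?g -` fst c')"
        then obtain z where z: "z \<in> U" "\<Phi> z \<in> fst d'" "?g (\<Phi> z) \<in> fst c'" "u = snd d' (\<Phi> z)"
          unfolding V_def by blast
        then have zc: "z \<in> fst c'" using g\<Phi> by simp
        then have "u = ?h (snd c' z)" using hz z(4) by simp
        then show "u \<in> ?h ` ?T" using zc z(1,2) by blast
      qed
    qed
    have "smooth_on (?h ` ?T) (snd c' \<circ> ?g \<circ> chart_inv d')"
    proof (rule smooth_on_cong[OF inv])
      fix u assume "u \<in> ?h ` ?T"
      then obtain z where z: "z \<in> fst c'" "z \<in> U" "\<Phi> z \<in> fst d'" "u = ?h (snd c' z)" by blast
      have "inv_into ?T ?h u = snd c' z"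
        unfolding z(4) by (rule inv_into_f_f[OF injh]) (use z in blast)
      moreover have "(snd c' \<circ> ?g \<circ> chart_inv d') u = snd c' z"
        unfolding z(4) hz[OF z(1)] using chart_inv_left[OF injB[OF d'] z(3)] g\<Phi>[OF z(2)] by simp
      ultimately show "inv_into ?T ?h u = (snd c' \<circ> ?g \<circ> chart_inv d') u" by simp
    qed
    then show "smooth_on (snd d' ` (fst d' \<inter> V \<inter> ?g -` fst c')) (snd c' \<circ> ?g \<circ> chart_inv d')"
      unfolding eqT .
  qed (rule V)
  then show "\<exists>U V. openin (mtop Q) U \<and> x \<in> U \<and> openin (mtop B) V \<and>
        bij_betw \<Phi> U V \<and> smooth_map_on Q B U \<Phi> \<and> smooth_map_on B Q V (inv_into U \<Phi>)"
    using U xU V bij smooth_\<Phi>[OF U] by blast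
qed

lemma mderiv_\<Phi>_image:
  assumes x: "x \<in> mcarrier Q"
  shows "mderiv Q B \<Phi> x ` D x = cartan_engel N \<xi> (\<Phi> x)"
proof -
  note s\<Phi> = smooth_\<Phi>[OF openin_mcarrier] and \<Phi>B = \<Phi>_in_prolongation[OF x]
  obtain U w r where U: "x \<in> U" and Ww: "\<And>y. y \<in> U \<Longrightarrow> W y = span {w y}"
    and Rr: "\<And>y. y \<in> U \<Longrightarrow> R y = ray (r y)" and Dwr: "\<And>y. y \<in> U \<Longrightarrow> D y = span {w y, r y}"
    by (rule local_fields[OF x]) (rule that, assumption+)
  let ?dP = "mderiv Q N P x" and ?d\<Phi> = "mderiv Q B \<Phi> x" and ?d\<pi> = "mderiv B N fst (\<Phi> x)"
  have "mderiv Q N (fst \<circ> \<Phi>) x = ?dP"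
    by (rule mderiv_cong[OF Q x openin_mcarrier]) (simp add: \<Phi>)
  then have chain: "?d\<pi> (?d\<Phi> v) = ?dP v" for v
    using mderiv_compose[OF s\<Phi> smooth_map_on_cartan_fst[OF N \<xi>] smooth_atlas_inj_atlas[OF Q]
        inj_atlas_cartan[OF N \<xi>] x \<Phi>B, of v] by simp
  have engel: "cartan_engel N \<xi> (\<Phi> x) = {u. ?d\<pi> u \<in> span {?dP (r x)}}"
    unfolding cartan_engel_def \<Phi>_ray[OF x Rr[OF U]] by (auto simp: span_ray)
  note lin = linear_dP[OF x]
  have kw: "?dP (w x) = 0" using ker[OF x] Ww[OF U] by (simp add: span_base)
  \<comment> \<open>\<open>D\<close> is the full preimage of the line and not merely mapped into it:
    a vector with image in the line differs from a multiple of \<open>r\<close> by an element of the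
    kernel \<open>W\<close>, which \<open>D\<close> contains.\<close>
  have DdP: "v \<in> D x \<longleftrightarrow> ?dP v \<in> span {?dP (r x)}" for v
  proof
    assume "v \<in> D x"
    then obtain a b where "v = a *\<^sub>R w x + b *\<^sub>R r x" unfolding Dwr[OF U] span_pair_iff by blast
    then have "?dP v = b *\<^sub>R ?dP (r x)" using kw by (simp add: linear_add[OF lin] linear_scale[OF lin])
    then show "?dP v \<in> span {?dP (r x)}" by (simp add: span_base span_scale)
  next
    assume "?dP v \<in> span {?dP (r x)}"
    then obtain b where "?dP v = b *\<^sub>R ?dP (r x)" by (auto simp: span_singleton)
    then have "?dP (v - b *\<^sub>R r x) = 0" by (simp add: linear_diff[OF lin] linear_scale[OF lin])
    then obtain a where "v - b *\<^sub>R r x = a *\<^sub>R w x"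
      unfolding ker[OF x] Ww[OF U] by (auto simp: span_singleton)
    then have "v = a *\<^sub>R w x + b *\<^sub>R r x" by (simp add: algebra_simps)
    then show "v \<in> D x" unfolding Dwr[OF U] span_pair_iff by blast
  qed
  have "inj ?d\<Phi>"
    unfolding mderiv_cderiv by (rule inj_cderiv_\<Phi>[OF x chart_atD[OF x] chart_atD[OF \<Phi>B]])
  \<comment> \<open>Equal dimensions make the injective d\<Phi> surjective. Hence each vector of the
    Engel plane is an image, and by \<open>chain\<close> and \<open>DdP\<close> it comes from
    \<open>D\<close>.\<close>
  then have "surj ?d\<Phi>"
    using linear_injective_imp_surjective[of ?d\<Phi>] linear_mderiv[OF s\<Phi> x] by simp
  then show ?thesis
    unfolding engel using DdP chain by (auto simp: surj_def image_iff) metis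
qed

end

section \<open>Identification with the leaf space and conclusion\<close>

lemma diffeo_mderiv_eq_0:
  assumes A: "smooth_atlas A" and B: "smooth_atlas B" and f: "diffeo A B f" and x: "x \<in> mcarrier A"
    and v: "mderiv A B f x v = 0"
  shows "v = 0"
proof -
  let ?g = "inv_into (mcarrier A) f"
  have sf: "smooth_map_on A B (mcarrier A) f" and sg: "smooth_map_on B A (mcarrier B) ?g"
    and bij: "bij_betw f (mcarrier A) (mcarrier B)"
    using f unfolding diffeo_def by blast+
  have fx: "f x \<in> mcarrier B" by (rule smooth_map_on_into[OF sf x])
  have "mderiv A A (?g \<circ> f) x = mderiv A A id x"
    by (rule mderiv_cong[OF A x openin_mcarrier]) (use bij in \<open>simp add: bij_betw_def\<close>)
  then have "v = mderiv A A (?g \<circ> f) x v" by (simp add: mderiv_id[OF A x])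
  also have "\<dots> = mderiv B A ?g (f x) (mderiv A B f x v)"
    by (rule mderiv_compose[OF sf sg smooth_atlas_inj_atlas[OF A] smooth_atlas_inj_atlas[OF B] x fx])
  also have "\<dots> = 0" unfolding v by (rule linear_0[OF linear_mderiv[OF sg fx]])
  finally show ?thesis .
qed

theorem corollary4p14:
  fixes N :: "('n, real ^ 3) atlas" and \<xi> :: "'n \<Rightarrow> (real ^ 3) set"
    and A :: "('m, 'e::euclidean_space) atlas" and g :: "'m \<Rightarrow> 'e \<Rightarrow> 'e \<Rightarrow> real"
    and fut :: "'m \<Rightarrow> 'e set"
    and C :: "('m \<times> 'e, 'h::euclidean_space) atlas"
    and NG :: "('m set, 'k::euclidean_space) atlas" and H :: "'m set \<Rightarrow> 'k set"
    and Q :: "('q, real ^ 4) atlas" and D W R :: "'q \<Rightarrow> (real ^ 4) set"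
    and L :: "('q set, real ^ 3) atlas" and \<psi> :: "'q set \<Rightarrow> 'n"
    and M :: "('q set, real ^ 3) atlas"
  defines "E \<equiv> dist_bracket Q D D"
    and "p \<equiv> leaf Q W"
    and "F \<equiv> leaf_space Q (unoriented R)"
    and "q \<equiv> leaf Q (unoriented R)"
    and "\<Phi> \<equiv> prolongation_map Q W R L N \<psi>"
  assumes "smooth_manifold N" and "contact_structure N \<xi>"
    and "spacetime A g fut"
    and "null_geodesic_manifold A g fut C NG"
    and "null_geodesic_contact A g fut NG H"
    and "contactomorphic N \<xi> NG H"
    and "smooth_manifold Q" and "engel_structure Q D" and "engel_kernel Q D W"
    and "leaf_manifold Q W L"
    and "diffeo L N \<psi>"
    and "\<forall>x\<in>mcarrier Q. mderiv L N \<psi> (p x) ` (mderiv Q L p x ` E x) = \<xi> (\<psi> (p x))"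
    and "oriented_circle_foliation Q R"
    and i: "\<forall>S\<in>F. \<forall>x\<in>S. direct_sum (unoriented R x) (W x) (D x)"
    and ii: "leaf_manifold Q (unoriented R) M"
    and iii: "\<forall>S\<in>F. is_null_cone (\<Union>x\<in>S. mderiv Q M q x ` D x) \<and>
                      inj_on (\<lambda>x. mderiv Q M q x ` D x) S"
  shows "local_diffeo Q (cartan_atlas N \<xi>) \<Phi> \<and>
         (\<forall>x\<in>mcarrier Q. mderiv Q (cartan_atlas N \<xi>) \<Phi> x ` D x = cartan_engel N \<xi> (\<Phi> x))"
proof -
  let ?P = "\<psi> \<circ> p"
  have Q: "smooth_atlas Q" and N: "smooth_atlas N" and L: "smooth_atlas L"
    using \<open>smooth_manifold Q\<close> \<open>smooth_manifold N\<close> \<open>leaf_manifold Q W L\<close> smooth_manifold_smooth_atlas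
    by (auto simp: leaf_manifold_def)
  have DQ: "distribution Q 2 D" and E: "distribution Q 3 E"
    using \<open>engel_structure Q D\<close> unfolding engel_structure_def E_def by blast+
  have W: "distribution Q 1 W" using \<open>engel_kernel Q D W\<close> by (simp add: engel_kernel_def)
  have R: "oriented_line_field Q R" using \<open>oriented_circle_foliation Q R\<close> by (simp add: oriented_circle_foliation_def)
  have \<xi>: "distribution N 2 \<xi>" using \<open>contact_structure N \<xi>\<close> by (simp add: contact_structure_def)
  have p: "smooth_map_on Q L (mcarrier Q) p"
    using \<open>leaf_manifold Q W L\<close> by (simp add: leaf_manifold_def submersion_def p_def)
  have \<psi>: "smooth_map_on L N (mcarrier L) \<psi>" using \<open>diffeo L N \<psi>\<close> unfolding diffeo_def by blast
  note iQ = smooth_atlas_inj_atlas[OF Q] and iL = smooth_atlas_inj_atlas[OF L]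
  have P: "smooth_map_on Q N (mcarrier Q) ?P"
    by (rule smooth_map_on_compose[OF iQ L p \<psi>]) (use smooth_map_on_into[OF p] in blast)
  have dP: "mderiv Q N ?P x v = mderiv L N \<psi> (p x) (mderiv Q L p x v)" if "x \<in> mcarrier Q" for x v
    by (rule mderiv_compose[OF p \<psi> iQ iL that smooth_map_on_into[OF p that]])
  \<comment> \<open>The differential of the diffeomorphism \<psi> is injective, so the composite has
    the same kernel as the leaf projection.\<close>
  have ker: "mderiv Q N ?P x v = 0 \<longleftrightarrow> v \<in> W x" if x: "x \<in> mcarrier Q" for x v
  proof -
    have px: "p x \<in> mcarrier L" by (rule smooth_map_on_into[OF p x])
    have "mderiv L N \<psi> (p x) u = 0 \<longleftrightarrow> u = 0" for u
      using diffeo_mderiv_eq_0[OF L N \<open>diffeo L N \<psi>\<close> px] linear_0[OF linear_mderiv[OF \<psi> px]] by blast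
    then show ?thesis
      using mderiv_leaf_eq_0_iff[OF \<open>smooth_manifold Q\<close> W \<open>leaf_manifold Q W L\<close> _ x, of v, folded p_def]
      by (simp add: dP[OF x])
  qed
  \<comment> \<open>Condition i) is stated leaf by leaf; every point belongs to its own
    leaf.\<close>
  have sum: "direct_sum (unoriented R x) (W x) (D x)" if x: "x \<in> mcarrier Q" for x
  proof -
    have "x \<in> leaf Q (unoriented R) x"
      by (rule leaf_refl[of x Q "unoriented R", OF x]) (simp add: unoriented_def)
    moreover have "leaf Q (unoriented R) x \<in> F" using x by (simp add: F_def leaf_space_def)
    ultimately show ?thesis using i by blast
  qed
  have PR: "mderiv Q N ?P x v \<in> \<xi> (?P x)" if x: "x \<in> mcarrier Q" and v: "v \<in> R x" for x v
  proof -
    \<comment> \<open>Adding the zero of \<open>W x\<close> exhibits the circle direction as an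
      element of \<open>D x\<close>. This lies in \<open>E x\<close>, which is mapped onto the
      contact plane.\<close>
    have "0 \<in> W x" by (rule subspace_0[OF distribution_subspace[OF W x]])
    moreover have "v \<in> unoriented R x" using v by (simp add: unoriented_def span_base)
    ultimately have "v + 0 \<in> D x" using sum[OF x] unfolding direct_sum_def by blast
    then have "v \<in> E x"
      using distribution_subset_dist_bracket[OF Q DQ _ x] unfolding E_def by auto
    then have "mderiv L N \<psi> (p x) (mderiv Q L p x v) \<in> \<xi> (\<psi> (p x))"
      using \<open>\<forall>x\<in>mcarrier Q. _ x = \<xi> (\<psi> (p x))\<close> x by blast
    then show ?thesis by (simp add: dP[OF x])
  qed
  interpret circle_engel Q N \<xi> D W R ?P \<Phi>
  proof
    show "\<Phi> x = (?P x, mderiv Q N ?P x ` R x)" if "x \<in> mcarrier Q" for x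
      unfolding \<Phi>_def prolongation_map_def p_def[symmetric] Let_def by (simp add: dP[OF that])
  qed (fact Q N \<xi> P ker W R sum E[unfolded E_def] PR)+
  show ?thesis using local_diffeo_\<Phi> mderiv_\<Phi>_image by blast
qed

end
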